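(* Let $\nu>0$ and $R>0$. For every $q>0$ and $V\in\mathbb R$, the viscous drag force $\mathbf F$ exerted by the Stokes flow on the disk $\mathcal B_q$ moving with velocity $\mathbf V=V\mathbf e_2$ (as defined in the context) satisfies $\mathbf F=-n(q)\mathbf V$, where $$n(q)=3\sqrt 2\,\pi\,\nu\left(\frac{R}{q}\right)^{3/2}\left[1+\varepsilon(q)\right],$$ with $\varepsilon(q)\to 0$ when $q\to 0$.
   Context: Let $\Omega=\{(x,y)\in\mathbb R^2: y>0\}$ be the half plane, with boundary $\partial\Omega=\{(x,0):x\in\mathbb R\}$, and $\mathbf e_2=(0,1)$. For $q>0$ let $\mathcal B_q=B((0,R+q),R)$ be the disk of radius $R$ at distance $q$ from $\partial\Omega$, and $\mathcal F_q=\Omega\setminus\overline{\mathcal B_q}$ the fluid domain. For $V\in\mathbb R$ and $\mathbf V=V\mathbf e_2$, let $(\mathbf u,p)$ be the solution of the Stokes system $$-\nu\Delta\mathbf u+\nabla p=0,\quad \nabla\cdot\mathbf u=0 \ \text{ in }\mathcal F_q,\qquad \mathbf u=0\ \text{ on }\partial\Omega,\qquad \mathbf u=\mathbf V\ \text{ on }\partial\mathcal B_q,$$ with zero boundary condition at infinity for $\mathbf u$. The functional framework is the following: $\mathbf u$, extended by $\mathbf V$ inside $\mathcal B_q$, belongs to $$D^{1,2}_0(\Omega)=\{\mathbf w\in L^1_{loc}(\Omega):\ \nabla\mathbf w\in L^2(\Omega),\ \operatorname{div}\mathbf w=0\text{ in }\Omega,\ \mathbf w=0\text{ on }\partial\Omega\}$$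 (vector fields with values in $\mathbb R^2$). In this framework the system is well-posed: there is a unique solution $(\mathbf u,p)$, with $p$ unique up to an additive constant, and it is smooth on $\overline{\mathcal F_q}$. The viscous drag force on the disk is $$\mathbf F=\int_{\partial\mathcal B_q}(2\nu D(\mathbf u)-pI)\,\mathbf n\,d\sigma,$$ where $D(\mathbf u)=\frac12(\nabla\mathbf u+\nabla\mathbf u^{T})$ and $\mathbf n$ is the unit normal on $\partial\mathcal B_q$ directed towards the fluid domain $\mathcal F_q$. *)

theory Defs
  imports "HOL-Analysis.Analysis"
begin

section \<open>Smoothness and differential operators\<close>

text \<open>
  Derivatives are taken within the set itself, so that on the closure of a domain with smooth
  boundary this is smoothness up to the boundary (with one-sided derivatives at boundary points).
  It is only meant for sets on which derivatives within the set are unique, such as open sets and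
  closures of smooth domains; elsewhere the library's choice of a derivative is arbitrary.
\<close>

primrec Ck_on :: "nat \<Rightarrow> ('a::euclidean_space \<Rightarrow> 'b::real_normed_vector) \<Rightarrow> 'a set \<Rightarrow> bool" where
  "Ck_on 0 f S \<longleftrightarrow> continuous_on S f"
| "Ck_on (Suc k) f S \<longleftrightarrow> f differentiable_on S \<and>
     (\<forall>b\<in>Basis. Ck_on k (\<lambda>x. frechet_derivative f (at x within S) b) S)"

definition smooth_on :: "('a::euclidean_space \<Rightarrow> 'b::real_normed_vector) \<Rightarrow> 'a set \<Rightarrow> bool" where
  "smooth_on f S \<longleftrightarrow> (\<forall>k. Ck_on k f S)"

definition partial_deriv :: "2 \<Rightarrow> (real^2 \<Rightarrow> 'b::real_normed_vector) \<Rightarrow> real^2 \<Rightarrow> 'b" where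
  "partial_deriv i f x = frechet_derivative f (at x) (axis i 1)"

definition grad :: "(real^2 \<Rightarrow> real) \<Rightarrow> real^2 \<Rightarrow> real^2" where
  "grad f x = (\<chi> i. partial_deriv i f x)"

definition laplacian :: "(real^2 \<Rightarrow> 'b::real_normed_vector) \<Rightarrow> real^2 \<Rightarrow> 'b" where
  "laplacian f x = (\<Sum>i\<in>UNIV. partial_deriv i (partial_deriv i f) x)"

definition divergence :: "(real^2 \<Rightarrow> real^2) \<Rightarrow> real^2 \<Rightarrow> real" where
  "divergence u x = (\<Sum>i\<in>UNIV. partial_deriv i u x $ i)"


section \<open>Geometry\<close>

definition e2 :: "real^2" where
  "e2 = axis 2 1"

definition half_plane :: "(real^2) set" where
  "half_plane = {x. x $ 2 > 0}"

definition wall :: "(real^2) set" where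
  "wall = {x. x $ 2 = 0}"

definition disk_center :: "real \<Rightarrow> real \<Rightarrow> real^2" where
  "disk_center R q = vector [0, R + q]"

definition disk :: "real \<Rightarrow> real \<Rightarrow> (real^2) set" where
  "disk R q = ball (disk_center R q) R"

definition disk_boundary :: "real \<Rightarrow> real \<Rightarrow> (real^2) set" where
  "disk_boundary R q = sphere (disk_center R q) R"

definition fluid :: "real \<Rightarrow> real \<Rightarrow> (real^2) set" where
  "fluid R q = half_plane - closure (disk R q)"


section \<open>The space of divergence-free fields of finite Dirichlet energy\<close>

definition test_function :: "(real^2) set \<Rightarrow> (real^2 \<Rightarrow> real) \<Rightarrow> bool" where
  "test_function S \<phi> \<longleftrightarrow> smooth_on \<phi> UNIV \<and>
     compact (closure {x. \<phi> x \<noteq> 0}) \<and> closure {x. \<phi> x \<noteq> 0} \<subseteq> S"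

definition L1_loc :: "(real^2) set \<Rightarrow> (real^2 \<Rightarrow> 'b::euclidean_space) \<Rightarrow> bool" where
  "L1_loc S w \<longleftrightarrow> (\<forall>K. compact K \<and> K \<subseteq> S \<longrightarrow> w absolutely_integrable_on K)"

definition L2 :: "(real^2) set \<Rightarrow> (real^2 \<Rightarrow> 'b::euclidean_space) \<Rightarrow> bool" where
  "L2 S w \<longleftrightarrow> w \<in> borel_measurable (lebesgue_on S) \<and>
     (\<lambda>x. (norm (w x))\<^sup>2) absolutely_integrable_on S"

text \<open>Here \<open>G x $ i $ j\<close> is the weak derivative of the \<open>i\<close>-th component in direction \<open>j\<close>.\<close>

definition weak_gradient ::
    "(real^2) set \<Rightarrow> (real^2 \<Rightarrow> real^2) \<Rightarrow> (real^2 \<Rightarrow> real^2^2) \<Rightarrow> bool" where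
  "weak_gradient S w G \<longleftrightarrow> L1_loc S G \<and>
     (\<forall>\<phi> i j. test_function S \<phi> \<longrightarrow>
        (LINT x:S|lebesgue. w x $ i * partial_deriv j \<phi> x) =
        - (LINT x:S|lebesgue. G x $ i $ j * \<phi> x))"

text \<open>
  Vanishing trace on the wall: the averages of \<open>norm w\<close> over the half disks
  centred at almost every wall point tend to zero.  For locally integrable fields with
  square-integrable weak gradient, which are integrable on bounded parts of the half plane, the
  trace is the limit of such averages almost everywhere.
\<close>

definition zero_trace_on_wall :: "(real^2 \<Rightarrow> real^2) \<Rightarrow> bool" where
  "zero_trace_on_wall w \<longleftrightarrow>
     (AE s in lborel.
        ((\<lambda>r. (LINT x:(half_plane \<inter> ball (vector [s, 0]) r)|lebesgue. norm (w x))
              / measure lebesgue (half_plane \<inter> ball (vector [s, 0]) r))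
         \<longlongrightarrow> 0) (at_right 0))"

definition D12_0 :: "(real^2 \<Rightarrow> real^2) set" where
  "D12_0 = {w. L1_loc half_plane w \<and>
     (\<exists>G. weak_gradient half_plane w G \<and> L2 half_plane G \<and>
          (AE x in lebesgue_on half_plane. trace (G x) = 0)) \<and>
     zero_trace_on_wall w}"


section \<open>Stokes flow around the disk and drag force\<close>

text \<open>
  The homogeneous condition at infinity is the one carried by membership in \<open>D12_0\<close>.
  Only the values of \<open>u\<close> and \<open>p\<close> on the closure of the fluid domain matter.
\<close>

definition stokes_solution ::
    "real \<Rightarrow> real \<Rightarrow> real \<Rightarrow> real \<Rightarrow> (real^2 \<Rightarrow> real^2) \<Rightarrow> (real^2 \<Rightarrow> real) \<Rightarrow> bool" where
  "stokes_solution \<nu> R q V u p \<longleftrightarrow>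
     smooth_on u (closure (fluid R q)) \<and>
     smooth_on p (closure (fluid R q)) \<and>
     (\<forall>x\<in>fluid R q. - (\<nu> *\<^sub>R laplacian u x) + grad p x = 0) \<and>
     (\<forall>x\<in>fluid R q. divergence u x = 0) \<and>
     (\<forall>x\<in>wall. u x = 0) \<and>
     (\<forall>x\<in>disk_boundary R q. u x = V *\<^sub>R e2) \<and>
     (\<lambda>x. if x \<in> disk R q then V *\<^sub>R e2 else u x) \<in> D12_0"

definition sym_gradient :: "real^2^2 \<Rightarrow> real^2^2" where
  "sym_gradient A = (1/2) *\<^sub>R (A + transpose A)"

text \<open>
  On the disk boundary the velocity gradient is the one-sided derivative from the fluid;
  \<open>mat (p x)\<close> is the scalar matrix with diagonal entries \<open>p x\<close>.
\<close>

definition stress ::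
    "real \<Rightarrow> real \<Rightarrow> real \<Rightarrow> (real^2 \<Rightarrow> real^2) \<Rightarrow> (real^2 \<Rightarrow> real) \<Rightarrow> real^2 \<Rightarrow> real^2^2" where
  "stress \<nu> R q u p x =
     (2 * \<nu>) *\<^sub>R sym_gradient (jacobian u (at x within closure (fluid R q))) - mat (p x)"

text \<open>
  The boundary integral is written in the parametrisation of the circle by the angle \<open>t\<close>: the unit
  normal pointing into the fluid is \<open>(cos t, sin t)\<close> and the arc length element is \<open>R dt\<close>.
\<close>

definition drag_force ::
    "real \<Rightarrow> real \<Rightarrow> real \<Rightarrow> (real^2 \<Rightarrow> real^2) \<Rightarrow> (real^2 \<Rightarrow> real) \<Rightarrow> real^2" where
  "drag_force \<nu> R q u p =
     integral {0..2 * pi} (\<lambda>t. let n = vector [cos t, sin t]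
       in R *\<^sub>R (stress \<nu> R q u p (disk_center R q + R *\<^sub>R n) *v n))"

end

theory Submission
  imports Defs "HOL-Real_Asymp.Real_Asymp" "HOL-Computational_Algebra.Polynomial"
begin

text \<open>
  The exact drag coefficient is \<open>n(q) = 4 * pi * \<nu> / (\<alpha> - tanh \<alpha>)\<close> with \<open>cosh \<alpha> = 1 + q / R\<close>, and
  \<open>\<alpha> - tanh \<alpha> \<sim> \<alpha> ^ 3 / 3\<close>, \<open>\<alpha>\<^sup>2 \<sim> 2 * q / R\<close> give the asymptotics.

  Bipolar coordinates \<open>(x, y)\<close> map the strip \<open>0 < y < \<alpha>\<close> onto the fluid domain, \<open>y = 0\<close> being the wall,
  \<open>y = \<alpha>\<close> the circle and \<open>(0, 0)\<close> the point at infinity.  There the flows of a disk that moves with unit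
  velocity perpendicular or parallel to the wall are elementary functions.  The drag of an arbitrary
  solution follows from the reciprocal theorem, tested with these two flows.  To cut off at infinity
  without any control of the unknown pressure, one truncates the stream function of the test flow, so
  that the truncated field stays divergence-free; the work of the test stress is written with a
  primitive of that stress, so that the cutoff error involves only the gradient of the solution and
  tends to zero because the Dirichlet energy is finite and conformally invariant.  The force appears
  as the period of the (multivalued) primitive around the disk.
\<close>

section \<open>Calculus on a strip\<close>

text \<open>The obstacle is infinity. Of the solution only a finite Dirichlet integral is known
  there: no decay of \<open>u\<close>, no bound on \<open>p\<close>, and even this energy belongs to
  a weak gradient, which has to be identified with the classical one. No solution is constructed and
  no uniqueness is invoked; the force is determined for whatever pair satisfies
  \<open>stokes_solution\<close>. The wall is what makes the test flows usable: unlike in the whole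
  plane, a flow that exerts a force can vanish at infinity. Near the preimage (0, 0) of infinity,
  the velocity and the stress primitive are O(sqrt(\<open>bip_N\<close>)), that is, at most linear
  in (x, y), and the stream function stays bounded. This is just the rate at which all cutoff errors
  are bounded uniformly in the cutoff parameter, on a region whose area tends to zero. The parallel
  flow serves only to show that the drag has no horizontal component. The constant 3 sqrt 2 is 12 /
  (2 sqrt 2): it arises from 4 pi \<nu> / (\<alpha>^3 / 3) = 12 pi \<nu> / \<alpha>^3 with sqrt(2 q
  / R) in place of \<alpha>.\<close>

lemma continuous_on_slice:
  assumes "continuous_on (S \<times> T) (\<lambda>(x, y). f x y)" "y \<in> T"
  shows "continuous_on S (\<lambda>x. f x y)"
proof -
  have "continuous_on S (\<lambda>x. (\<lambda>(x, y). f x y) (x, y))"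
    by (rule continuous_on_compose2[OF assms(1)]) (use assms(2) in \<open>auto intro!: continuous_intros\<close>)
  then show ?thesis by simp
qed

lemma continuous_on_prod_swap:
  assumes "continuous_on (S \<times> T) (\<lambda>(x, y). f x y)"
  shows "continuous_on (T \<times> S) (\<lambda>(y, x). f x y)"
proof -
  have "continuous_on (T \<times> S) (\<lambda>p. (\<lambda>(x, y). f x y) (snd p, fst p))"
    by (rule continuous_on_compose2[OF assms]) (auto intro!: continuous_intros)
  then show ?thesis by (simp add: split_beta)
qed

text \<open>Fubini is avoided: the inner integral is differentiated in \<open>y\<close> under the integral sign.\<close>

lemma green_strip:
  fixes P Q Py Qx :: "real \<Rightarrow> real \<Rightarrow> real" and J :: "real \<Rightarrow> real"
  assumes "c < d" "0 < h"
    and Py: "\<And>x y. \<lbrakk>c \<le> x; x \<le> d; 0 < y; y < h\<rbrakk> \<Longrightarrow> ((\<lambda>y. P x y) has_real_derivative Py x y) (at y)"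
    and Qx: "\<And>x y. \<lbrakk>c \<le> x; x \<le> d; 0 < y; y < h\<rbrakk> \<Longrightarrow> ((\<lambda>x. Q x y) has_real_derivative Qx x y) (at x)"
    and cPy: "continuous_on ({c..d} \<times> {0<..<h}) (\<lambda>(x, y). Py x y)"
    and cQx: "continuous_on ({c..d} \<times> {0<..<h}) (\<lambda>(x, y). Qx x y)"
    and cP: "continuous_on ({c..d} \<times> {0..h}) (\<lambda>(x, y). P x y)"
    and cJ: "continuous_on {0..h} J"
    and J: "\<And>y. \<lbrakk>0 < y; y < h\<rbrakk> \<Longrightarrow> (J has_real_derivative (Q d y - Q c y)) (at y)"
    and E: "\<And>y0 y1. \<lbrakk>0 < y0; y0 < y1; y1 < h\<rbrakk> \<Longrightarrow>
         \<bar>integral {y0..y1} (\<lambda>y. integral {c..d} (\<lambda>x. Py x y - Qx x y))\<bar> \<le> E"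
  shows "\<bar>integral {c..d} (\<lambda>x. P x h) - integral {c..d} (\<lambda>x. P x 0) - (J h - J 0)\<bar> \<le> E"
proof -
  define \<Phi> where "\<Phi> y = integral {c..d} (\<lambda>x. P x y) - J y" for y
  note swap = continuous_on_prod_swap
  have cP': "continuous_on ({c..d} \<times> {0<..<h}) (\<lambda>(x, y). P x y)"
    by (rule continuous_on_subset[OF cP]) auto
  have c\<Phi>: "continuous_on {0..h} \<Phi>"
    unfolding \<Phi>_def using swap[OF cP]
    by (intro continuous_intros cJ integral_continuous_on_param[of _ c d, simplified]) auto
  have der: "(\<Phi> has_real_derivative integral {c..d} (\<lambda>x. Py x y - Qx x y)) (at y)"
    if y: "0 < y" "y < h" for y
  proof -
    have c1: "continuous_on {c..d} (\<lambda>x. Py x y)" "continuous_on {c..d} (\<lambda>x. Qx x y)"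
      using y continuous_on_slice[where f = Py, OF cPy] continuous_on_slice[where f = Qx, OF cQx] by auto
    have "((\<lambda>y. integral {c..d} (\<lambda>x. P x y)) has_real_derivative integral {c..d} (\<lambda>x. Py x y)) (at y within {0<..<h})"
    proof (rule leibniz_rule_field_derivative[of "{0<..<h}" c d "\<lambda>y x. P x y" "\<lambda>y x. Py x y", unfolded cbox_interval])
      show "(\<lambda>x. P x t) integrable_on {c..d}" if "t \<in> {0<..<h}" for t
        using that by (intro integrable_continuous_real continuous_on_slice[where f = P, OF cP']) auto
      show "continuous_on ({0<..<h} \<times> {c..d}) (\<lambda>(y, x). Py x y)" by (rule swap[OF cPy])
      show "((\<lambda>y. P x y) has_real_derivative Py x t) (at t within {0<..<h})"
        if "t \<in> {0<..<h}" "x \<in> {c..d}" for t x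
        using Py[of x t] that by (simp add: has_field_derivative_at_within)
    qed (use y in auto)
    then have 1: "((\<lambda>y. integral {c..d} (\<lambda>x. P x y)) has_real_derivative integral {c..d} (\<lambda>x. Py x y)) (at y)"
      using y at_within_open[of y "{0<..<h}"] by simp
    have "((\<lambda>x. Qx x y) has_integral (Q d y - Q c y)) {c..d}"
      using y \<open>c < d\<close> Qx
      by (intro fundamental_theorem_of_calculus)
        (auto simp: has_real_derivative_iff_has_vector_derivative[symmetric] intro: has_field_derivative_at_within)
    then have 2: "integral {c..d} (\<lambda>x. Qx x y) = Q d y - Q c y" by blast
    have "integral {c..d} (\<lambda>x. Py x y - Qx x y) = integral {c..d} (\<lambda>x. Py x y) - (Q d y - Q c y)"
      using c1 by (simp add: integral_diff integrable_continuous_real 2)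
    then show ?thesis unfolding \<Phi>_def using y by (auto intro!: derivative_eq_intros 1 J)
  qed
  have le: "\<bar>\<Phi> y1 - \<Phi> y0\<bar> \<le> E" if y: "0 < y0" "y0 < y1" "y1 < h" for y0 y1
  proof -
    have "((\<lambda>y. integral {c..d} (\<lambda>x. Py x y - Qx x y)) has_integral (\<Phi> y1 - \<Phi> y0)) {y0..y1}"
    proof (rule fundamental_theorem_of_calculus)
      show "(\<Phi> has_vector_derivative integral {c..d} (\<lambda>x. Py x z - Qx x z)) (at z within {y0..y1})"
        if "z \<in> {y0..y1}" for z
        using der[of z] y that
        by (simp add: has_real_derivative_iff_has_vector_derivative[symmetric] has_field_derivative_at_within)
    qed (use y in simp)
    then show ?thesis using E[OF y] by (simp add: integral_unique)
  qed
  \<comment> \<open>Derivatives and the bound \<open>E\<close> are available only inside the strip,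
    so the estimate passes to the boundary by continuity. The heights h / (n + 4) stay below h / 4,
    which keeps the lower one under the upper one for every n.\<close>
  have lims: "((\<lambda>n. \<Phi> (h - h / (real n + 4))) \<longlongrightarrow> \<Phi> h) sequentially"
     "((\<lambda>n. \<Phi> (h / (real n + 4))) \<longlongrightarrow> \<Phi> 0) sequentially"
  proof -
    have l: "(\<lambda>n. h / (real n + 4)) \<longlonglongrightarrow> 0" by real_asymp
    have l': "(\<lambda>n. h - h / (real n + 4)) \<longlonglongrightarrow> h" using tendsto_diff[OF tendsto_const l, of h] by simp
    have r: "h / (real n + 4) \<le> h" for n using \<open>0 < h\<close> by (simp add: field_simps)
    show "((\<lambda>n. \<Phi> (h - h / (real n + 4))) \<longlongrightarrow> \<Phi> h) sequentially"
      using \<open>0 < h\<close> by (intro continuous_on_tendsto_compose[OF c\<Phi> l']) (auto simp: r)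
    show "((\<lambda>n. \<Phi> (h / (real n + 4))) \<longlongrightarrow> \<Phi> 0) sequentially"
      using \<open>0 < h\<close> by (intro continuous_on_tendsto_compose[OF c\<Phi> l]) (auto simp: r)
  qed
  have "((\<lambda>n. \<bar>\<Phi> (h - h / (real n + 4)) - \<Phi> (h / (real n + 4))\<bar>) \<longlongrightarrow> \<bar>\<Phi> h - \<Phi> 0\<bar>) sequentially"
    by (intro tendsto_intros lims)
  moreover have "\<bar>\<Phi> (h - h / (real n + 4)) - \<Phi> (h / (real n + 4))\<bar> \<le> E" for n
  proof -
    have "h / (real n + 4) \<le> h / 4" "0 < h / (real n + 4)"
      using \<open>0 < h\<close> by (simp_all add: frac_le del: le_divide_eq_numeral1)
    then show ?thesis using \<open>0 < h\<close> by (intro le) linarith+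
  qed
  ultimately have le': "\<bar>\<Phi> h - \<Phi> 0\<bar> \<le> E" by (intro LIMSEQ_le_const2) auto
  have "integral {c..d} (\<lambda>x. P x h) - integral {c..d} (\<lambda>x. P x 0) - (J h - J 0) = \<Phi> h - \<Phi> 0"
    unfolding \<Phi>_def by simp
  then show ?thesis using le' by simp
qed

text \<open>Integrating \<open>fx\<close> in x and differentiating in y under the integral shows
  that \<open>fy\<close> is a primitive of \<open>fxy\<close> in x; the fundamental theorem then
  identifies its derivative \<open>fyx\<close>. Continuity of one mixed derivative is enough for
  this.\<close>

lemma mixed_partials_eq:
  fixes f fx fy fxy fyx :: "real \<Rightarrow> real \<Rightarrow> real"
  assumes "l < r"
    and fx: "\<And>x y. \<lbrakk>l < y; y < r\<rbrakk> \<Longrightarrow> ((\<lambda>x. f x y) has_real_derivative fx x y) (at x)"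
    and fy: "\<And>x y. \<lbrakk>l < y; y < r\<rbrakk> \<Longrightarrow> ((\<lambda>y. f x y) has_real_derivative fy x y) (at y)"
    and fxy: "\<And>x y. \<lbrakk>l < y; y < r\<rbrakk> \<Longrightarrow> ((\<lambda>y. fx x y) has_real_derivative fxy x y) (at y)"
    and fyx: "\<And>x y. \<lbrakk>l < y; y < r\<rbrakk> \<Longrightarrow> ((\<lambda>x. fy x y) has_real_derivative fyx x y) (at x)"
    and c: "continuous_on (UNIV \<times> {l<..<r}) (\<lambda>(x, y). fxy x y)"
    and y: "l < y" "y < r"
  shows "fxy x y = fyx x y"
proof -
  have swap: "continuous_on ({l<..<r} \<times> {x - 1..b}) (\<lambda>(y, x). fxy x y)" for b
    by (rule continuous_on_prod_swap, rule continuous_on_subset[OF c]) auto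
  have eq: "fy t y = fy (x - 1) y + integral {x - 1..t} (\<lambda>s. fxy s y)" if t: "x - 1 \<le> t" for t
  proof -
    have f: "f t z = f (x - 1) z + integral {x - 1..t} (\<lambda>s. fx s z)" if z: "l < z" "z < r" for z
    proof -
      have "((\<lambda>s. fx s z) has_integral (f t z - f (x - 1) z)) {x - 1..t}"
        using t z fx by (intro fundamental_theorem_of_calculus)
          (auto simp: has_real_derivative_iff_has_vector_derivative[symmetric] intro: has_field_derivative_at_within)
      then show ?thesis by (simp add: integral_unique)
    qed
    have ci: "(\<lambda>s. fx s z) integrable_on {x - 1..t}" if z: "l < z" "z < r" for z
      by (rule has_integral_integrable[OF fundamental_theorem_of_calculus[where f = "\<lambda>s. f s z"]])
         (use t z fx in \<open>auto simp: has_real_derivative_iff_has_vector_derivative[symmetric] intro: has_field_derivative_at_within\<close>)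
    have "((\<lambda>z. integral {x - 1..t} (\<lambda>s. fx s z)) has_real_derivative integral {x - 1..t} (\<lambda>s. fxy s y)) (at y within {l<..<r})"
    proof (rule leibniz_rule_field_derivative[of "{l<..<r}" "x - 1" t "\<lambda>y x. fx x y" "\<lambda>y x. fxy x y", unfolded cbox_interval])
      show "continuous_on ({l<..<r} \<times> {x - 1..t}) (\<lambda>(y, x). fxy x y)" by (rule swap)
      show "((\<lambda>y. fx s y) has_real_derivative fxy s z) (at z within {l<..<r})"
        if "z \<in> {l<..<r}" for z s
        using fxy[of z s] that by (simp add: has_field_derivative_at_within)
    qed (use y ci in auto)
    then have D: "((\<lambda>z. integral {x - 1..t} (\<lambda>s. fx s z)) has_real_derivative integral {x - 1..t} (\<lambda>s. fxy s y)) (at y)"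
      using y at_within_open[of y "{l<..<r}"] by simp
    have "((\<lambda>z. f (x - 1) z + integral {x - 1..t} (\<lambda>s. fx s z)) has_real_derivative
          (fy (x - 1) y + integral {x - 1..t} (\<lambda>s. fxy s y))) (at y)"
      using y by (auto intro!: derivative_eq_intros D fy)
    then have "((\<lambda>z. f t z) has_real_derivative (fy (x - 1) y + integral {x - 1..t} (\<lambda>s. fxy s y))) (at y)"
      by (rule has_field_derivative_transform_within_open[of _ _ _ "{l<..<r}"]) (use y f in auto)
    then show ?thesis by (rule DERIV_unique[OF fy[OF y]])
  qed
  have cs: "continuous_on {x - 1..x + 1} (\<lambda>s. fxy s y)"
    using continuous_on_slice[where f = fxy, OF c, of y] y by (auto intro: continuous_on_subset)
  have "((\<lambda>t. integral {x - 1..t} (\<lambda>s. fxy s y)) has_real_derivative fxy x y) (at x within {x - 1..x + 1})"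
    by (rule integral_has_real_derivative[OF cs]) auto
  then have "((\<lambda>t. integral {x - 1..t} (\<lambda>s. fxy s y)) has_real_derivative fxy x y) (at x)"
    by (simp add: at_within_Icc_at)
  then have "((\<lambda>t. fy (x - 1) y + integral {x - 1..t} (\<lambda>s. fxy s y)) has_real_derivative fxy x y) (at x)"
    by (auto intro!: derivative_eq_intros)
  then have "((\<lambda>t. fy t y) has_real_derivative fxy x y) (at x)"
  proof (rule has_field_derivative_transform_within_open[of _ _ _ "{x - 1<..<x + 1}"])
    show "fy (x - 1) y + integral {x - 1..t} (\<lambda>s. fxy s y) = fy t y" if "t \<in> {x - 1<..<x + 1}" for t
      by (rule eq[symmetric]) (use that in auto)
  qed auto
  then show ?thesis by (rule DERIV_unique[OF _ fyx[OF y]])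
qed

section \<open>A cutoff with two continuous derivatives\<close>

lemma has_real_derivative_pos_part_power:
  "((\<lambda>s::real. (max 0 (s - b)) ^ Suc (Suc n)) has_real_derivative real (Suc (Suc n)) * (max 0 (s - b)) ^ Suc n) (at s)"
proof (cases s b rule: linorder_cases)
  case less
  have "((\<lambda>s::real. 0) has_real_derivative 0) (at s)" by simp
  then have "((\<lambda>s::real. (max 0 (s - b)) ^ Suc (Suc n)) has_real_derivative 0) (at s)"
    by (rule has_field_derivative_transform_within_open[of _ _ _ "{..<b}"]) (use less in auto)
  then show ?thesis using less by simp
next
  case greater
  have "((\<lambda>s::real. (s - b) ^ Suc (Suc n)) has_real_derivative real (Suc (Suc n)) * (s - b) ^ Suc n) (at s)"
    by (rule derivative_eq_intros refl | simp)+
  then have "((\<lambda>s::real. (max 0 (s - b)) ^ Suc (Suc n)) has_real_derivative real (Suc (Suc n)) * (s - b) ^ Suc n) (at s)"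
    by (rule has_field_derivative_transform_within_open[of _ _ _ "{b<..}"]) (use greater in auto)
  then show ?thesis using greater by simp
next
  case equal
  have "((\<lambda>h. (max 0 h) ^ Suc (Suc n) / h) \<longlongrightarrow> 0) (at (0::real))"
  proof (rule Lim_null_comparison)
    show "\<forall>\<^sub>F h in at (0::real). norm ((max 0 h) ^ Suc (Suc n) / h) \<le> \<bar>h\<bar> ^ Suc n"
    proof (rule always_eventually, rule allI)
      fix h :: real
      show "norm ((max 0 h) ^ Suc (Suc n) / h) \<le> \<bar>h\<bar> ^ Suc n"
        by (cases h "0 :: real" rule: linorder_cases) (auto simp: max_def mult_le_0_iff)
    qed
    show "((\<lambda>h::real. \<bar>h\<bar> ^ Suc n) \<longlongrightarrow> 0) (at 0)"
      by (rule tendsto_eq_intros refl | simp)+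
  qed
  then show ?thesis using equal by (simp add: DERIV_def)
qed

text \<open>\<open>k\<close> is the third difference, at the knots 1, 2, 3, 4, of the truncated cube
  divided by 6, so \<open>k1\<close> is the quadratic B-spline. Beyond 4 no truncation is active and
  the third difference of s^3 / 6 is 1. Two derivatives are needed because the truncated velocity
  contains the gradient of the cutoff and is itself differentiated once.\<close>

lemma C2_cutoff:
  obtains k k1 k2 :: "real \<Rightarrow> real" and B :: real
  where "\<And>s. (k has_real_derivative k1 s) (at s)" "\<And>s. (k1 has_real_derivative k2 s) (at s)"
    "continuous_on UNIV k2" "\<And>s. s \<le> 1 \<Longrightarrow> k s = 0" "\<And>s. 4 \<le> s \<Longrightarrow> k s = 1"
    "\<And>s. s \<le> 1 \<or> 4 \<le> s \<Longrightarrow> k1 s = 0" "\<And>s. s \<le> 1 \<or> 4 \<le> s \<Longrightarrow> k2 s = 0"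
    "\<And>s. \<bar>k1 s\<bar> \<le> B" "\<And>s. \<bar>k2 s\<bar> \<le> B"
proof -
  define m where "m b s = max 0 (s - b)" for b s :: real
  define k where "k s = (m 1 s ^ 3 - 3 * m 2 s ^ 3 + 3 * m 3 s ^ 3 - m 4 s ^ 3) / 6" for s
  define k1 where "k1 s = (m 1 s ^ 2 - 3 * m 2 s ^ 2 + 3 * m 3 s ^ 2 - m 4 s ^ 2) / 2" for s
  define k2 where "k2 s = m 1 s - 3 * m 2 s + 3 * m 3 s - m 4 s" for s
  have d3: "((\<lambda>s. m b s ^ 3) has_real_derivative 3 * m b s ^ 2) (at s)" for b s
    unfolding m_def using has_real_derivative_pos_part_power[of b 1 s] by (simp add: eval_nat_numeral)
  have d2: "((\<lambda>s. m b s ^ 2) has_real_derivative 2 * m b s) (at s)" for b s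
    unfolding m_def using has_real_derivative_pos_part_power[of b 0 s] by (simp add: eval_nat_numeral)
  have D1: "(k has_real_derivative k1 s) (at s)" for s
    unfolding k_def k1_def by (rule derivative_eq_intros d3 refl | simp add: field_simps)+
  have D2: "(k1 has_real_derivative k2 s) (at s)" for s
    unfolding k1_def k2_def by (rule derivative_eq_intros d2 refl | simp add: field_simps)+
  have c2: "continuous_on UNIV k2" unfolding k2_def m_def by (intro continuous_intros)
  have c1: "continuous_on UNIV k1" unfolding k1_def m_def by (intro continuous_intros) auto
  have k0: "k s = 0" if "s \<le> 1" for s using that by (simp add: k_def m_def)
  have k4: "k s = 1" if "4 \<le> s" for s
    using that by (simp add: k_def m_def) (simp add: power3_eq_cube algebra_simps)
  have z1: "k1 s = 0" if "s \<le> 1 \<or> 4 \<le> s" for s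
    using that by (auto simp: k1_def m_def) (simp add: power2_eq_square algebra_simps)
  have z2: "k2 s = 0" if "s \<le> 1 \<or> 4 \<le> s" for s
    using that by (auto simp: k2_def m_def)
  have "bounded (k1 ` {1..4})" "bounded (k2 ` {1..4})"
    using c1 c2 by (auto intro!: compact_imp_bounded compact_continuous_image intro: continuous_on_subset)
  then obtain B1 B2 where B: "\<forall>x\<in>k1 ` {1..4}. norm x \<le> B1" "\<forall>x\<in>k2 ` {1..4}. norm x \<le> B2"
    unfolding bounded_iff by blast
  have "\<bar>k1 s\<bar> \<le> max 0 (max B1 B2) \<and> \<bar>k2 s\<bar> \<le> max 0 (max B1 B2)" for s
  proof (cases "s \<in> {1..4}")
    case True
    then have "\<bar>k1 s\<bar> \<le> B1" "\<bar>k2 s\<bar> \<le> B2" using B by auto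
    then show ?thesis by linarith
  qed (use z1[of s] z2[of s] in auto)
  with that D1 D2 c2 k0 k4 z1 z2 show ?thesis by blast
qed

section \<open>Bipolar coordinates\<close>

text \<open>The chart is X - iY = a cot((x + iy) / 2), and \<open>bip_N\<close> is 2 |sin((x + iy) /
  2)|^2. It vanishes exactly at the points (2 pi k, 0), which correspond to infinity.\<close>

definition bip_N :: "real \<Rightarrow> real \<Rightarrow> real" where
  "bip_N x y = cosh y - cos x"

definition bip_X :: "real \<Rightarrow> real \<Rightarrow> real \<Rightarrow> real" where
  "bip_X a x y = a * sin x / bip_N x y"

definition bip_Y :: "real \<Rightarrow> real \<Rightarrow> real \<Rightarrow> real" where
  "bip_Y a x y = a * sinh y / bip_N x y"

text \<open>\<open>bip_c\<close> - i \<open>bip_s\<close> is the complex derivative of X - iY. By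
  the Cauchy-Riemann equations all first derivatives of the chart are \<open>bip_c\<close> and
  \<open>bip_s\<close> up to sign, and all second ones are \<open>bip_cx\<close> and
  \<open>bip_cy\<close> up to sign.\<close>

definition bip_c :: "real \<Rightarrow> real \<Rightarrow> real \<Rightarrow> real" where
  "bip_c a x y = a * (cos x * cosh y - 1) / (bip_N x y)\<^sup>2"

definition bip_s :: "real \<Rightarrow> real \<Rightarrow> real \<Rightarrow> real" where
  "bip_s a x y = - a * sin x * sinh y / (bip_N x y)\<^sup>2"

definition bip_cx :: "real \<Rightarrow> real \<Rightarrow> real \<Rightarrow> real" where
  "bip_cx a x y = - a * sin x * cosh y / (bip_N x y)\<^sup>2 - 2 * a * (cos x * cosh y - 1) * sin x / (bip_N x y) ^ 3"

definition bip_cy :: "real \<Rightarrow> real \<Rightarrow> real \<Rightarrow> real" where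
  "bip_cy a x y = a * cos x * sinh y / (bip_N x y)\<^sup>2 - 2 * a * (cos x * cosh y - 1) * sinh y / (bip_N x y) ^ 3"

lemma cosh_sq: "(cosh y)\<^sup>2 = 1 + (sinh y)\<^sup>2" for y :: real
  using cosh_square_eq[of y] by simp

lemma bip_N_nonneg: "bip_N x y \<ge> 0"
  unfolding bip_N_def using cosh_real_ge_1[of y] cos_le_one[of x] by linarith

lemma bip_N_pos: "y \<noteq> 0 \<Longrightarrow> bip_N x y > 0"
  unfolding bip_N_def using cosh_real_strict_mono[of 0 "\<bar>y\<bar>"] cos_le_one[of x] by (smt (verit) cosh_0 cosh_real_abs)

lemma bip_N_pos': "cos x \<noteq> 1 \<Longrightarrow> bip_N x y > 0"
  unfolding bip_N_def using cosh_real_ge_1[of y] cos_le_one[of x] by linarith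

text \<open>The left side is |cos(x + iy) - 1|^2, and 1 - cos z = 2 (sin(z / 2))^2 has modulus
  \<open>bip_N\<close>.\<close>

lemma bip_identity: "(cos x * cosh y - 1)\<^sup>2 + (sin x * sinh y)\<^sup>2 = (bip_N x y)\<^sup>2"
proof -
  have "(sin x)\<^sup>2 = 1 - (cos x)\<^sup>2" "(sinh y)\<^sup>2 = (cosh y)\<^sup>2 - 1"
    by (simp_all add: sin_squared_eq cosh_sq)
  then show ?thesis by (simp add: bip_N_def power_mult_distrib) (simp add: power2_eq_square algebra_simps)
qed

lemma bip_abs_le: "\<bar>cos x * cosh y - 1\<bar> \<le> bip_N x y" "\<bar>sin x * sinh y\<bar> \<le> bip_N x y"
proof -
  have "(cos x * cosh y - 1)\<^sup>2 \<le> (bip_N x y)\<^sup>2" "(sin x * sinh y)\<^sup>2 \<le> (bip_N x y)\<^sup>2"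
    unfolding bip_identity[symmetric] by simp_all
  then show "\<bar>cos x * cosh y - 1\<bar> \<le> bip_N x y" "\<bar>sin x * sinh y\<bar> \<le> bip_N x y"
    using bip_N_nonneg[of x y] by (simp_all add: abs_le_square_iff[symmetric])
qed

lemma bip_jacobian:
  assumes "bip_N x y \<noteq> 0"
  shows "(bip_c a x y)\<^sup>2 + (bip_s a x y)\<^sup>2 = (a / bip_N x y)\<^sup>2"
proof -
  have "(bip_c a x y)\<^sup>2 + (bip_s a x y)\<^sup>2
     = a\<^sup>2 * ((cos x * cosh y - 1)\<^sup>2 + (sin x * sinh y)\<^sup>2) / ((bip_N x y)\<^sup>2)\<^sup>2"
    unfolding bip_c_def bip_s_def power_divide add_divide_distrib[symmetric] by algebra
  also have "\<dots> = (a / bip_N x y)\<^sup>2"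
    unfolding bip_identity using assms by (simp add: power2_eq_square)
  finally show ?thesis .
qed

lemma bip_cs_bound:
  assumes "a > 0" "bip_N x y > 0"
  shows "\<bar>bip_c a x y\<bar> \<le> a / bip_N x y" "\<bar>bip_s a x y\<bar> \<le> a / bip_N x y"
proof -
  have "(bip_c a x y)\<^sup>2 \<le> (a / bip_N x y)\<^sup>2" "(bip_s a x y)\<^sup>2 \<le> (a / bip_N x y)\<^sup>2"
    using bip_jacobian[of x y a] assms by (smt (verit) zero_le_power2)+
  then show "\<bar>bip_c a x y\<bar> \<le> a / bip_N x y" "\<bar>bip_s a x y\<bar> \<le> a / bip_N x y"
    using assms abs_le_square_iff[of _ "a / bip_N x y"] by auto
qed

lemma bip_derivs:
  assumes "bip_N x y \<noteq> 0"
  shows "((\<lambda>x. bip_N x y) has_real_derivative sin x) (at x)"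
    and "((\<lambda>y. bip_N x y) has_real_derivative sinh y) (at y)"
    and "((\<lambda>x. bip_X a x y) has_real_derivative bip_c a x y) (at x)"
    and "((\<lambda>y. bip_X a x y) has_real_derivative bip_s a x y) (at y)"
    and "((\<lambda>x. bip_Y a x y) has_real_derivative bip_s a x y) (at x)"
    and "((\<lambda>y. bip_Y a x y) has_real_derivative - bip_c a x y) (at y)"
    and "((\<lambda>x. bip_c a x y) has_real_derivative bip_cx a x y) (at x)"
    and "((\<lambda>y. bip_c a x y) has_real_derivative bip_cy a x y) (at y)"
    and "((\<lambda>x. bip_s a x y) has_real_derivative bip_cy a x y) (at x)"
    and "((\<lambda>y. bip_s a x y) has_real_derivative - bip_cx a x y) (at y)"
proof -
  show Nx: "((\<lambda>x. bip_N x y) has_real_derivative sin x) (at x)"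
    unfolding bip_N_def by (auto intro!: derivative_eq_intros)
  show Ny: "((\<lambda>y. bip_N x y) has_real_derivative sinh y) (at y)"
    unfolding bip_N_def by (auto intro!: derivative_eq_intros)
  have cc: "cosh y = bip_N x y + cos x" by (simp add: bip_N_def)
  have ss: "sin x * sin x = 1 - cos x * cos x" using sin_squared_eq[of x] by (simp add: power2_eq_square)
  have sh: "sinh y * sinh y = cosh y * cosh y - 1"
    using cosh_sq[of y] by (simp add: power2_eq_square)
  show "((\<lambda>x. bip_X a x y) has_real_derivative bip_c a x y) (at x)"
    unfolding bip_X_def bip_c_def
    by (rule DERIV_cong, (rule derivative_intros Nx | simp add: assms)+,
        use assms cc ss sh in \<open>simp add: divide_simps power2_eq_square power3_eq_cube; algebra\<close>)
  show "((\<lambda>y. bip_X a x y) has_real_derivative bip_s a x y) (at y)"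
    unfolding bip_X_def bip_s_def
    by (rule DERIV_cong, (rule derivative_intros Ny | simp add: assms)+,
        use assms cc ss sh in \<open>simp add: divide_simps power2_eq_square power3_eq_cube; algebra\<close>)
  show "((\<lambda>x. bip_Y a x y) has_real_derivative bip_s a x y) (at x)"
    unfolding bip_Y_def bip_s_def
    by (rule DERIV_cong, (rule derivative_intros Nx | simp add: assms)+,
        use assms cc ss sh in \<open>simp add: divide_simps power2_eq_square power3_eq_cube; algebra\<close>)
  show "((\<lambda>y. bip_Y a x y) has_real_derivative - bip_c a x y) (at y)"
    unfolding bip_Y_def bip_c_def
    by (rule DERIV_cong, (rule derivative_intros Ny | simp add: assms)+,
        use assms cc ss sh in \<open>simp add: divide_simps power2_eq_square power3_eq_cube; algebra\<close>)
  have ni: "bip_N x y * inverse (bip_N x y) = 1" using assms by simp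
  show "((\<lambda>x. bip_c a x y) has_real_derivative bip_cx a x y) (at x)"
    unfolding bip_c_def bip_cx_def
    by (rule DERIV_cong, (rule derivative_intros Nx | simp add: assms)+,
        use assms cc ss sh ni in \<open>simp only: divide_inverse power_inverse[symmetric]; algebra\<close>)
  show "((\<lambda>y. bip_c a x y) has_real_derivative bip_cy a x y) (at y)"
    unfolding bip_c_def bip_cy_def
    by (rule DERIV_cong, (rule derivative_intros Ny | simp add: assms)+,
        use assms cc ss sh ni in \<open>simp only: divide_inverse power_inverse[symmetric]; algebra\<close>)
  show "((\<lambda>x. bip_s a x y) has_real_derivative bip_cy a x y) (at x)"
    unfolding bip_cy_def bip_s_def
    by (rule DERIV_cong, (rule derivative_intros Nx | simp add: assms)+,
        use assms cc ss sh ni in \<open>simp only: divide_inverse power_inverse[symmetric]; algebra\<close>)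
  show "((\<lambda>y. bip_s a x y) has_real_derivative - bip_cx a x y) (at y)"
    unfolding bip_cx_def bip_s_def
    by (rule DERIV_cong, (rule derivative_intros Ny | simp add: assms)+,
        use assms cc ss sh ni in \<open>simp only: divide_inverse power_inverse[symmetric]; algebra\<close>)
qed

section \<open>The reciprocal identity\<close>

definition bip_domain :: "real \<Rightarrow> (real \<times> real) set" where
  "bip_domain \<alpha> = {q. 0 \<le> snd q \<and> snd q \<le> \<alpha> \<and> 0 < bip_N (fst q) (snd q)}"

text \<open>A solution seen on the strip: velocity components stay Cartesian, while the suffixes x
  and y denote derivatives in the bipolar coordinates. \<open>stokes1\<close>,
  \<open>stokes2\<close> and \<open>div_u\<close> are the Cartesian equations multiplied by the
  conformal factor \<open>bip_c\<close>^2 + \<open>bip_s\<close>^2. The velocity itself is recorded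
  only on the cut x = pi, where it serves to integrate the jump of the reciprocal form; everywhere
  else its derivatives suffice. The energy bound is stated as an iterated integral over inner strips
  because that is how it is consumed.\<close>

locale bipolar_flow =
  fixes a \<alpha> \<nu> V M :: real
    and u1 u2 p u1x u1y u2x u2y px py u1xx u1xy u1yy u2xx u2xy u2yy :: "real \<Rightarrow> real \<Rightarrow> real"
  assumes pos: "0 < a" "0 < \<alpha>" "0 < \<nu>"
    and u1_pi: "\<And>y. \<lbrakk>0 < y; y < \<alpha>\<rbrakk> \<Longrightarrow> ((\<lambda>y. u1 pi y) has_real_derivative u1y pi y) (at y)"
    and u2_pi: "\<And>y. \<lbrakk>0 < y; y < \<alpha>\<rbrakk> \<Longrightarrow> ((\<lambda>y. u2 pi y) has_real_derivative u2y pi y) (at y)"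
    and u1xx: "\<And>x y. \<lbrakk>0 < y; y < \<alpha>\<rbrakk> \<Longrightarrow> ((\<lambda>x. u1x x y) has_real_derivative u1xx x y) (at x)"
    and u1xy: "\<And>x y. \<lbrakk>0 < y; y < \<alpha>\<rbrakk> \<Longrightarrow> ((\<lambda>y. u1x x y) has_real_derivative u1xy x y) (at y)"
    and u1yx: "\<And>x y. \<lbrakk>0 < y; y < \<alpha>\<rbrakk> \<Longrightarrow> ((\<lambda>x. u1y x y) has_real_derivative u1xy x y) (at x)"
    and u1yy: "\<And>x y. \<lbrakk>0 < y; y < \<alpha>\<rbrakk> \<Longrightarrow> ((\<lambda>y. u1y x y) has_real_derivative u1yy x y) (at y)"
    and u2xx: "\<And>x y. \<lbrakk>0 < y; y < \<alpha>\<rbrakk> \<Longrightarrow> ((\<lambda>x. u2x x y) has_real_derivative u2xx x y) (at x)"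
    and u2xy: "\<And>x y. \<lbrakk>0 < y; y < \<alpha>\<rbrakk> \<Longrightarrow> ((\<lambda>y. u2x x y) has_real_derivative u2xy x y) (at y)"
    and u2yx: "\<And>x y. \<lbrakk>0 < y; y < \<alpha>\<rbrakk> \<Longrightarrow> ((\<lambda>x. u2y x y) has_real_derivative u2xy x y) (at x)"
    and u2yy: "\<And>x y. \<lbrakk>0 < y; y < \<alpha>\<rbrakk> \<Longrightarrow> ((\<lambda>y. u2y x y) has_real_derivative u2yy x y) (at y)"
    and px: "\<And>x y. \<lbrakk>0 < y; y < \<alpha>\<rbrakk> \<Longrightarrow> ((\<lambda>x. p x y) has_real_derivative px x y) (at x)"
    and py: "\<And>x y. \<lbrakk>0 < y; y < \<alpha>\<rbrakk> \<Longrightarrow> ((\<lambda>y. p x y) has_real_derivative py x y) (at y)"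
    and c2: "\<And>f. f \<in> {u1xx, u1xy, u1yy, u2xx, u2xy, u2yy, px, py} \<Longrightarrow>
            continuous_on (UNIV \<times> {0<..<\<alpha>}) (\<lambda>q. f (fst q) (snd q))"
    and c1: "\<And>f. f \<in> {u1x, u1y, u2x, u2y, p} \<Longrightarrow> continuous_on (bip_domain \<alpha>) (\<lambda>q. f (fst q) (snd q))"
    and c0: "continuous_on {0..\<alpha>} (u1 pi)" "continuous_on {0..\<alpha>} (u2 pi)"
    and periodic: "\<And>f y. f \<in> {u1x, u1y, u2x, u2y, p} \<Longrightarrow> f pi y = f (- pi) y"
    and wall: "u1 pi 0 = 0" "u2 pi 0 = 0"
      "\<And>x. bip_N x 0 > 0 \<Longrightarrow> u1x x 0 = 0" "\<And>x. bip_N x 0 > 0 \<Longrightarrow> u2x x 0 = 0"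
    and disk: "u1 pi \<alpha> = 0" "u2 pi \<alpha> = V" "\<And>x. u1x x \<alpha> = 0" "\<And>x. u2x x \<alpha> = 0"
    and stokes1: "\<And>x y. \<lbrakk>0 < y; y < \<alpha>\<rbrakk> \<Longrightarrow>
          \<nu> * (u1xx x y + u1yy x y) = px x y * bip_c a x y + py x y * bip_s a x y"
    and stokes2: "\<And>x y. \<lbrakk>0 < y; y < \<alpha>\<rbrakk> \<Longrightarrow>
          \<nu> * (u2xx x y + u2yy x y) = px x y * bip_s a x y - py x y * bip_c a x y"
    and div_u: "\<And>x y. \<lbrakk>0 < y; y < \<alpha>\<rbrakk> \<Longrightarrow>
          bip_c a x y * u1x x y + bip_s a x y * u1y x y + bip_s a x y * u2x x y - bip_c a x y * u2y x y = 0"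
    and energy: "\<And>y0 y1. \<lbrakk>0 < y0; y0 < y1; y1 < \<alpha>\<rbrakk> \<Longrightarrow>
          integral {y0..y1} (\<lambda>y. integral {- pi..pi}
             (\<lambda>x. (u1x x y)\<^sup>2 + (u1y x y)\<^sup>2 + (u2x x y)\<^sup>2 + (u2y x y)\<^sup>2)) \<le> M"

text \<open>
  \<open>(H1, H2)\<close> is a primitive of the stress form of the flow \<open>(v1, v2)\<close> with pressure \<open>pr\<close>, so that its
  increments are forces; it is multivalued around the disk, with periods \<open>2 * pi * b1\<close>, \<open>2 * pi * b2\<close>.
\<close>

locale bipolar_test_flow =
  fixes a \<alpha> \<nu> K b1 b2 e1 e2 :: real
    and v1 v2 \<psi> H1 H2 pr v1x v1y v2x v2y :: "real \<Rightarrow> real \<Rightarrow> real"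
  assumes v1x: "\<And>x y. 0 < y \<Longrightarrow> ((\<lambda>x. v1 x y) has_real_derivative v1x x y) (at x)"
    and v1y: "\<And>x y. 0 < y \<Longrightarrow> ((\<lambda>y. v1 x y) has_real_derivative v1y x y) (at y)"
    and v2x: "\<And>x y. 0 < y \<Longrightarrow> ((\<lambda>x. v2 x y) has_real_derivative v2x x y) (at x)"
    and v2y: "\<And>x y. 0 < y \<Longrightarrow> ((\<lambda>y. v2 x y) has_real_derivative v2y x y) (at y)"
    and psix: "\<And>x y. 0 < y \<Longrightarrow>
          ((\<lambda>x. \<psi> x y) has_real_derivative v2 x y * bip_c a x y - v1 x y * bip_s a x y) (at x)"
    and psiy: "\<And>x y. 0 < y \<Longrightarrow>
          ((\<lambda>y. \<psi> x y) has_real_derivative v2 x y * bip_s a x y + v1 x y * bip_c a x y) (at y)"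
    and H1x: "\<And>x y. 0 < y \<Longrightarrow>
          ((\<lambda>x. H1 x y) has_real_derivative - pr x y * bip_s a x y + \<nu> * (v1y x y - v2x x y)) (at x)"
    and H1y: "\<And>x y. 0 < y \<Longrightarrow>
          ((\<lambda>y. H1 x y) has_real_derivative pr x y * bip_c a x y - \<nu> * (v1x x y + v2y x y)) (at y)"
    and H2x: "\<And>x y. 0 < y \<Longrightarrow>
          ((\<lambda>x. H2 x y) has_real_derivative pr x y * bip_c a x y + \<nu> * (v1x x y + v2y x y)) (at x)"
    and H2y: "\<And>x y. 0 < y \<Longrightarrow>
          ((\<lambda>y. H2 x y) has_real_derivative pr x y * bip_s a x y + \<nu> * (v1y x y - v2x x y)) (at y)"
    and div_v: "\<And>x y. 0 < y \<Longrightarrow>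
          bip_c a x y * v1x x y + bip_s a x y * v1y x y + bip_s a x y * v2x x y - bip_c a x y * v2y x y = 0"
    and cv1: "\<And>f. f \<in> {v1x, v1y, v2x, v2y, pr} \<Longrightarrow> continuous_on (UNIV \<times> {0<..<\<alpha>}) (\<lambda>q. f (fst q) (snd q))"
    and cv0: "\<And>f. f \<in> {v1, v2, \<psi>, H1, H2} \<Longrightarrow> continuous_on (bip_domain \<alpha>) (\<lambda>q. f (fst q) (snd q))"
    and v_wall: "\<And>x. bip_N x 0 > 0 \<Longrightarrow> v1 x 0 = 0" "\<And>x. bip_N x 0 > 0 \<Longrightarrow> v2 x 0 = 0"
      "\<And>x. bip_N x 0 > 0 \<Longrightarrow> \<psi> x 0 = 0"
    and v_disk: "\<And>x. v1 x \<alpha> = e1" "\<And>x. v2 x \<alpha> = e2"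
    and psi_bound: "\<And>x y. \<lbrakk>\<bar>x\<bar> \<le> pi; 0 < y; y \<le> \<alpha>\<rbrakk> \<Longrightarrow> \<bar>\<psi> x y\<bar> \<le> K"
    and bound: "\<And>f x y. \<lbrakk>f \<in> {v1, v2, H1, H2}; \<bar>x\<bar> \<le> pi; 0 < y; y \<le> \<alpha>\<rbrakk> \<Longrightarrow> \<bar>f x y\<bar> \<le> K * sqrt (bip_N x y)"
    and v_periodic: "\<And>f y. f \<in> {v1, v2, \<psi>} \<Longrightarrow> f pi y = f (- pi) y"
    and H_period: "\<And>y. H1 pi y - H1 (- pi) y = 2 * pi * b1" "\<And>y. H2 pi y - H2 (- pi) y = 2 * pi * b2"

locale reciprocity = bipolar_flow + bipolar_test_flow
begin

lemma K_nonneg: "K \<ge> 0"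
  using psi_bound[of 0 \<alpha>] pos by auto

end

section \<open>The truncated test flow and the reciprocal form\<close>

text \<open>The cutoff is a function of \<open>bip_N\<close> / \<delta>: it is 0 where
  \<open>bip_N\<close> is at most \<delta> and 1 where it is at least 4 \<delta>. The bound by cosh
  \<alpha> - 1 keeps the disk boundary in the region where it is 1; the bound 1 / 4 does the same
  for the cut x = pi, and gives cosh y \<le> 2 where the cutoff varies.\<close>

locale cutoff_reciprocity = reciprocity +
  fixes k k1 k2 :: "real \<Rightarrow> real" and B \<delta> :: real
  assumes k: "\<And>s. (k has_real_derivative k1 s) (at s)" "\<And>s. (k1 has_real_derivative k2 s) (at s)"
    "continuous_on UNIV k2" "\<And>s. s \<le> 1 \<Longrightarrow> k s = 0" "\<And>s. 4 \<le> s \<Longrightarrow> k s = 1"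
    "\<And>s. s \<le> 1 \<or> 4 \<le> s \<Longrightarrow> k1 s = 0" "\<And>s. s \<le> 1 \<or> 4 \<le> s \<Longrightarrow> k2 s = 0"
    "\<And>s. \<bar>k1 s\<bar> \<le> B" "\<And>s. \<bar>k2 s\<bar> \<le> B"
    and delta: "0 < \<delta>" "\<delta> \<le> 1 / 4" "4 * \<delta> \<le> cosh \<alpha> - 1"
begin

definition "chi x y = k (bip_N x y / \<delta>)"
definition "chix x y = k1 (bip_N x y / \<delta>) * (sin x / \<delta>)"
definition "chiy x y = k1 (bip_N x y / \<delta>) * (sinh y / \<delta>)"

text \<open>\<open>chiX\<close> and \<open>chiY\<close> are the Cartesian partial derivatives of the cutoff.\<close>

definition "g1 s = s * k1 s"
definition "g2 s = k1 s + s * k2 s"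
definition "chiX x y = - g1 (bip_N x y / \<delta>) * sin x * cosh y / a"
definition "chiY x y = - g1 (bip_N x y / \<delta>) * sinh y * cos x / a"
definition "chiXx x y = - (g2 (bip_N x y / \<delta>) * (sin x / \<delta>) * sin x * cosh y + g1 (bip_N x y / \<delta>) * cos x * cosh y) / a"
definition "chiXy x y = - (g2 (bip_N x y / \<delta>) * (sinh y / \<delta>) * sin x * cosh y + g1 (bip_N x y / \<delta>) * sin x * sinh y) / a"
definition "chiYx x y = - (g2 (bip_N x y / \<delta>) * (sin x / \<delta>) * sinh y * cos x - g1 (bip_N x y / \<delta>) * sinh y * sin x) / a"
definition "chiYy x y = - (g2 (bip_N x y / \<delta>) * (sinh y / \<delta>) * sinh y * cos x + g1 (bip_N x y / \<delta>) * cosh y * cos x) / a"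

definition "\<psi>x x y = v2 x y * bip_c a x y - v1 x y * bip_s a x y"
definition "\<psi>y x y = v2 x y * bip_s a x y + v1 x y * bip_c a x y"

text \<open>The velocity with stream function \<open>chi * \<psi>\<close>, and the derivatives of its difference to \<open>chi * v\<close>.\<close>

definition "w1 x y = chi x y * v1 x y - \<psi> x y * chiY x y"
definition "w2 x y = chi x y * v2 x y + \<psi> x y * chiX x y"
definition "r1x x y = chix x y * v1 x y - \<psi>x x y * chiY x y - \<psi> x y * chiYx x y"
definition "r1y x y = chiy x y * v1 x y - \<psi>y x y * chiY x y - \<psi> x y * chiYy x y"
definition "r2x x y = chix x y * v2 x y + \<psi>x x y * chiX x y + \<psi> x y * chiXx x y"
definition "r2y x y = chiy x y * v2 x y + \<psi>y x y * chiX x y + \<psi> x y * chiXy x y"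

text \<open>(\<open>T1x\<close>, \<open>T1y\<close>) and (\<open>T2x\<close>, \<open>T2y\<close>)
  are the pulled-back stress forms sigma_i1 dY - sigma_i2 dX of the solution, i = 1, 2, rewritten by
  incompressibility so that only derivatives in x and y occur. The Stokes equations make them
  closed; \<open>T1'\<close> and \<open>T2'\<close> are the common values of the two cross
  derivatives.\<close>

definition "T1x x y = - p x y * bip_s a x y + \<nu> * (u1y x y - u2x x y)"
definition "T1y x y = p x y * bip_c a x y - \<nu> * (u1x x y + u2y x y)"
definition "T2x x y = p x y * bip_c a x y + \<nu> * (u1x x y + u2y x y)"
definition "T2y x y = p x y * bip_s a x y + \<nu> * (u1y x y - u2x x y)"
definition "T1' x y = - py x y * bip_s a x y + p x y * bip_cx a x y + \<nu> * (u1yy x y - u2xy x y)"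
definition "T2' x y = py x y * bip_c a x y + p x y * bip_cy a x y + \<nu> * (u1xy x y + u2yy x y)"

definition "H1x' x y = - pr x y * bip_s a x y + \<nu> * (v1y x y - v2x x y)"
definition "H1y' x y = pr x y * bip_c a x y - \<nu> * (v1x x y + v2y x y)"
definition "H2x' x y = pr x y * bip_c a x y + \<nu> * (v1x x y + v2y x y)"
definition "H2y' x y = pr x y * bip_s a x y + \<nu> * (v1y x y - v2x x y)"

text \<open>P dx + Q dy is the sum over i of w_i T_i + chi H_i du_i. The T_i are closed and dH_i is
  the stress form of the test flow; so for chi = 1 the exterior derivative is the sum of dv_i wedge
  T_i minus du_i wedge dH_i, which is zero by the symmetry of the viscous work. This is the
  reciprocal theorem as a closed form.\<close>

definition "P x y = w1 x y * T1x x y + w2 x y * T2x x y + chi x y * (H1 x y * u1x x y + H2 x y * u2x x y)"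
definition "Q x y = w1 x y * T1y x y + w2 x y * T2y x y + chi x y * (H1 x y * u1y x y + H2 x y * u2y x y)"
definition "Py x y = (chi x y * v1y x y + r1y x y) * T1x x y + w1 x y * T1' x y
   + (chi x y * v2y x y + r2y x y) * T2x x y + w2 x y * T2' x y
   + chiy x y * (H1 x y * u1x x y + H2 x y * u2x x y)
   + chi x y * (H1y' x y * u1x x y + H2y' x y * u2x x y + H1 x y * u1xy x y + H2 x y * u2xy x y)"
definition "Qx x y = (chi x y * v1x x y + r1x x y) * T1y x y + w1 x y * T1' x y
   + (chi x y * v2x x y + r2x x y) * T2y x y + w2 x y * T2' x y
   + chix x y * (H1 x y * u1y x y + H2 x y * u2y x y)
   + chi x y * (H1x' x y * u1y x y + H2x' x y * u2y x y + H1 x y * u1xy x y + H2 x y * u2xy x y)"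

lemma g_derivs: "(g1 has_real_derivative g2 s) (at s)"
  unfolding g1_def g2_def by (auto intro!: derivative_eq_intros k)

lemma chi_derivs:
  assumes "0 < y"
  shows "((\<lambda>x. chi x y) has_real_derivative chix x y) (at x)"
    and "((\<lambda>y. chi x y) has_real_derivative chiy x y) (at y)"
    and "((\<lambda>x. chiX x y) has_real_derivative chiXx x y) (at x)"
    and "((\<lambda>y. chiX x y) has_real_derivative chiXy x y) (at y)"
    and "((\<lambda>x. chiY x y) has_real_derivative chiYx x y) (at x)"
    and "((\<lambda>y. chiY x y) has_real_derivative chiYy x y) (at y)"
proof -
  have N: "bip_N x y \<noteq> 0" using bip_N_pos[of y x] assms by simp
  note Nd = bip_derivs(1,2)[OF N]
  have ks: "((\<lambda>x. k (bip_N x y / \<delta>)) has_real_derivative k1 (bip_N x y / \<delta>) * (sin x / \<delta>)) (at x)"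
    by (rule DERIV_chain2[OF k(1)]) (intro DERIV_cdivide Nd)
  have ky: "((\<lambda>y. k (bip_N x y / \<delta>)) has_real_derivative k1 (bip_N x y / \<delta>) * (sinh y / \<delta>)) (at y)"
    by (rule DERIV_chain2[OF k(1)]) (intro DERIV_cdivide Nd)
  have gs: "((\<lambda>x. g1 (bip_N x y / \<delta>)) has_real_derivative g2 (bip_N x y / \<delta>) * (sin x / \<delta>)) (at x)"
    by (rule DERIV_chain2[OF g_derivs]) (intro DERIV_cdivide Nd)
  have gy: "((\<lambda>y. g1 (bip_N x y / \<delta>)) has_real_derivative g2 (bip_N x y / \<delta>) * (sinh y / \<delta>)) (at y)"
    by (rule DERIV_chain2[OF g_derivs]) (intro DERIV_cdivide Nd)
  show "((\<lambda>x. chi x y) has_real_derivative chix x y) (at x)" "((\<lambda>y. chi x y) has_real_derivative chiy x y) (at y)"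
    unfolding chi_def chix_def chiy_def by (rule ks, rule ky)
  show "((\<lambda>x. chiX x y) has_real_derivative chiXx x y) (at x)"
    unfolding chiX_def chiXx_def
    by (rule DERIV_cong, (rule derivative_intros gs gy | simp add: pos(1)[THEN less_imp_neq, symmetric] power2_eq_square field_simps)+)
  show "((\<lambda>y. chiX x y) has_real_derivative chiXy x y) (at y)"
    unfolding chiX_def chiXy_def
    by (rule DERIV_cong, (rule derivative_intros gs gy | simp add: pos(1)[THEN less_imp_neq, symmetric] power2_eq_square field_simps)+)
  show "((\<lambda>x. chiY x y) has_real_derivative chiYx x y) (at x)"
    unfolding chiY_def chiYx_def
    by (rule DERIV_cong, (rule derivative_intros gs gy | simp add: pos(1)[THEN less_imp_neq, symmetric] power2_eq_square field_simps)+)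
  show "((\<lambda>y. chiY x y) has_real_derivative chiYy x y) (at y)"
    unfolding chiY_def chiYy_def
    by (rule DERIV_cong, (rule derivative_intros gs gy | simp add: pos(1)[THEN less_imp_neq, symmetric] power2_eq_square field_simps)+)
qed

lemma w_derivs:
  assumes "0 < y"
  shows "((\<lambda>x. w1 x y) has_real_derivative chi x y * v1x x y + r1x x y) (at x)"
    and "((\<lambda>y. w1 x y) has_real_derivative chi x y * v1y x y + r1y x y) (at y)"
    and "((\<lambda>x. w2 x y) has_real_derivative chi x y * v2x x y + r2x x y) (at x)"
    and "((\<lambda>y. w2 x y) has_real_derivative chi x y * v2y x y + r2y x y) (at y)"
  unfolding w1_def w2_def r1x_def r1y_def r2x_def r2y_def
  by (rule DERIV_cong, rule derivative_intros chi_derivs[OF assms]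
       v1x[OF assms] v1y[OF assms] v2x[OF assms] v2y[OF assms]
       psix[OF assms, folded \<psi>x_def] psiy[OF assms, folded \<psi>y_def],
       (rule derivative_intros chi_derivs[OF assms]
       v1x[OF assms] v1y[OF assms] v2x[OF assms] v2y[OF assms]
       psix[OF assms, folded \<psi>x_def] psiy[OF assms, folded \<psi>y_def])+, simp add: algebra_simps)+

lemma T_derivs:
  assumes "0 < y" "y < \<alpha>"
  shows "((\<lambda>y. T1x x y) has_real_derivative T1' x y) (at y)"
    and "((\<lambda>x. T1y x y) has_real_derivative T1' x y) (at x)"
    and "((\<lambda>y. T2x x y) has_real_derivative T2' x y) (at y)"
    and "((\<lambda>x. T2y x y) has_real_derivative T2' x y) (at x)"
proof -
  have N: "bip_N x y \<noteq> 0" using bip_N_pos[of y x] assms by simp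
  note d = bip_derivs(7-10)[OF N, of a] px[OF assms] py[OF assms]
     u1xx[OF assms] u1xy[OF assms] u1yx[OF assms] u1yy[OF assms]
     u2xx[OF assms] u2xy[OF assms] u2yx[OF assms] u2yy[OF assms]
  show "((\<lambda>y. T1x x y) has_real_derivative T1' x y) (at y)"
    unfolding T1x_def T1'_def by (rule DERIV_cong, (rule derivative_intros d)+, simp add: algebra_simps)
  show "((\<lambda>x. T1y x y) has_real_derivative T1' x y) (at x)"
    unfolding T1y_def T1'_def
    by (rule DERIV_cong, (rule derivative_intros d)+, insert stokes1[OF assms, of x], simp add: algebra_simps)
  show "((\<lambda>y. T2x x y) has_real_derivative T2' x y) (at y)"
    unfolding T2x_def T2'_def by (rule DERIV_cong, (rule derivative_intros d)+, simp add: algebra_simps)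
  show "((\<lambda>x. T2y x y) has_real_derivative T2' x y) (at x)"
    unfolding T2y_def T2'_def
    by (rule DERIV_cong, (rule derivative_intros d)+, insert stokes2[OF assms, of x], simp add: algebra_simps)
qed

lemma P_deriv:
  assumes "0 < y" "y < \<alpha>"
  shows "((\<lambda>y. P x y) has_real_derivative Py x y) (at y)"
  unfolding P_def Py_def
  by (rule DERIV_cong, (rule derivative_intros w_derivs[OF assms(1)] T_derivs[OF assms] chi_derivs[OF assms(1)]
      H1y[OF assms(1), folded H1y'_def] H2y[OF assms(1), folded H2y'_def] u1xy[OF assms] u2xy[OF assms])+,
      simp add: algebra_simps)

lemma Q_deriv:
  assumes "0 < y" "y < \<alpha>"
  shows "((\<lambda>x. Q x y) has_real_derivative Qx x y) (at x)"
  unfolding Q_def Qx_def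
  by (rule DERIV_cong, (rule derivative_intros w_derivs[OF assms(1)] T_derivs[OF assms] chi_derivs[OF assms(1)]
      H1x[OF assms(1), folded H1x'_def] H2x[OF assms(1), folded H2x'_def] u1yx[OF assms] u2yx[OF assms])+,
      simp add: algebra_simps)

text \<open>The truncated field has a stream function, hence divergence zero, and so has the test
  flow; the difference between the gradient of the former and chi times the gradient of the latter
  is therefore trace free. This is what removes the unknown pressure from the error term.\<close>

lemma rest_div_free:
  assumes "0 < y"
  shows "bip_c a x y * r1x x y + bip_s a x y * r1y x y + bip_s a x y * r2x x y - bip_c a x y * r2y x y = 0"
proof -
  define i where "i = inverse (bip_N x y)"
  have N: "bip_N x y * i = 1" using bip_N_pos[of y x] assms unfolding i_def by simp
  define j where "j = inverse a"
  have j: "a * j = 1" using pos by (simp add: j_def)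
  define l where "l = inverse \<delta>"
  have l: "\<delta> * l = 1" using delta by (simp add: l_def)
  have ss: "(sin x)\<^sup>2 = 1 - (cos x)\<^sup>2" "(sinh y)\<^sup>2 = (cosh y)\<^sup>2 - 1"
    by (simp_all add: sin_squared_eq cosh_sq)
  have cN: "cosh y = bip_N x y + cos x" by (simp add: bip_N_def)
  define G1 G2 where "G1 = k1 (bip_N x y * l)" and "G2 = g2 (bip_N x y * l)"
  have g1: "g1 (bip_N x y * l) = bip_N x y * l * G1" unfolding g1_def G1_def by simp
  \<comment> \<open>\<open>A\<close> and \<open>A'\<close> are the chain rule for the cutoff,
    multiplied by the conformal factor (a i)^2; \<open>C\<close> is the symmetry of its mixed
    Cartesian derivatives.\<close>
  have A: "bip_c a x y * chix x y + bip_s a x y * chiy x y = (a * i)\<^sup>2 * chiX x y"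
    unfolding chix_def chiy_def chiX_def bip_c_def bip_s_def divide_inverse power_inverse[symmetric]
      i_def[symmetric] j_def[symmetric] l_def[symmetric] g1 G1_def[symmetric]
    using N j l ss cN by algebra
  have A': "bip_s a x y * chix x y - bip_c a x y * chiy x y = (a * i)\<^sup>2 * chiY x y"
    unfolding chix_def chiy_def chiY_def bip_c_def bip_s_def divide_inverse power_inverse[symmetric]
      i_def[symmetric] j_def[symmetric] l_def[symmetric] g1 G1_def[symmetric]
    using N j l ss cN by algebra
  have C: "bip_c a x y * chiYx x y + bip_s a x y * chiYy x y = bip_s a x y * chiXx x y - bip_c a x y * chiXy x y"
    unfolding chiXx_def chiXy_def chiYx_def chiYy_def bip_c_def bip_s_def divide_inverse power_inverse[symmetric]
      i_def[symmetric] j_def[symmetric] l_def[symmetric] g1 G1_def[symmetric] G2_def[symmetric]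
    using N j l ss cN by algebra
  have J: "(bip_c a x y)\<^sup>2 + (bip_s a x y)\<^sup>2 = (a * i)\<^sup>2"
    using bip_jacobian[of x y a] N unfolding i_def divide_inverse by force
  have D: "bip_c a x y * \<psi>x x y + bip_s a x y * \<psi>y x y = (a * i)\<^sup>2 * v2 x y"
    "bip_s a x y * \<psi>x x y - bip_c a x y * \<psi>y x y = - ((a * i)\<^sup>2 * v1 x y)"
    unfolding \<psi>x_def \<psi>y_def J[symmetric] by algebra+
  show ?thesis
    unfolding r1x_def r1y_def r2x_def r2y_def using A A' C D by algebra
qed

text \<open>The terms in which chi is undifferentiated cancel by reciprocity, and the pressures drop
  out by the three divergence conditions. What is left contains derivatives of the cutoff and only
  the gradient of the solution.\<close>

lemma W_eq:
  assumes "0 < y" "y < \<alpha>"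
  shows "Py x y - Qx x y = \<nu> * ((r1y x y - r2x x y) * (u1y x y - u2x x y) + (r1x x y + r2y x y) * (u1x x y + u2y x y))
     + chiy x y * (H1 x y * u1x x y + H2 x y * u2x x y) - chix x y * (H1 x y * u1y x y + H2 x y * u2y x y)"
  unfolding Py_def Qx_def T1x_def T1y_def T2x_def T2y_def H1x'_def H1y'_def H2x'_def H2y'_def
  using rest_div_free[OF assms(1), of x] div_v[OF assms(1), of x] div_u[OF assms, of x]
  by algebra

end

section \<open>Elementary inequalities\<close>

lemma sinh_ge_self: "0 \<le> t \<Longrightarrow> t \<le> sinh t" for t :: real
proof -
  assume t: "0 \<le> t"
  have "sinh 0 - 0 \<le> sinh t - t"
  proof (rule DERIV_nonneg_imp_nondecreasing[OF t])
    fix x :: real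
    have "((\<lambda>t. sinh t - t) has_real_derivative cosh x - 1) (at x)"
      by (auto intro!: derivative_eq_intros)
    then show "\<exists>d. ((\<lambda>t. sinh t - t) has_real_derivative d) (at x) \<and> 0 \<le> d"
      using cosh_real_ge_1[of x] by (intro exI[of _ "cosh x - 1"]) simp
  qed
  then show ?thesis by simp
qed

lemma cosh_ge_quadratic: "1 + y\<^sup>2 / 2 \<le> cosh y" for y :: real
proof -
  have "1 + t\<^sup>2 / 2 \<le> cosh t" if "0 \<le> t" for t :: real
  proof -
    have "cosh 0 - 0\<^sup>2 / 2 \<le> cosh t - t\<^sup>2 / 2"
    proof (rule DERIV_nonneg_imp_nondecreasing[OF that])
      fix x :: real
      assume "0 \<le> x"
      have "((\<lambda>t. cosh t - t\<^sup>2 / 2) has_real_derivative sinh x - x) (at x)"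
        by (auto intro!: derivative_eq_intros)
      then show "\<exists>d. ((\<lambda>t. cosh t - t\<^sup>2 / 2) has_real_derivative d) (at x) \<and> 0 \<le> d"
        using sinh_ge_self[OF \<open>0 \<le> x\<close>] by (intro exI[of _ "sinh x - x"]) simp
    qed
    then show ?thesis by simp
  qed
  from this[of "\<bar>y\<bar>"] show ?thesis by simp
qed

lemma bip_continuous:
  "continuous_on S (\<lambda>q. bip_N (fst q) (snd q))"
  "(\<And>q. q \<in> S \<Longrightarrow> bip_N (fst q) (snd q) \<noteq> 0) \<Longrightarrow> continuous_on S (\<lambda>q. bip_c a (fst q) (snd q))"
  "(\<And>q. q \<in> S \<Longrightarrow> bip_N (fst q) (snd q) \<noteq> 0) \<Longrightarrow> continuous_on S (\<lambda>q. bip_s a (fst q) (snd q))"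
  "(\<And>q. q \<in> S \<Longrightarrow> bip_N (fst q) (snd q) \<noteq> 0) \<Longrightarrow> continuous_on S (\<lambda>q. bip_cx a (fst q) (snd q))"
  "(\<And>q. q \<in> S \<Longrightarrow> bip_N (fst q) (snd q) \<noteq> 0) \<Longrightarrow> continuous_on S (\<lambda>q. bip_cy a (fst q) (snd q))"
  unfolding bip_N_def bip_c_def bip_s_def bip_cx_def bip_cy_def by (auto intro!: continuous_intros)

lemma abs_mult_mono: "\<bar>x\<bar> \<le> A \<Longrightarrow> \<bar>y\<bar> \<le> C \<Longrightarrow> \<bar>x * y\<bar> \<le> A * C" for x y A C :: real
  unfolding abs_mult by (intro mult_mono) auto

text \<open>Young's inequality, used in place of Cauchy-Schwarz: the weight is free and will be
  coupled to the cutoff radius.\<close>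

lemma abs_le_weighted_square: "0 < lm \<Longrightarrow> \<bar>t\<bar> \<le> lm * t\<^sup>2 + 1 / (4 * lm)" for t lm :: real
proof -
  assume l: "0 < lm"
  have "0 \<le> (2 * lm * \<bar>t\<bar> - 1)\<^sup>2" by simp
  then have "4 * lm * \<bar>t\<bar> \<le> 4 * lm * (lm * t\<^sup>2) + 1"
    by (simp add: power2_diff power_mult_distrib) (simp add: power2_eq_square algebra_simps)
  then show ?thesis using l by (simp add: field_simps)
qed

section \<open>Regularity and size of the cutoff terms\<close>

context cutoff_reciprocity
begin

lemma k_continuous [continuous_intros]:
  assumes "continuous_on S f"
  shows "continuous_on S (\<lambda>x. k (f x))" "continuous_on S (\<lambda>x. k1 (f x))" "continuous_on S (\<lambda>x. k2 (f x))"
proof -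
  have "continuous_on UNIV k" "continuous_on UNIV k1"
    by (rule DERIV_continuous_on[OF has_field_derivative_at_within[OF k(1)]],
        rule DERIV_continuous_on[OF has_field_derivative_at_within[OF k(2)]])
  with k(3) assms show "continuous_on S (\<lambda>x. k (f x))" "continuous_on S (\<lambda>x. k1 (f x))" "continuous_on S (\<lambda>x. k2 (f x))"
    by (auto intro: continuous_on_compose2)
qed

lemma chi_continuous [continuous_intros]:
  "continuous_on S (\<lambda>q. chi (fst q) (snd q))"
  "continuous_on S (\<lambda>q. chix (fst q) (snd q))" "continuous_on S (\<lambda>q. chiy (fst q) (snd q))"
  "continuous_on S (\<lambda>q. chiX (fst q) (snd q))" "continuous_on S (\<lambda>q. chiY (fst q) (snd q))"
  "continuous_on S (\<lambda>q. chiXx (fst q) (snd q))" "continuous_on S (\<lambda>q. chiXy (fst q) (snd q))"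
  "continuous_on S (\<lambda>q. chiYx (fst q) (snd q))" "continuous_on S (\<lambda>q. chiYy (fst q) (snd q))"
  unfolding chi_def chix_def chiy_def chiX_def chiY_def chiXx_def chiXy_def chiYx_def chiYy_def g1_def g2_def
  by (intro continuous_intros bip_continuous; use pos delta in simp)+

lemma open_strip_subset: "UNIV \<times> {0<..<\<alpha>} \<subseteq> bip_domain \<alpha>"
  using bip_N_pos by (auto simp: bip_domain_def)

lemma P_continuous_domain: "continuous_on (bip_domain \<alpha>) (\<lambda>q. P (fst q) (snd q))"
proof -
  have N: "\<And>q. q \<in> bip_domain \<alpha> \<Longrightarrow> bip_N (fst q) (snd q) \<noteq> 0" by (auto simp: bip_domain_def)
  have cs: "continuous_on (bip_domain \<alpha>) (\<lambda>q. u1x (fst q) (snd q))" "continuous_on (bip_domain \<alpha>) (\<lambda>q. u1y (fst q) (snd q))"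
    "continuous_on (bip_domain \<alpha>) (\<lambda>q. u2x (fst q) (snd q))" "continuous_on (bip_domain \<alpha>) (\<lambda>q. u2y (fst q) (snd q))"
    "continuous_on (bip_domain \<alpha>) (\<lambda>q. p (fst q) (snd q))"
    "continuous_on (bip_domain \<alpha>) (\<lambda>q. v1 (fst q) (snd q))" "continuous_on (bip_domain \<alpha>) (\<lambda>q. v2 (fst q) (snd q))"
    "continuous_on (bip_domain \<alpha>) (\<lambda>q. \<psi> (fst q) (snd q))"
    "continuous_on (bip_domain \<alpha>) (\<lambda>q. H1 (fst q) (snd q))" "continuous_on (bip_domain \<alpha>) (\<lambda>q. H2 (fst q) (snd q))"
    by (intro c1 cv0; simp)+
  show ?thesis
    unfolding P_def w1_def w2_def T1x_def T2x_def
    by (intro continuous_intros bip_continuous cs N)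
qed

lemma Py_Qx_continuous:
  "continuous_on (UNIV \<times> {0<..<\<alpha>}) (\<lambda>q. Py (fst q) (snd q))"
  "continuous_on (UNIV \<times> {0<..<\<alpha>}) (\<lambda>q. Qx (fst q) (snd q))"
proof -
  let ?S = "UNIV \<times> {0<..<\<alpha>} :: (real \<times> real) set"
  have N: "bip_N (fst q) (snd q) \<noteq> 0" if "q \<in> ?S" for q using bip_N_pos[of "snd q" "fst q"] that by auto
  have cs: "continuous_on ?S (\<lambda>q. u1x (fst q) (snd q))" "continuous_on ?S (\<lambda>q. u1y (fst q) (snd q))"
    "continuous_on ?S (\<lambda>q. u2x (fst q) (snd q))" "continuous_on ?S (\<lambda>q. u2y (fst q) (snd q))"
    "continuous_on ?S (\<lambda>q. p (fst q) (snd q))"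
    "continuous_on ?S (\<lambda>q. v1 (fst q) (snd q))" "continuous_on ?S (\<lambda>q. v2 (fst q) (snd q))"
    "continuous_on ?S (\<lambda>q. \<psi> (fst q) (snd q))"
    "continuous_on ?S (\<lambda>q. H1 (fst q) (snd q))" "continuous_on ?S (\<lambda>q. H2 (fst q) (snd q))"
    by (rule continuous_on_subset[OF _ open_strip_subset], intro c1 cv0, simp)+
  have cs2: "continuous_on ?S (\<lambda>q. u1xy (fst q) (snd q))"
    "continuous_on ?S (\<lambda>q. u1yy (fst q) (snd q))"
    "continuous_on ?S (\<lambda>q. u2xy (fst q) (snd q))" "continuous_on ?S (\<lambda>q. u2yy (fst q) (snd q))"
    "continuous_on ?S (\<lambda>q. py (fst q) (snd q))"
    "continuous_on ?S (\<lambda>q. v1x (fst q) (snd q))" "continuous_on ?S (\<lambda>q. v1y (fst q) (snd q))"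
    "continuous_on ?S (\<lambda>q. v2x (fst q) (snd q))" "continuous_on ?S (\<lambda>q. v2y (fst q) (snd q))"
    "continuous_on ?S (\<lambda>q. pr (fst q) (snd q))"
    by (intro c2 cv1; simp)+
  note bc = bip_continuous(2-5)[OF N]
  have w: "continuous_on ?S (\<lambda>q. w1 (fst q) (snd q))" "continuous_on ?S (\<lambda>q. w2 (fst q) (snd q))"
    "continuous_on ?S (\<lambda>q. r1x (fst q) (snd q))" "continuous_on ?S (\<lambda>q. r1y (fst q) (snd q))"
    "continuous_on ?S (\<lambda>q. r2x (fst q) (snd q))" "continuous_on ?S (\<lambda>q. r2y (fst q) (snd q))"
    unfolding w1_def w2_def r1x_def r1y_def r2x_def r2y_def \<psi>x_def \<psi>y_def
    by (intro continuous_intros bc cs; assumption)+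
  have T: "continuous_on ?S (\<lambda>q. T1x (fst q) (snd q))" "continuous_on ?S (\<lambda>q. T1y (fst q) (snd q))"
    "continuous_on ?S (\<lambda>q. T2x (fst q) (snd q))" "continuous_on ?S (\<lambda>q. T2y (fst q) (snd q))"
    "continuous_on ?S (\<lambda>q. T1' (fst q) (snd q))" "continuous_on ?S (\<lambda>q. T2' (fst q) (snd q))"
    "continuous_on ?S (\<lambda>q. H1x' (fst q) (snd q))" "continuous_on ?S (\<lambda>q. H1y' (fst q) (snd q))"
    "continuous_on ?S (\<lambda>q. H2x' (fst q) (snd q))" "continuous_on ?S (\<lambda>q. H2y' (fst q) (snd q))"
    unfolding T1x_def T1y_def T2x_def T2y_def T1'_def T2'_def H1x'_def H1y'_def H2x'_def H2y'_def
    by (intro continuous_intros bc cs cs2; assumption)+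
  show "continuous_on ?S (\<lambda>q. Py (fst q) (snd q))" "continuous_on ?S (\<lambda>q. Qx (fst q) (snd q))"
    unfolding Py_def Qx_def by (intro continuous_intros w T cs cs2)+
qed

lemma chi_near_infinity:
  assumes "bip_N x y \<le> \<delta>"
  shows "chi x y = 0" "chiX x y = 0" "chiY x y = 0"
  using assms delta k(4,6)[of "bip_N x y / \<delta>"] by (auto simp: chi_def chiX_def chiY_def g1_def field_simps)

lemma chi_far:
  assumes "4 * \<delta> \<le> bip_N x y"
  shows "chi x y = 1" "chiX x y = 0" "chiY x y = 0" "chix x y = 0" "chiy x y = 0"
    "chiXx x y = 0" "chiXy x y = 0" "chiYx x y = 0" "chiYy x y = 0"
  using assms delta k(5-7)[of "bip_N x y / \<delta>"]
  by (auto simp: chi_def chix_def chiy_def chiX_def chiY_def chiXx_def chiXy_def chiYx_def chiYy_def g1_def g2_def field_simps)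

text \<open>The chart is singular at (0, 0), which lies on the lower side of the rectangle, but
  \<open>P\<close> vanishes identically where \<open>bip_N\<close> is below \<delta>. The two
  relatively open sets given by \<open>bip_N\<close> < \<delta> and \<open>bip_N\<close> > 0 cover
  the rectangle.\<close>

lemma P_continuous: "continuous_on ({- pi..pi} \<times> {0..\<alpha>}) (\<lambda>(x, y). P x y)"
proof -
  let ?R = "{- pi..pi} \<times> {0..\<alpha>} :: (real \<times> real) set"
  let ?N = "\<lambda>q. bip_N (fst q) (snd q)"
  define S1 where "S1 = {q \<in> ?R. ?N q \<in> {..<\<delta>}}"
  define S2 where "S2 = {q \<in> ?R. ?N q \<in> {0<..}}"
  have R: "S1 \<union> S2 = ?R" using delta by (auto simp: S1_def S2_def)
  have "openin (top_of_set ?R) S1" "openin (top_of_set ?R) S2"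
    using continuous_openin_preimage_gen[OF bip_continuous(1)[of ?R], of "{..<\<delta>}"]
      continuous_openin_preimage_gen[OF bip_continuous(1)[of ?R], of "{0<..}"]
    by (simp_all add: S1_def S2_def vimage_def Int_def)
  moreover have "continuous_on S1 (\<lambda>q. P (fst q) (snd q))"
  proof (rule continuous_on_eq[of _ "\<lambda>_. 0"])
    show "0 = P (fst q) (snd q)" if "q \<in> S1" for q
      using that chi_near_infinity[of "fst q" "snd q"] by (auto simp: S1_def P_def w1_def w2_def)
  qed simp
  moreover have "continuous_on S2 (\<lambda>q. P (fst q) (snd q))"
    by (rule continuous_on_subset[OF P_continuous_domain]) (auto simp: S2_def bip_domain_def)
  ultimately have "continuous_on (S1 \<union> S2) (\<lambda>q. P (fst q) (snd q))"
    by (intro continuous_on_Un_local_open) (simp_all add: R)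
  then show ?thesis by (simp add: R split_beta)
qed

lemma P_wall: "P x 0 = 0"
proof (cases "bip_N x 0 > 0")
  case True
  then show ?thesis by (simp add: P_def w1_def w2_def v_wall wall)
next
  case False
  then have "bip_N x 0 \<le> \<delta>" using delta by simp
  then show ?thesis using chi_near_infinity[of x 0] by (simp add: P_def w1_def w2_def)
qed

lemma P_disk: "P x \<alpha> = e1 * T1x x \<alpha> + e2 * T2x x \<alpha>"
proof -
  have "4 * \<delta> \<le> bip_N x \<alpha>" using delta cos_le_one[of x] unfolding bip_N_def by linarith
  from chi_far[OF this] show ?thesis by (simp add: P_def w1_def w2_def v_disk disk)
qed

text \<open>On the cut the cutoff is 1 and every factor of \<open>Q\<close> is periodic except the
  primitives \<open>H1\<close> and \<open>H2\<close>. The force of the test flow enters the argument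
  here, as their period.\<close>

lemma Q_jump: "Q pi y - Q (- pi) y = 2 * pi * (b1 * u1y pi y + b2 * u2y pi y)"
proof -
  have "4 * \<delta> \<le> bip_N pi y" "4 * \<delta> \<le> bip_N (- pi) y"
    using delta cosh_real_ge_1[of y] by (auto simp: bip_N_def)
  note f = chi_far[OF this(1)] chi_far[OF this(2)]
  have b: "bip_c a (- pi) y = bip_c a pi y" "bip_s a (- pi) y = bip_s a pi y"
    by (simp_all add: bip_c_def bip_s_def bip_N_def)
  have pe: "u1x (- pi) y = u1x pi y" "u1y (- pi) y = u1y pi y" "u2x (- pi) y = u2x pi y"
    "u2y (- pi) y = u2y pi y" "p (- pi) y = p pi y"
    "v1 (- pi) y = v1 pi y" "v2 (- pi) y = v2 pi y"
    by (rule periodic[symmetric] v_periodic[symmetric], simp)+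
  have "Q pi y - Q (- pi) y = (H1 pi y - H1 (- pi) y) * u1y pi y + (H2 pi y - H2 (- pi) y) * u2y pi y"
    unfolding Q_def w1_def w2_def T1y_def T2y_def f b pe by (simp add: algebra_simps)
  then show ?thesis by (simp add: H_period algebra_simps)
qed

text \<open>For each remainder, 8 + 32 comes from the terms with the velocity and with the gradient
  of the stream function, and 176 / a from the second derivatives of the cutoff. That neither
  constant involves \<delta> is decisive for the limit.\<close>

definition "C1 = 40 * (B * K) + 176 * (B * K) / a"
definition "Cw = 4 * (\<nu> * C1) + 16 * (B * K)"

lemma B_nonneg: "B \<ge> 0" using k(8)[of 0] by linarith

text \<open>Write n for sqrt(\<open>bip_N\<close>), so that n^2 < 4 \<delta>. The strip derivatives
  of chi are O(n / \<delta>), while v and H are O(n). The Cartesian derivatives of chi are O(n) with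
  strip derivatives O(1), while the stream function is O(1) with strip derivatives O(1 / n). Every
  product that occurs is thus bounded uniformly in \<delta>.\<close>

lemma rest_bounds:
  assumes x: "\<bar>x\<bar> \<le> pi" and y: "0 < y" "y < \<alpha>" and N: "bip_N x y < 4 * \<delta>"
  shows "\<bar>r1x x y\<bar> \<le> C1" "\<bar>r1y x y\<bar> \<le> C1" "\<bar>r2x x y\<bar> \<le> C1" "\<bar>r2y x y\<bar> \<le> C1"
    "\<And>h. h \<in> {H1, H2} \<Longrightarrow> \<bar>chix x y * h x y\<bar> \<le> 8 * (B * K)"
    "\<And>h. h \<in> {H1, H2} \<Longrightarrow> \<bar>chiy x y * h x y\<bar> \<le> 8 * (B * K)"
proof -
  define n where "n = sqrt (bip_N x y)"
  have Np: "0 < bip_N x y" using bip_N_pos[of y x] y by simp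
  have n: "0 < n" "n * n = bip_N x y" using Np by (simp_all add: n_def)
  have n1: "n * n \<le> 4 * \<delta>" "n * n \<le> 1" using N delta n by auto
  have ch: "cosh y \<le> 2" using n1 n cos_le_one[of x] unfolding bip_N_def by linarith
  have "(sin x)\<^sup>2 = (1 - cos x) * (1 + cos x)" using sin_squared_eq[of x] by (simp add: power2_eq_square algebra_simps)
  also have "\<dots> \<le> (n * n) * 2"
    by (intro mult_mono)
      (use n cosh_real_ge_1[of y] cos_le_one[of x] cos_ge_minus_one[of x] in \<open>unfold bip_N_def, linarith\<close>)+
  also have "\<dots> \<le> (2 * n)\<^sup>2" by (simp add: power2_eq_square)
  finally have sx: "\<bar>sin x\<bar> \<le> 2 * n" using n abs_le_square_iff[of "sin x" "2 * n"] by simp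
  have "(sinh y)\<^sup>2 = (cosh y - 1) * (cosh y + 1)" using cosh_sq[of y] by (simp add: power2_eq_square algebra_simps)
  also have "\<dots> \<le> (n * n) * 4"
    by (intro mult_mono)
      (use n ch cosh_real_ge_1[of y] cos_le_one[of x] in \<open>unfold bip_N_def, linarith\<close>)+
  also have "\<dots> = (2 * n)\<^sup>2" by (simp add: power2_eq_square)
  finally have sy: "\<bar>sinh y\<bar> \<le> 2 * n" using n abs_le_square_iff[of "sinh y" "2 * n"] by simp
  have chy: "\<bar>cosh y\<bar> \<le> 2" using ch cosh_real_ge_1[of y] by simp
  have cx: "\<bar>cos x\<bar> \<le> 1" by simp
  let ?s = "bip_N x y / \<delta>"
  have s: "\<bar>?s\<bar> \<le> 4" using Np N delta by (simp add: field_simps)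
  have g1: "\<bar>g1 ?s\<bar> \<le> 4 * B" unfolding g1_def by (rule abs_mult_mono[OF s k(8)])
  have g2: "\<bar>g2 ?s\<bar> \<le> 5 * B" unfolding g2_def
    using abs_mult_mono[OF s k(9)] k(8)[of ?s] by (smt (verit))
  have sxd: "\<bar>sin x / \<delta>\<bar> \<le> 2 * n / \<delta>" "\<bar>sinh y / \<delta>\<bar> \<le> 2 * n / \<delta>"
    using sx sy delta by (simp_all add: divide_right_mono)
  have chib: "\<bar>chix x y\<bar> \<le> B * (2 * n / \<delta>)" "\<bar>chiy x y\<bar> \<le> B * (2 * n / \<delta>)"
    unfolding chix_def chiy_def by (intro abs_mult_mono k(8) sxd)+
  have nd: "n * n / \<delta> \<le> 4" using n1 delta by (simp add: field_simps)
  have K: "K \<ge> 0" by (rule K_nonneg)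
  have hb: "\<bar>c * h\<bar> \<le> 8 * (B * K)" if "\<bar>c\<bar> \<le> B * (2 * n / \<delta>)" "\<bar>h\<bar> \<le> K * n" for c h
  proof -
    have "\<bar>c * h\<bar> \<le> B * (2 * n / \<delta>) * (K * n)" by (rule abs_mult_mono[OF that])
    also have "\<dots> = 2 * (B * K) * (n * n / \<delta>)" by simp
    also have "\<dots> \<le> 2 * (B * K) * 4" using nd B_nonneg K by (intro mult_left_mono) auto
    finally show ?thesis by simp
  qed
  have v: "\<bar>v1 x y\<bar> \<le> K * n" "\<bar>v2 x y\<bar> \<le> K * n" "\<bar>H1 x y\<bar> \<le> K * n" "\<bar>H2 x y\<bar> \<le> K * n"
    unfolding n_def using x y by (intro bound; simp)+
  show "\<And>h. h \<in> {H1, H2} \<Longrightarrow> \<bar>chix x y * h x y\<bar> \<le> 8 * (B * K)"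
    "\<And>h. h \<in> {H1, H2} \<Longrightarrow> \<bar>chiy x y * h x y\<bar> \<le> 8 * (B * K)"
    using hb[OF chib(1) v(3)] hb[OF chib(1) v(4)] hb[OF chib(2) v(3)] hb[OF chib(2) v(4)] by auto
  have ia: "\<bar>t / a\<bar> \<le> c / a" if "\<bar>t\<bar> \<le> c" for t c using that pos by (simp add: divide_right_mono)
  have bX: "\<bar>chiX x y\<bar> \<le> 16 * B * n / a" "\<bar>chiY x y\<bar> \<le> 16 * B * n / a"
  proof -
    have "\<bar>- g1 ?s * sin x * cosh y\<bar> \<le> 4 * B * (2 * n) * 2"
      by (intro abs_mult_mono sx chy) (use g1 in simp)
    then show "\<bar>chiX x y\<bar> \<le> 16 * B * n / a" unfolding chiX_def by (intro ia) simp
    have "\<bar>- g1 ?s * sinh y * cos x\<bar> \<le> 4 * B * (2 * n) * 1"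
      by (intro abs_mult_mono sy cx) (use g1 in simp)
    also have "\<dots> \<le> 16 * B * n" using mult_nonneg_nonneg[of B n] B_nonneg n by simp
    finally show "\<bar>chiY x y\<bar> \<le> 16 * B * n / a" unfolding chiY_def by (rule ia)
  qed
  \<comment> \<open>With n^2 / \<delta> \<le> 4 and c \<le> 2 the first term contributes 20 * 2 * 4
    = 160, the second at most 16.\<close>
  have big: "\<bar>- (t + v)\<bar> \<le> 176 * B" "\<bar>- (t - v)\<bar> \<le> 176 * B"
    if "\<bar>t\<bar> \<le> 5 * B * (2 * n / \<delta>) * (2 * n) * c" "\<bar>v\<bar> \<le> d" "0 \<le> c" "c \<le> 2" "d \<le> 16 * B" for t v c d
  proof -
    have "5 * B * (2 * n / \<delta>) * (2 * n) * c = 20 * B * c * (n * n / \<delta>)" by simp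
    also have "\<dots> \<le> 20 * B * 2 * 4" using nd B_nonneg that n delta Np by (intro mult_mono) auto
    finally show "\<bar>- (t + v)\<bar> \<le> 176 * B" "\<bar>- (t - v)\<bar> \<le> 176 * B" using that by linarith+
  qed
  have dn: "4 * B * (2 * n) * (2 * n) \<le> 16 * B" using n1 B_nonneg by (simp add: mult_left_le)
  have bXx: "\<bar>chiXx x y\<bar> \<le> 176 * B / a" "\<bar>chiXy x y\<bar> \<le> 176 * B / a" "\<bar>chiYx x y\<bar> \<le> 176 * B / a" "\<bar>chiYy x y\<bar> \<le> 176 * B / a"
  proof -
    have "\<bar>g2 ?s * (sin x / \<delta>) * sin x * cosh y\<bar> \<le> 5 * B * (2 * n / \<delta>) * (2 * n) * 2"
      by (intro abs_mult_mono g2 sxd sx chy)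
    moreover have "\<bar>g1 ?s * cos x * cosh y\<bar> \<le> 4 * B * 1 * 2" by (intro abs_mult_mono g1 cx chy)
    ultimately have "\<bar>- (g2 ?s * (sin x / \<delta>) * sin x * cosh y + g1 ?s * cos x * cosh y)\<bar> \<le> 176 * B"
      by (rule big) (use B_nonneg in simp_all)
    then show "\<bar>chiXx x y\<bar> \<le> 176 * B / a" unfolding chiXx_def by (rule ia)
    have "\<bar>g2 ?s * (sinh y / \<delta>) * sin x * cosh y\<bar> \<le> 5 * B * (2 * n / \<delta>) * (2 * n) * 2"
      by (intro abs_mult_mono g2 sxd sx chy)
    moreover have "\<bar>g1 ?s * sin x * sinh y\<bar> \<le> 4 * B * (2 * n) * (2 * n)" by (intro abs_mult_mono g1 sx sy)
    ultimately have "\<bar>- (g2 ?s * (sinh y / \<delta>) * sin x * cosh y + g1 ?s * sin x * sinh y)\<bar> \<le> 176 * B"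
      by (rule big) (use dn in simp_all)
    then show "\<bar>chiXy x y\<bar> \<le> 176 * B / a" unfolding chiXy_def by (rule ia)
    have "\<bar>g2 ?s * (sin x / \<delta>) * sinh y * cos x\<bar> \<le> 5 * B * (2 * n / \<delta>) * (2 * n) * 1"
      by (intro abs_mult_mono g2 sxd sy cx)
    moreover have "\<bar>g1 ?s * sinh y * sin x\<bar> \<le> 4 * B * (2 * n) * (2 * n)" by (intro abs_mult_mono g1 sx sy)
    ultimately have "\<bar>- (g2 ?s * (sin x / \<delta>) * sinh y * cos x - g1 ?s * sinh y * sin x)\<bar> \<le> 176 * B"
      by (rule big) (use dn in simp_all)
    then show "\<bar>chiYx x y\<bar> \<le> 176 * B / a" unfolding chiYx_def by (rule ia)
    have "\<bar>g2 ?s * (sinh y / \<delta>) * sinh y * cos x\<bar> \<le> 5 * B * (2 * n / \<delta>) * (2 * n) * 1"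
      by (intro abs_mult_mono g2 sxd sy cx)
    moreover have "\<bar>g1 ?s * cosh y * cos x\<bar> \<le> 4 * B * 2 * 1" by (intro abs_mult_mono g1 cx chy)
    ultimately have "\<bar>- (g2 ?s * (sinh y / \<delta>) * sinh y * cos x + g1 ?s * cosh y * cos x)\<bar> \<le> 176 * B"
      by (rule big) (use B_nonneg in simp_all)
    then show "\<bar>chiYy x y\<bar> \<le> 176 * B / a" unfolding chiYy_def by (rule ia)
  qed
  have cs: "\<bar>bip_c a x y\<bar> \<le> a / (n * n)" "\<bar>bip_s a x y\<bar> \<le> a / (n * n)"
    using bip_cs_bound[OF pos(1) Np] n by simp_all
  have psi: "\<bar>\<psi>x x y\<bar> \<le> 2 * K * a / n" "\<bar>\<psi>y x y\<bar> \<le> 2 * K * a / n"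
  proof -
    have e: "K * n * (a / (n * n)) = K * a / n" using n(1) by simp
    have e2: "2 * K * a / n = 2 * (K * a / n)" by simp
    have "\<bar>v2 x y * bip_c a x y\<bar> \<le> K * a / n" "\<bar>v1 x y * bip_s a x y\<bar> \<le> K * a / n"
      "\<bar>v2 x y * bip_s a x y\<bar> \<le> K * a / n" "\<bar>v1 x y * bip_c a x y\<bar> \<le> K * a / n"
      unfolding e[symmetric] by (intro abs_mult_mono v cs)+
    then show "\<bar>\<psi>x x y\<bar> \<le> 2 * K * a / n" "\<bar>\<psi>y x y\<bar> \<le> 2 * K * a / n"
      unfolding \<psi>x_def \<psi>y_def using e2 by linarith+
  qed
  have pc: "\<bar>s * t\<bar> \<le> 32 * (B * K)" if "\<bar>s\<bar> \<le> 2 * K * a / n" "\<bar>t\<bar> \<le> 16 * B * n / a" for s t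
  proof -
    have "\<bar>s * t\<bar> \<le> 2 * K * a / n * (16 * B * n / a)" by (rule abs_mult_mono[OF that])
    also have "\<dots> = 32 * (B * K)" using n(1) pos by (simp add: field_simps)
    finally show ?thesis .
  qed
  have pcc: "\<bar>\<psi> x y * t\<bar> \<le> 176 * (B * K) / a" if "\<bar>t\<bar> \<le> 176 * B / a" for t
    using abs_mult_mono[OF psi_bound[of x y] that] x y by (simp add: mult.commute mult.left_commute)
  show "\<bar>r1x x y\<bar> \<le> C1" unfolding r1x_def C1_def
    using hb[OF chib(1) v(1)] pc[OF psi(1) bX(2)] pcc[OF bXx(3)] by linarith
  show "\<bar>r1y x y\<bar> \<le> C1" unfolding r1y_def C1_def
    using hb[OF chib(2) v(1)] pc[OF psi(2) bX(2)] pcc[OF bXx(4)] by linarith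
  show "\<bar>r2x x y\<bar> \<le> C1" unfolding r2x_def C1_def
    using hb[OF chib(1) v(2)] pc[OF psi(1) bX(1)] pcc[OF bXx(1)] by linarith
  show "\<bar>r2y x y\<bar> \<le> C1" unfolding r2y_def C1_def
    using hb[OF chib(2) v(2)] pc[OF psi(2) bX(1)] pcc[OF bXx(2)] by linarith
qed

definition "en x y = (u1x x y)\<^sup>2 + (u1y x y)\<^sup>2 + (u2x x y)\<^sup>2 + (u2y x y)\<^sup>2"

lemma C1_nonneg: "C1 \<ge> 0" using B_nonneg K_nonneg pos by (simp add: C1_def)
lemma Cw_nonneg: "Cw \<ge> 0" using B_nonneg K_nonneg C1_nonneg pos by (simp add: Cw_def)

text \<open>\<open>bip_N\<close> is at least cosh y - 1, hence at least y^2 / 2; above the height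
  sqrt(8 \<delta>) the cutoff is therefore constant.\<close>

lemma W_zero:
  assumes "0 < y" "y < \<alpha>" "8 * \<delta> < y\<^sup>2"
  shows "Py x y - Qx x y = 0"
proof -
  have "4 * \<delta> \<le> bip_N x y" using cosh_ge_quadratic[of y] cos_le_one[of x] assms unfolding bip_N_def by linarith
  from chi_far[OF this] show ?thesis
    unfolding W_eq[OF assms(1,2)] r1x_def r1y_def r2x_def r2y_def by simp
qed

lemma W_bound:
  assumes x: "\<bar>x\<bar> \<le> pi" and y: "0 < y" "y < \<alpha>" and l: "0 < lm"
  shows "\<bar>Py x y - Qx x y\<bar> \<le> Cw * (lm * en x y + 1 / lm)"
proof -
  let ?D = "\<bar>u1x x y\<bar> + \<bar>u1y x y\<bar> + \<bar>u2x x y\<bar> + \<bar>u2y x y\<bar>"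
  have "\<bar>Py x y - Qx x y\<bar> \<le> Cw * ?D"
  proof (cases "bip_N x y < 4 * \<delta>")
    case True
    note r = rest_bounds[OF x y True]
    have d: "\<bar>u1y x y - u2x x y\<bar> \<le> ?D" "\<bar>u1x x y + u2y x y\<bar> \<le> ?D" by linarith+
    have rr: "\<bar>r1y x y - r2x x y\<bar> \<le> 2 * C1" "\<bar>r1x x y + r2y x y\<bar> \<le> 2 * C1" using r(1-4) by linarith+
    have "\<bar>(r1y x y - r2x x y) * (u1y x y - u2x x y)\<bar> \<le> 2 * C1 * ?D"
      "\<bar>(r1x x y + r2y x y) * (u1x x y + u2y x y)\<bar> \<le> 2 * C1 * ?D"
      by (intro abs_mult_mono d rr)+
    then have "\<bar>(r1y x y - r2x x y) * (u1y x y - u2x x y) + (r1x x y + r2y x y) * (u1x x y + u2y x y)\<bar> \<le> 4 * C1 * ?D"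
      by linarith
    then have 1: "\<bar>\<nu> * ((r1y x y - r2x x y) * (u1y x y - u2x x y) + (r1x x y + r2y x y) * (u1x x y + u2y x y))\<bar> \<le> \<nu> * (4 * C1 * ?D)"
      using pos by (intro abs_mult_mono) auto
    have h: "\<bar>c * (H1 x y * s + H2 x y * t)\<bar> \<le> 8 * (B * K) * (\<bar>s\<bar> + \<bar>t\<bar>)"
      if "\<bar>c * H1 x y\<bar> \<le> 8 * (B * K)" "\<bar>c * H2 x y\<bar> \<le> 8 * (B * K)" for c s t
    proof -
      have "\<bar>c * H1 x y * s\<bar> \<le> 8 * (B * K) * \<bar>s\<bar>" "\<bar>c * H2 x y * t\<bar> \<le> 8 * (B * K) * \<bar>t\<bar>"
        by (intro abs_mult_mono that order.refl)+
      moreover have "c * (H1 x y * s + H2 x y * t) = c * H1 x y * s + c * H2 x y * t" by (simp add: algebra_simps)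
      ultimately show ?thesis unfolding distrib_left by linarith
    qed
    have 2: "\<bar>chiy x y * (H1 x y * u1x x y + H2 x y * u2x x y)\<bar> \<le> 8 * (B * K) * (\<bar>u1x x y\<bar> + \<bar>u2x x y\<bar>)"
      by (intro h r) auto
    have 3: "\<bar>chix x y * (H1 x y * u1y x y + H2 x y * u2y x y)\<bar> \<le> 8 * (B * K) * (\<bar>u1y x y\<bar> + \<bar>u2y x y\<bar>)"
      by (intro h r) auto
    have BK: "0 \<le> B * K * ?D" using B_nonneg K_nonneg by simp
    have "\<bar>Py x y - Qx x y\<bar> \<le> \<nu> * (4 * C1 * ?D) + (8 * (B * K) * (\<bar>u1x x y\<bar> + \<bar>u2x x y\<bar>) + 8 * (B * K) * (\<bar>u1y x y\<bar> + \<bar>u2y x y\<bar>))"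
    proof -
      have tri: "\<bar>s + t - v\<bar> \<le> A + (C + D)" if "\<bar>s\<bar> \<le> A" "\<bar>t\<bar> \<le> C" "\<bar>v\<bar> \<le> D" for s t v A C D :: real
        using that by linarith
      show ?thesis unfolding W_eq[OF y] by (rule tri[OF 1 2 3])
    qed
    also have "\<dots> = \<nu> * (4 * C1 * ?D) + 8 * (B * K * ?D)" by (simp only: distrib_left ac_simps)
    also have "\<dots> \<le> \<nu> * (4 * C1 * ?D) + 16 * (B * K * ?D)" using BK by linarith
    also have "\<dots> = Cw * ?D" unfolding Cw_def by algebra
    finally show ?thesis .
  next
    case False
    then have "4 * \<delta> \<le> bip_N x y" by simp
    from chi_far[OF this] show ?thesis
      unfolding W_eq[OF y] r1x_def r1y_def r2x_def r2y_def using Cw_nonneg by simp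
  qed
  also have "\<dots> \<le> Cw * (lm * en x y + 1 / lm)"
  proof (rule mult_left_mono[OF _ Cw_nonneg])
    have "1 / lm = 4 * (1 / (4 * lm))" by simp
    then show "?D \<le> lm * en x y + 1 / lm" unfolding en_def
      using abs_le_weighted_square[OF l, of "u1x x y"] abs_le_weighted_square[OF l, of "u1y x y"]
        abs_le_weighted_square[OF l, of "u2x x y"] abs_le_weighted_square[OF l, of "u2y x y"]
      unfolding distrib_left by linarith
  qed
  finally show ?thesis .
qed

end

section \<open>The cutoff error and its limit\<close>

context cutoff_reciprocity
begin

text \<open>Green's theorem for P dx + Q dy on the strip: the wall contributes nothing, the circle
  gives the flux, and the two vertical sides differ by the jump of \<open>Q\<close>, whose primitive
  \<open>J\<close> only sees the boundary values of the velocity. The error is supported in 0 < y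
  \<le> sqrt(8 \<delta>); Young's inequality bounds it by l times the energy plus a multiple of the
  area of that thin strip divided by l.\<close>

lemma flux_error:
  assumes l: "0 < l"
  shows "\<bar>integral {- pi..pi} (\<lambda>x. e1 * T1x x \<alpha> + e2 * T2x x \<alpha>) - 2 * pi * (b2 * V)\<bar>
     \<le> Cw * (l * M + 8 * pi * sqrt (8 * \<delta>) / l)"
proof -
  define J where "J y = 2 * pi * (b1 * u1 pi y + b2 * u2 pi y)" for y
  define m where "m = sqrt (8 * \<delta>)"
  have m: "0 < m" "m * m = 8 * \<delta>" using delta by (simp_all add: m_def)
  define En where "En y = integral {- pi..pi} (\<lambda>x. en x y)" for y
  have cen: "continuous_on (UNIV \<times> {0<..<\<alpha>}) (\<lambda>(x, y). en x y)"
  proof -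
    have "continuous_on (UNIV \<times> {0<..<\<alpha>}) (\<lambda>q. u1x (fst q) (snd q))" "continuous_on (UNIV \<times> {0<..<\<alpha>}) (\<lambda>q. u1y (fst q) (snd q))"
      "continuous_on (UNIV \<times> {0<..<\<alpha>}) (\<lambda>q. u2x (fst q) (snd q))" "continuous_on (UNIV \<times> {0<..<\<alpha>}) (\<lambda>q. u2y (fst q) (snd q))"
      by (rule continuous_on_subset[OF _ open_strip_subset], intro c1, simp)+
    then show ?thesis unfolding en_def split_beta by (intro continuous_intros)
  qed
  have cW: "continuous_on (UNIV \<times> {0<..<\<alpha>}) (\<lambda>(x, y). Py x y - Qx x y)"
    unfolding split_beta by (intro continuous_intros Py_Qx_continuous)
  have slice: "continuous_on {- pi..pi} (\<lambda>x. f x y)"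
    if "continuous_on (UNIV \<times> {0<..<\<alpha>}) (\<lambda>(x, y). f x y)" "0 < y" "y < \<alpha>" for f :: "real \<Rightarrow> real \<Rightarrow> real" and y
    using continuous_on_slice[OF that(1), of y] that(2,3) by (auto intro: continuous_on_subset)
  have cint: "continuous_on {y0..y1} (\<lambda>y. integral {- pi..pi} (\<lambda>x. f x y))"
    if f: "continuous_on (UNIV \<times> {0<..<\<alpha>}) (\<lambda>(x, y). f x y)" and y: "0 < y0" "y1 < \<alpha>"
    for f :: "real \<Rightarrow> real \<Rightarrow> real" and y0 y1
  proof (rule integral_continuous_on_param[of _ "- pi" pi, unfolded cbox_interval])
    show "continuous_on ({y0..y1} \<times> {- pi..pi}) (\<lambda>(y, x). f x y)"
      by (rule continuous_on_prod_swap, rule continuous_on_subset[OF f]) (use y in auto)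
  qed
  define c where "c = Cw * (2 * pi / l)"
  have c: "0 \<le> c" using Cw_nonneg l by (simp add: c_def)
  \<comment> \<open>4 m^2 / (y + m)^2 is a smooth majorant of the indicator of y \<le> m. It gives
    one bound for all heights, and its integral is at most 4 m.\<close>
  have inner: "\<bar>integral {- pi..pi} (\<lambda>x. Py x y - Qx x y)\<bar> \<le> Cw * l * En y + c * (4 * m\<^sup>2 / (y + m)\<^sup>2)"
    if y: "0 < y" "y < \<alpha>" for y
  proof -
    have En: "0 \<le> En y" unfolding En_def
      by (rule Henstock_Kurzweil_Integration.integral_nonneg[OF integrable_continuous_real[OF slice[OF cen y]]])
         (simp add: en_def)
    have r: "0 \<le> 4 * m\<^sup>2 / (y + m)\<^sup>2" by simp
    show ?thesis
    proof (cases "y \<le> m")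
      case True
      have "(y + m)\<^sup>2 \<le> (2 * m)\<^sup>2" using True y m by (intro power_mono) auto
      then have 1: "1 \<le> 4 * m\<^sup>2 / (y + m)\<^sup>2" using y m by (simp add: power_mult_distrib)
      have "norm (integral {- pi..pi} (\<lambda>x. Py x y - Qx x y)) \<le> integral {- pi..pi} (\<lambda>x. Cw * (l * en x y + 1 / l))"
      proof (rule integral_norm_bound_integral)
        show "(\<lambda>x. Py x y - Qx x y) integrable_on {- pi..pi}"
          by (rule integrable_continuous_real[OF slice[where f = "\<lambda>x y. Py x y - Qx x y", OF cW y]])
        show "(\<lambda>x. Cw * (l * en x y + 1 / l)) integrable_on {- pi..pi}"
          by (rule integrable_continuous_real) (intro continuous_intros slice[OF cen y])
        show "norm (Py x y - Qx x y) \<le> Cw * (l * en x y + 1 / l)" if "x \<in> {- pi..pi}" for x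
          using W_bound[OF _ y l, of x] that by auto
      qed
      also have "\<dots> = Cw * (l * En y + 2 * pi * (1 / l))"
      proof -
        have "integral {- pi..pi} (\<lambda>x. l * en x y + 1 / l) = l * En y + 2 * pi * (1 / l)"
          unfolding En_def by (subst integral_add)
            (auto intro!: integrable_continuous_real continuous_intros slice[OF cen y])
        then show ?thesis by simp
      qed
      also have "\<dots> = Cw * l * En y + c * 1" by (simp add: c_def algebra_simps)
      also have "\<dots> \<le> Cw * l * En y + c * (4 * m\<^sup>2 / (y + m)\<^sup>2)"
        using mult_left_mono[OF 1 c] by simp
      finally show ?thesis by simp
    next
      case False
      then have "m * m < y * y" using m by (intro mult_strict_mono) auto
      then have "8 * \<delta> < y\<^sup>2" using m by (simp add: power2_eq_square)
      then have "integral {- pi..pi} (\<lambda>x. Py x y - Qx x y) = 0" using W_zero[OF y] by simp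
      then show ?thesis using En c Cw_nonneg l by simp
    qed
  qed
  have "\<bar>integral {- pi..pi} (\<lambda>x. P x \<alpha>) - integral {- pi..pi} (\<lambda>x. P x 0) - (J \<alpha> - J 0)\<bar>
     \<le> Cw * (l * M + 8 * pi * sqrt (8 * \<delta>) / l)"
  proof (rule green_strip[where Q = Q and Py = Py and Qx = Qx])
    show "continuous_on ({- pi..pi} \<times> {0<..<\<alpha>}) (\<lambda>(x, y). Py x y)"
      "continuous_on ({- pi..pi} \<times> {0<..<\<alpha>}) (\<lambda>(x, y). Qx x y)"
      using Py_Qx_continuous unfolding split_beta by (auto intro: continuous_on_subset)
    show "continuous_on {0..\<alpha>} J" unfolding J_def by (intro continuous_intros c0)
    show "(J has_real_derivative (Q pi y - Q (- pi) y)) (at y)" if "0 < y" "y < \<alpha>" for y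
      unfolding J_def Q_jump by (intro DERIV_cmult DERIV_add u1_pi u2_pi that)
    fix y0 y1 assume y: "0 < y0" "y0 < y1" "y1 < \<alpha>"
    have i: "((\<lambda>y. 4 * m\<^sup>2 / (y + m)\<^sup>2) has_integral (- 4 * m\<^sup>2 / (y1 + m) - - 4 * m\<^sup>2 / (y0 + m))) {y0..y1}"
    proof (rule fundamental_theorem_of_calculus)
      show "((\<lambda>y. - 4 * m\<^sup>2 / (y + m)) has_vector_derivative 4 * m\<^sup>2 / (x + m)\<^sup>2) (at x within {y0..y1})"
        if "x \<in> {y0..y1}" for x
        unfolding has_real_derivative_iff_has_vector_derivative[symmetric]
        using that y m by (auto intro!: derivative_eq_intros simp: power2_eq_square)
    qed (use y in simp)
    have il: "integral {y0..y1} (\<lambda>y. 4 * m\<^sup>2 / (y + m)\<^sup>2) \<le> 4 * m"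
    proof -
      have "4 * m\<^sup>2 \<le> 4 * m * (y0 + m)" using y m(1) by (simp add: power2_eq_square distrib_left)
      then have "4 * m\<^sup>2 / (y0 + m) \<le> 4 * m" "0 \<le> 4 * m\<^sup>2 / (y1 + m)" using y m(1) by (simp_all add: pos_divide_le_eq)
      then show ?thesis using i by (simp add: integral_unique)
    qed
    have cEn: "continuous_on {y0..y1} En" unfolding En_def by (rule cint[OF cen y(1,3)])
    have "norm (integral {y0..y1} (\<lambda>y. integral {- pi..pi} (\<lambda>x. Py x y - Qx x y)))
       \<le> integral {y0..y1} (\<lambda>y. Cw * l * En y + c * (4 * m\<^sup>2 / (y + m)\<^sup>2))"
    proof (rule integral_norm_bound_integral)
      show "(\<lambda>y. integral {- pi..pi} (\<lambda>x. Py x y - Qx x y)) integrable_on {y0..y1}"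
        by (rule integrable_continuous_real[OF cint[where f = "\<lambda>x y. Py x y - Qx x y", OF cW y(1,3)]])
      show "(\<lambda>y. Cw * l * En y + c * (4 * m\<^sup>2 / (y + m)\<^sup>2)) integrable_on {y0..y1}"
        using y m by (intro integrable_continuous_real continuous_intros cEn) auto
      show "norm (integral {- pi..pi} (\<lambda>x. Py x y - Qx x y)) \<le> Cw * l * En y + c * (4 * m\<^sup>2 / (y + m)\<^sup>2)"
        if "y \<in> {y0..y1}" for y using inner[of y] that y by auto
    qed
    also have "\<dots> = Cw * l * integral {y0..y1} En + c * integral {y0..y1} (\<lambda>y. 4 * m\<^sup>2 / (y + m)\<^sup>2)"
    proof -
      have a: "(\<lambda>y. Cw * l * En y) integrable_on {y0..y1}"
        by (intro integrable_continuous_real continuous_intros cEn)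
      have b: "(\<lambda>y. c * (4 * m\<^sup>2 / (y + m)\<^sup>2)) integrable_on {y0..y1}"
        using y m by (intro integrable_continuous_real continuous_intros) auto
      show ?thesis unfolding integral_add[OF a b] by (simp only: integral_mult_right)
    qed
    also have "\<dots> \<le> Cw * l * M + c * (4 * m)"
    proof (rule add_mono)
      have "integral {y0..y1} En \<le> M" unfolding En_def en_def by (rule energy[OF y])
      then show "Cw * l * integral {y0..y1} En \<le> Cw * l * M" using Cw_nonneg l by (intro mult_left_mono) auto
      show "c * integral {y0..y1} (\<lambda>y. 4 * m\<^sup>2 / (y + m)\<^sup>2) \<le> c * (4 * m)" by (rule mult_left_mono[OF il c])
    qed
    also have "\<dots> = Cw * (l * M + 8 * pi * sqrt (8 * \<delta>) / l)" unfolding c_def m_def[symmetric] by (simp add: algebra_simps)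
    finally show "\<bar>integral {y0..y1} (\<lambda>y. integral {- pi..pi} (\<lambda>x. Py x y - Qx x y))\<bar>
       \<le> Cw * (l * M + 8 * pi * sqrt (8 * \<delta>) / l)" by simp
  qed (use pos P_continuous P_deriv Q_deriv in auto)
  then show ?thesis by (simp add: P_wall P_disk J_def wall disk)
qed

end

context reciprocity
begin

text \<open>The left side does not depend on \<delta>, so the cutoff error must vanish: with the
  weight \<delta>^(1/4) both of its parts are O(\<delta>^(1/4)).\<close>

theorem boundary_flux:
  "integral {- pi..pi} (\<lambda>x. e1 * (- p x \<alpha> * bip_s a x \<alpha> + \<nu> * (u1y x \<alpha> - u2x x \<alpha>))
      + e2 * (p x \<alpha> * bip_c a x \<alpha> + \<nu> * (u1x x \<alpha> + u2y x \<alpha>))) = 2 * pi * (b2 * V)"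
proof -
  obtain k k1 k2 :: "real \<Rightarrow> real" and B where k: "\<And>s. (k has_real_derivative k1 s) (at s)" "\<And>s. (k1 has_real_derivative k2 s) (at s)"
    "continuous_on UNIV k2" "\<And>s. s \<le> 1 \<Longrightarrow> k s = 0" "\<And>s. 4 \<le> s \<Longrightarrow> k s = 1"
    "\<And>s. s \<le> 1 \<or> 4 \<le> s \<Longrightarrow> k1 s = 0" "\<And>s. s \<le> 1 \<or> 4 \<le> s \<Longrightarrow> k2 s = 0"
    "\<And>s. \<bar>k1 s\<bar> \<le> B" "\<And>s. \<bar>k2 s\<bar> \<le> B"
    by (rule C2_cutoff) blast
  let ?F = "integral {- pi..pi} (\<lambda>x. e1 * (- p x \<alpha> * bip_s a x \<alpha> + \<nu> * (u1y x \<alpha> - u2x x \<alpha>))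
      + e2 * (p x \<alpha> * bip_c a x \<alpha> + \<nu> * (u1x x \<alpha> + u2y x \<alpha>)))"
  \<comment> \<open>The value of \<open>Cw\<close>, written outside the cutoff locale so that it
    stays fixed while \<delta> tends to 0.\<close>
  define C where "C = 4 * (\<nu> * (40 * (B * K) + 176 * (B * K) / a)) + 16 * (B * K)"
  define d0 where "d0 = min (1 / 4) ((cosh \<alpha> - 1) / 4)"
  have d0: "0 < d0" using cosh_real_strict_mono[of 0 \<alpha>] pos by (simp add: d0_def)
  have le: "\<bar>?F - 2 * pi * (b2 * V)\<bar> \<le> C * (\<delta> powr (1/4) * M + 8 * pi * sqrt (8 * \<delta>) / \<delta> powr (1/4))"
    if d: "0 < \<delta>" "\<delta> < d0" for \<delta>
  proof -
    have d': "\<delta> \<le> 1 / 4" "4 * \<delta> \<le> cosh \<alpha> - 1" using d by (simp_all add: d0_def)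
    interpret c: cutoff_reciprocity a \<alpha> \<nu> V M u1 u2 p u1x u1y u2x u2y px py u1xx u1xy u1yy u2xx u2xy u2yy K b1 b2 e1 e2
       v1 v2 \<psi> H1 H2 pr v1x v1y v2x v2y k k1 k2 B \<delta>
      by unfold_locales (rule k d d' | assumption)+
    have "c.Cw = C" unfolding c.Cw_def c.C1_def C_def ..
    with c.flux_error[of "\<delta> powr (1/4)"] d show ?thesis by (simp add: c.T1x_def c.T2x_def)
  qed
  have "((\<lambda>\<delta>. C * (\<delta> powr (1/4) * M + 8 * pi * sqrt (8 * \<delta>) / \<delta> powr (1/4))) \<longlongrightarrow> 0) (at_right 0)"
    by real_asymp
  moreover have "\<forall>\<^sub>F \<delta> in at_right 0. \<bar>?F - 2 * pi * (b2 * V)\<bar> \<le> C * (\<delta> powr (1/4) * M + 8 * pi * sqrt (8 * \<delta>) / \<delta> powr (1/4))"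
    using eventually_at_right_less[of "0::real"] eventually_at_right_real[OF d0]
    by eventually_elim (rule le, auto)
  ultimately have "\<bar>?F - 2 * pi * (b2 * V)\<bar> \<le> 0"
    by (rule tendsto_lowerbound) simp
  then show ?thesis by simp
qed

end

section \<open>Explicit flows for a disk moving perpendicular and parallel to the wall\<close>

text \<open>With z = |x| / 2 one has 1 - cos x = 2 (sin z)^2, and z lies below 1.6, so z^2 \<le> 3
  and the cubic Taylor error is at most z / 2; hence sin z is at least z / 2. The lemma bounds |x|
  by 3 sqrt(\<open>bip_N\<close>).\<close>

lemma square_le_one_minus_cos: "\<bar>x\<bar> \<le> pi \<Longrightarrow> x\<^sup>2 \<le> 8 * (1 - cos x)"
proof -
  assume x: "\<bar>x\<bar> \<le> pi"
  define z where "z = \<bar>x\<bar> / 2"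
  have z: "0 \<le> z" "z \<le> 1.6" "\<bar>x\<bar> = 2 * z" using x pi_less_4 pi_approx by (auto simp: z_def)
  have "\<bar>sin z - (\<Sum>m<3. sin_coeff m * z ^ m)\<bar> \<le> inverse (fact 3) * \<bar>z\<bar> ^ 3"
    by (rule Maclaurin_sin_bound)
  then have 1: "\<bar>sin z - z\<bar> \<le> z ^ 3 / 6" using z by (simp add: sin_coeff_def eval_nat_numeral)
  have "z * z \<le> 1.6 * 1.6" using z by (intro mult_mono) auto
  then have "z * (z * z) \<le> z * 3" using z by (intro mult_left_mono) auto
  then have "z / 2 \<le> sin z" using 1 unfolding power3_eq_cube mult.assoc by linarith
  then have "(z / 2)\<^sup>2 \<le> (sin z)\<^sup>2" using z by (intro power_mono) auto
  moreover have "cos (2 * z) = 1 - 2 * (sin z)\<^sup>2" by (rule cos_double_sin)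
  moreover have "cos x = cos (2 * z)" "x\<^sup>2 = (2 * z)\<^sup>2" using z(3) by (metis cos_abs_real, metis power2_abs)
  ultimately show ?thesis by (simp add: power_mult_distrib power_divide)
qed

section \<open>Bounds and relations shared by the two explicit flows\<close>

locale bipolar_params =
  fixes a \<alpha> \<nu> :: real
  assumes pos: "0 < a" "0 < \<alpha>" "0 < \<nu>"
begin

text \<open>One constant that dominates \<open>bip_N\<close>, cosh y, sinh y and y on the whole
  strip.\<close>

definition "L = cosh \<alpha> + 1"

lemma L_ge: "2 \<le> L" using cosh_real_ge_1[of \<alpha>] by (simp add: L_def)

lemma basic_bounds:
  assumes x: "\<bar>x\<bar> \<le> pi" and y: "0 < y" "y \<le> \<alpha>"
  defines "n \<equiv> sqrt (bip_N x y)"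
  shows "0 < n" "n * n = bip_N x y" "\<bar>x\<bar> \<le> 3 * n" "\<bar>sin x\<bar> \<le> 2 * n" "0 \<le> sinh y" "sinh y \<le> L * n" "y \<le> L * n"
    "\<bar>cosh y\<bar> \<le> L" "bip_N x y \<le> L * n" "y \<le> L" "sinh y \<le> L"
proof -
  have N: "0 < bip_N x y" using bip_N_pos[of y x] y by simp
  show n: "0 < n" "n * n = bip_N x y" using N by (simp_all add: n_def)
  have c1: "1 \<le> cosh y" by (rule cosh_real_ge_1)
  have ch: "cosh y \<le> cosh \<alpha>" using y cosh_real_nonneg_le_iff[of y \<alpha>] by simp
  then show chL: "\<bar>cosh y\<bar> \<le> L" using c1 by (simp add: L_def)
  have cx: "1 - cos x \<le> n * n" "cosh y - 1 \<le> n * n" using n c1 cos_le_one[of x] unfolding bip_N_def by linarith+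
  have "x\<^sup>2 \<le> 8 * (1 - cos x)" by (rule square_le_one_minus_cos[OF x])
  also have "\<dots> \<le> 8 * (n * n)" using cx(1) by (intro mult_left_mono) auto
  also have "\<dots> \<le> (3 * n)\<^sup>2" by (simp add: power2_eq_square)
  finally show "\<bar>x\<bar> \<le> 3 * n" using n(1) abs_le_square_iff[of x "3 * n"] by simp
  have "(sin x)\<^sup>2 = (1 - cos x) * (1 + cos x)" using sin_squared_eq[of x] by (simp add: power2_eq_square algebra_simps)
  also have "\<dots> \<le> (n * n) * 2"
    by (intro mult_mono)
      (use cx(1) zero_le_square[of n] cos_le_one[of x] cos_ge_minus_one[of x] in linarith)+
  also have "\<dots> \<le> (2 * n)\<^sup>2" by (simp add: power2_eq_square)
  finally show "\<bar>sin x\<bar> \<le> 2 * n" using n abs_le_square_iff[of "sin x" "2 * n"] by simp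
  show S0: "0 \<le> sinh y" using y by simp
  have "(sinh y)\<^sup>2 = (cosh y - 1) * (cosh y + 1)" using cosh_sq[of y] by (simp add: power2_eq_square algebra_simps)
  also have "\<dots> \<le> (n * n) * L"
    by (intro mult_mono) (use cx n ch c1 in \<open>auto simp: L_def\<close>)
  also have "\<dots> \<le> (n * n) * (L * L)"
    by (intro mult_left_mono zero_le_square) (use L_ge mult_left_mono[of 1 L L] in simp)
  also have "\<dots> = (L * n)\<^sup>2" by (simp add: power2_eq_square)
  finally show SL: "sinh y \<le> L * n" using n L_ge by (auto dest: power2_le_imp_le)
  then show "y \<le> L * n" using sinh_ge_self[of y] y by simp
  have NL: "n * n \<le> L" using n(2) ch cos_ge_minus_one[of x] unfolding bip_N_def L_def by linarith
  also have "\<dots> \<le> L * L" using L_ge by (auto intro: mult_left_mono[of 1 L L, simplified])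
  finally have "n \<le> L" using n L_ge by (metis power2_eq_square power2_le_imp_le zero_le_numeral order_trans)
  then show "bip_N x y \<le> L * n" using n by (metis mult_right_mono less_imp_le)
  have "sinh y < cosh y" by (rule sinh_less_cosh_real)
  then show "sinh y \<le> L" using chL by simp
  then show "y \<le> L" using sinh_ge_self[of y] y by simp
qed

lemma inverse_N_derivs:
  assumes "0 < y"
  shows "((\<lambda>x. inverse (bip_N x y)) has_real_derivative - sin x * (inverse (bip_N x y))\<^sup>2) (at x)"
    and "((\<lambda>y. inverse (bip_N x y)) has_real_derivative - sinh y * (inverse (bip_N x y))\<^sup>2) (at y)"
proof -
  have N: "bip_N x y \<noteq> 0" using bip_N_pos[of y x] assms by simp
  show "((\<lambda>x. inverse (bip_N x y)) has_real_derivative - sin x * (inverse (bip_N x y))\<^sup>2) (at x)"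
    by (rule DERIV_cong[OF DERIV_inverse_fun[OF bip_derivs(1)[OF N] N]]) (simp add: power2_eq_square)
  show "((\<lambda>y. inverse (bip_N x y)) has_real_derivative - sinh y * (inverse (bip_N x y))\<^sup>2) (at y)"
    by (rule DERIV_cong[OF DERIV_inverse_fun[OF bip_derivs(2)[OF N] N]]) (simp add: power2_eq_square)
qed

text \<open>These relations present all fields as polynomials in cos x, sin x, cosh y, sinh y and 1
  / \<open>bip_N\<close>, so that the differential identities below become questions of ideal
  membership for \<open>algebra\<close>.\<close>

lemma facts:
  assumes "0 < y"
  shows "bip_N x y * inverse (bip_N x y) = 1" "(sin x)\<^sup>2 = 1 - (cos x)\<^sup>2" "(sinh y)\<^sup>2 = (cosh y)\<^sup>2 - 1"
    "cosh y = bip_N x y + cos x" "a * inverse a = 1"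
    "bip_c a x y = a * (cos x * cosh y - 1) * (inverse (bip_N x y))\<^sup>2"
    "bip_s a x y = - a * sin x * sinh y * (inverse (bip_N x y))\<^sup>2"
  using bip_N_pos[of y x] assms pos
  by (simp_all add: sin_squared_eq cosh_sq bip_N_def bip_c_def bip_s_def divide_inverse power_inverse)

end

section \<open>The disk moving perpendicular to the wall\<close>

locale perp_params = bipolar_params
begin

definition "t = tanh \<alpha>"
definition "A = 1 / (2 * (tanh \<alpha> - \<alpha>))"
definition "G1 y = 4 * A * (sinh y - t * cosh y)"
definition "G1' y = 4 * A * (cosh y - t * sinh y)"
text \<open>The stream function is X g(y), where X is the horizontal coordinate; it is biharmonic
  when g is spanned by 1, y, sinh(2 y) and cosh(2 y). No slip on the wall means g = g' = 0 at 0. On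
  the circle g = 1 and g' = 0 make the stream function agree with X to first order, which is the
  velocity (0, 1). These four conditions fix \<open>t\<close> and \<open>A\<close>; the product
  \<open>G1 y * sinh y\<close> is g'.\<close>

definition "g y = 2 * A * (sinh y * cosh y - y - t * (sinh y)\<^sup>2)"
definition "v1 x y = G1 y * sinh y * sin x * (cos x * cosh y - 1) * inverse (bip_N x y)"
definition "v2 x y = g y - G1 y * (sinh y)\<^sup>2 * (sin x)\<^sup>2 * inverse (bip_N x y)"
definition "v1x x y = G1 y * sinh y * ((cos x * (cos x * cosh y - 1) - (sin x)\<^sup>2 * cosh y) * inverse (bip_N x y)
    - (sin x)\<^sup>2 * (cos x * cosh y - 1) * (inverse (bip_N x y))\<^sup>2)"
definition "v1y x y = (G1' y * sinh y + G1 y * cosh y) * sin x * (cos x * cosh y - 1) * inverse (bip_N x y)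
    + G1 y * sinh y * sin x * cos x * sinh y * inverse (bip_N x y)
    - G1 y * (sinh y)\<^sup>2 * sin x * (cos x * cosh y - 1) * (inverse (bip_N x y))\<^sup>2"
definition "v2x x y = - G1 y * (sinh y)\<^sup>2 * (2 * sin x * cos x * inverse (bip_N x y) - (sin x) ^ 3 * (inverse (bip_N x y))\<^sup>2)"
definition "v2y x y = G1 y * sinh y - (G1' y * (sinh y)\<^sup>2 + 2 * G1 y * sinh y * cosh y) * (sin x)\<^sup>2 * inverse (bip_N x y)
    + G1 y * (sinh y) ^ 3 * (sin x)\<^sup>2 * (inverse (bip_N x y))\<^sup>2"
definition "\<psi> x y = a * sin x * inverse (bip_N x y) * g y"
text \<open>phi = \<open>phi1\<close> + i \<open>phi2\<close> is the Goursat function of the flow,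
  holomorphic in X + iY up to its period: the pressure is -4 \<nu> Re phi', and H1 + i H2 = 2 \<nu>
  i (v - 2 phi) with v = v1 + i v2. Its multivalued part A x carries the force, and the constant
  \<open>t\<close> in \<open>phi2\<close> makes phi vanish at infinity.\<close>

definition "phi1 x y = A * (x - sin x * (cosh y - t * sinh y))"
definition "phi2 x y = - A * (y + cos x * (t * cosh y - sinh y) - t)"
definition "phi1x x y = A * (1 - cos x * (cosh y - t * sinh y))"
definition "phi2x x y = A * sin x * (t * cosh y - sinh y)"
definition "H1 x y = 4 * \<nu> * phi2 x y - 2 * \<nu> * v2 x y"
definition "H2 x y = - 4 * \<nu> * phi1 x y + 2 * \<nu> * v1 x y"
definition "pr x y = - 4 * \<nu> * inverse a * ((cos x * cosh y - 1) * phi1x x y - sin x * sinh y * phi2x x y)"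

lemma denominator: "tanh \<alpha> < \<alpha>"
proof -
  have "sinh 0 - 0 * cosh 0 > sinh \<alpha> - \<alpha> * cosh \<alpha>"
  proof (rule DERIV_neg_imp_decreasing_open[OF pos(2)])
    fix x :: real assume x: "0 < x" "x < \<alpha>"
    have "((\<lambda>x. sinh x - x * cosh x) has_real_derivative - x * sinh x) (at x)"
      by (auto intro!: derivative_eq_intros)
    then show "\<exists>d. ((\<lambda>x. sinh x - x * cosh x) has_real_derivative d) (at x) \<and> d < 0"
      using x by (intro exI[of _ "- x * sinh x"]) auto
  qed (intro continuous_intros)
  then show ?thesis by (simp add: tanh_def pos_divide_less_eq)
qed

lemma A_eq: "2 * A * (t - \<alpha>) = 1"
  using denominator by (simp add: A_def t_def)

lemma t_eq: "t * cosh \<alpha> = sinh \<alpha>"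
  by (simp add: t_def tanh_def)

lemma t_bounds: "0 < t" "t < 1"
  using pos by (simp_all add: t_def tanh_real_lt_1)

lemma g_derivs:
  "(g has_real_derivative G1 y * sinh y) (at y)" "(G1 has_real_derivative G1' y) (at y)"
proof -
  show "(g has_real_derivative G1 y * sinh y) (at y)" unfolding g_def G1_def
    by (rule DERIV_cong, (rule derivative_intros | simp)+, use cosh_sq[of y] in algebra)
  show "(G1 has_real_derivative G1' y) (at y)" unfolding G1_def G1'_def
    by (rule DERIV_cong, (rule derivative_intros | simp)+)
qed

lemma v_derivs:
  assumes "0 < y"
  shows "((\<lambda>x. v1 x y) has_real_derivative v1x x y) (at x)" "((\<lambda>y. v1 x y) has_real_derivative v1y x y) (at y)"
    "((\<lambda>x. v2 x y) has_real_derivative v2x x y) (at x)" "((\<lambda>y. v2 x y) has_real_derivative v2y x y) (at y)"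
  unfolding v1_def v1x_def v1y_def v2_def v2x_def v2y_def
  by (rule DERIV_cong, (rule derivative_intros g_derivs inverse_N_derivs[OF assms] refl | simp)+, algebra)+

lemma psi_derivs:
  assumes "0 < y"
  shows "((\<lambda>x. \<psi> x y) has_real_derivative v2 x y * bip_c a x y - v1 x y * bip_s a x y) (at x)"
    "((\<lambda>y. \<psi> x y) has_real_derivative v2 x y * bip_s a x y + v1 x y * bip_c a x y) (at y)"
  unfolding \<psi>_def v1_def v2_def facts(6,7)[OF assms]
  by (rule DERIV_cong, (rule derivative_intros g_derivs inverse_N_derivs[OF assms] refl | simp)+,
      use facts(1,2,4)[OF assms, of x] facts(3,5)[OF assms] in algebra)+

lemma phi_derivs:
  "((\<lambda>x. phi1 x y) has_real_derivative phi1x x y) (at x)" "((\<lambda>y. phi1 x y) has_real_derivative phi2x x y) (at y)"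
  "((\<lambda>x. phi2 x y) has_real_derivative phi2x x y) (at x)" "((\<lambda>y. phi2 x y) has_real_derivative - phi1x x y) (at y)"
  unfolding phi1_def phi2_def phi1x_def phi2x_def
  by (auto intro!: derivative_eq_intros simp: algebra_simps)

text \<open>The first two identities turn the derivatives of H = 2 \<nu> i (v - 2 phi) into the
  stress form of v; the third is incompressibility, a consequence of the stream function.\<close>

lemma stress_identities:
  assumes "0 < y"
  shows "\<nu> * (v1x x y - v2y x y) = 4 * \<nu> * phi1x x y + pr x y * bip_c a x y"
    "\<nu> * (v2x x y + v1y x y) = 4 * \<nu> * phi2x x y + pr x y * bip_s a x y"
    "bip_c a x y * v1x x y + bip_s a x y * v1y x y + bip_s a x y * v2x x y - bip_c a x y * v2y x y = 0"
  unfolding v1x_def v1y_def v2x_def v2y_def pr_def phi1x_def phi2x_def facts(6,7)[OF assms] G1_def G1'_def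
  by (use facts(1,2,4)[OF assms, of x] facts(3,5)[OF assms] in algebra)+

lemma stress_derivs:
  assumes "0 < y"
  shows "((\<lambda>x. H1 x y) has_real_derivative - pr x y * bip_s a x y + \<nu> * (v1y x y - v2x x y)) (at x)"
    "((\<lambda>y. H1 x y) has_real_derivative pr x y * bip_c a x y - \<nu> * (v1x x y + v2y x y)) (at y)"
    "((\<lambda>x. H2 x y) has_real_derivative pr x y * bip_c a x y + \<nu> * (v1x x y + v2y x y)) (at x)"
    "((\<lambda>y. H2 x y) has_real_derivative pr x y * bip_s a x y + \<nu> * (v1y x y - v2x x y)) (at y)"
  unfolding H1_def H2_def
  by (rule DERIV_cong, (rule derivative_intros phi_derivs v_derivs[OF assms])+,
      use stress_identities[OF assms, of x] in \<open>simp add: algebra_simps\<close>)+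

text \<open>The summands dominate the factors 14 for \<open>v2\<close>, 44 \<nu> for
  \<open>H2\<close> and 12 a for the stream function; \<open>v1\<close> and \<open>H1\<close> need
  only 8 and 40 \<nu>.\<close>

definition "K = (14 + 44 * \<nu> + 12 * a) * (\<bar>A\<bar> * (L * L))"

lemma bounds:
  assumes x: "\<bar>x\<bar> \<le> pi" and y: "0 < y" "y \<le> \<alpha>"
  shows "\<bar>\<psi> x y\<bar> \<le> K" "\<bar>v1 x y\<bar> \<le> K * sqrt (bip_N x y)" "\<bar>v2 x y\<bar> \<le> K * sqrt (bip_N x y)"
    "\<bar>H1 x y\<bar> \<le> K * sqrt (bip_N x y)" "\<bar>H2 x y\<bar> \<le> K * sqrt (bip_N x y)"
proof -
  define n where "n = sqrt (bip_N x y)"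
  note b = basic_bounds[OF x y, folded n_def]
  define Z where "Z = \<bar>A\<bar> * (L * L)"
  have Z: "0 \<le> Z" by (simp add: Z_def)
  have sL: "\<bar>sinh y\<bar> \<le> L" "\<bar>sinh y\<bar> \<le> L * n" "\<bar>y\<bar> \<le> L * n" using b y by auto
  have tL: "\<bar>t\<bar> \<le> 1" using t_bounds by simp
  have A0: "\<bar>A\<bar> \<le> \<bar>A\<bar>" by simp
  have Ln: "L * n \<le> L * L * n" "n \<le> L * L * n" "L * n + n \<le> L * L * n"
  proof -
    have "2 * L \<le> L * L" "2 * 2 \<le> L * L" using L_ge by (intro mult_mono; simp)+
    then have "L \<le> L * L" "1 \<le> L * L" "L + 1 \<le> L * L" using L_ge by linarith+
    then show "L * n \<le> L * L * n" "n \<le> L * L * n" "L * n + n \<le> L * L * n"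
      using b(1) mult_right_mono[of L "L * L" n] mult_right_mono[of 1 "L * L" n] mult_right_mono[of "L + 1" "L * L" n]
      by (auto simp: algebra_simps)
  qed
  have Np: "0 < bip_N x y" using b(1,2) mult_pos_pos[of n n] by simp
  have ratio: "\<bar>(cos x * cosh y - 1) * inverse (bip_N x y)\<bar> \<le> 1" "\<bar>sin x * sinh y * inverse (bip_N x y)\<bar> \<le> 1"
    using bip_abs_le[of x y] Np by (auto simp: abs_mult divide_inverse[symmetric])
  have G1: "\<bar>G1 y * sinh y\<bar> \<le> 8 * Z * n"
  proof -
    have "\<bar>t * cosh y\<bar> \<le> 1 * L" by (intro abs_mult_mono tL b)
    then have "\<bar>sinh y - t * cosh y\<bar> \<le> 2 * L" using sL by linarith
    then have "\<bar>A * (sinh y - t * cosh y) * sinh y\<bar> \<le> \<bar>A\<bar> * (2 * L) * (L * n)"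
      by (intro abs_mult_mono A0 sL)
    then show ?thesis unfolding G1_def Z_def by (simp add: abs_mult algebra_simps)
  qed
  have g: "\<bar>g y\<bar> \<le> 6 * Z * n"
  proof -
    have "\<bar>sinh y * cosh y\<bar> \<le> L * n * L" by (intro abs_mult_mono sL b)
    moreover have "\<bar>t * (sinh y * sinh y)\<bar> \<le> 1 * (L * n * L)" by (intro abs_mult_mono sL tL)
    moreover have "\<bar>y\<bar> \<le> L * n * L" using sL Ln by (simp add: mult.commute mult.left_commute)
    ultimately have "\<bar>sinh y * cosh y - y - t * (sinh y)\<^sup>2\<bar> \<le> 3 * (L * n * L)"
      unfolding power2_eq_square by linarith
    then have "\<bar>A * (sinh y * cosh y - y - t * (sinh y)\<^sup>2)\<bar> \<le> \<bar>A\<bar> * (3 * (L * n * L))"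
      by (intro abs_mult_mono A0)
    then show ?thesis unfolding g_def Z_def by (simp add: abs_mult algebra_simps)
  qed
  have sx: "\<bar>sin x\<bar> \<le> 1" "\<bar>cos x\<bar> \<le> 1" by simp_all
  have v1: "\<bar>v1 x y\<bar> \<le> 8 * Z * n"
  proof -
    have "\<bar>G1 y * sinh y * sin x * ((cos x * cosh y - 1) * inverse (bip_N x y))\<bar> \<le> 8 * Z * n * 1 * 1"
      by (intro abs_mult_mono G1 sx ratio)
    then show ?thesis unfolding v1_def by (simp add: mult.assoc)
  qed
  have v2: "\<bar>v2 x y\<bar> \<le> 14 * Z * n"
  proof -
    have "\<bar>G1 y * sinh y * sin x * (sin x * sinh y * inverse (bip_N x y))\<bar> \<le> 8 * Z * n * 1 * 1"
      by (intro abs_mult_mono G1 sx ratio)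
    then have "\<bar>G1 y * (sinh y)\<^sup>2 * (sin x)\<^sup>2 * inverse (bip_N x y)\<bar> \<le> 8 * Z * n"
      by (simp add: power2_eq_square ac_simps)
    then show ?thesis unfolding v2_def using g by linarith
  qed
  have p2: "\<bar>phi2 x y\<bar> \<le> 3 * Z * n"
  proof -
    \<comment> \<open>The regrouping uses the constant \<open>t\<close> to exhibit decay: each of
      the three terms is O(sqrt(\<open>bip_N\<close>)).\<close>
    have e: "y + cos x * (t * cosh y - sinh y) - t = y + t * (cos x * cosh y - 1) - cos x * sinh y"
      by (simp add: algebra_simps)
    have "\<bar>t * (cos x * cosh y - 1)\<bar> \<le> 1 * (L * n)"
      using bip_abs_le[of x y] b(9) by (intro abs_mult_mono tL) auto
    moreover have "\<bar>cos x * sinh y\<bar> \<le> 1 * (L * n)" by (intro abs_mult_mono sx sL)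
    ultimately have "\<bar>y + cos x * (t * cosh y - sinh y) - t\<bar> \<le> 3 * (L * L * n)"
      unfolding e using sL Ln by linarith
    then have "\<bar>A * (y + cos x * (t * cosh y - sinh y) - t)\<bar> \<le> \<bar>A\<bar> * (3 * (L * L * n))"
      by (intro abs_mult_mono A0)
    then show ?thesis unfolding phi2_def Z_def by (simp add: abs_mult algebra_simps)
  qed
  have p1: "\<bar>phi1 x y\<bar> \<le> 7 * Z * n"
  proof -
    have "\<bar>t * sinh y\<bar> \<le> 1 * L" by (intro abs_mult_mono tL sL)
    then have "\<bar>cosh y - t * sinh y\<bar> \<le> 2 * L" using b(8) by linarith
    then have *: "\<bar>sin x * (cosh y - t * sinh y)\<bar> \<le> 2 * n * (2 * L)" by (intro abs_mult_mono b)
    have "\<bar>x - sin x * (cosh y - t * sinh y)\<bar> \<le> 7 * (L * L * n)"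
    proof -
      have "2 * n * (2 * L) = 4 * (L * n)" by simp
      with * b(3) Ln show ?thesis by linarith
    qed
    then have "\<bar>A * (x - sin x * (cosh y - t * sinh y))\<bar> \<le> \<bar>A\<bar> * (7 * (L * L * n))"
      by (intro abs_mult_mono A0)
    then show ?thesis unfolding phi1_def Z_def by (simp add: abs_mult algebra_simps)
  qed
  have Kn: "c * Z * n \<le> K * n" if "c \<le> 14 + 44 * \<nu> + 12 * a" for c
    unfolding K_def Z_def[symmetric] using that Z b(1) by (intro mult_right_mono) auto
  show "\<bar>v1 x y\<bar> \<le> K * sqrt (bip_N x y)" "\<bar>v2 x y\<bar> \<le> K * sqrt (bip_N x y)"
    unfolding n_def[symmetric] using v1 v2 Kn[of 8] Kn[of 14] pos by (auto intro: order_trans)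
  have mul: "\<bar>\<nu> * s\<bar> \<le> \<nu> * c" if "\<bar>s\<bar> \<le> c" for s c using that pos by (intro abs_mult_mono) auto
  have "\<bar>H1 x y\<bar> \<le> (40 * \<nu>) * Z * n"
    unfolding H1_def using mul[OF p2] mul[OF v2] by (simp add: abs_if algebra_simps split: if_splits)
  then show "\<bar>H1 x y\<bar> \<le> K * sqrt (bip_N x y)"
    unfolding n_def[symmetric] using Kn[of "40 * \<nu>"] pos by auto
  have "\<bar>H2 x y\<bar> \<le> (44 * \<nu>) * Z * n"
    unfolding H2_def using mul[OF p1] mul[OF v1] by (simp add: abs_if algebra_simps split: if_splits)
  then show "\<bar>H2 x y\<bar> \<le> K * sqrt (bip_N x y)"
    unfolding n_def[symmetric] using Kn[of "44 * \<nu>"] pos by auto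
  have "\<bar>\<psi> x y\<bar> \<le> 12 * a * Z"
  proof -
    have "\<bar>sin x * g y\<bar> \<le> 2 * n * (6 * Z * n)" by (intro abs_mult_mono b g)
    then have "\<bar>sin x * g y\<bar> \<le> 12 * Z * bip_N x y" unfolding b(2)[symmetric] by (simp add: ac_simps)
    then have "\<bar>sin x * g y\<bar> / bip_N x y \<le> 12 * Z"
      using b(1,2) by (metis pos_divide_le_eq mult_pos_pos)
    then have "a * (\<bar>sin x * g y\<bar> / bip_N x y) \<le> a * (12 * Z)" using pos by (intro mult_left_mono) auto
    moreover have "\<bar>\<psi> x y\<bar> = a * (\<bar>sin x * g y\<bar> / bip_N x y)"
      unfolding \<psi>_def using pos b(1,2) mult_pos_pos[of n n] by (simp add: abs_mult divide_inverse)
    ultimately show ?thesis by simp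
  qed
  also have "\<dots> \<le> K" unfolding K_def Z_def[symmetric] using Z pos by (intro mult_right_mono) auto
  finally show "\<bar>\<psi> x y\<bar> \<le> K" .
qed

lemma continuity:
  "f \<in> {v1x, v1y, v2x, v2y, pr} \<Longrightarrow> continuous_on (UNIV \<times> {0<..<\<alpha>}) (\<lambda>q. f (fst q) (snd q))"
  "f \<in> {v1, v2, \<psi>, H1, H2} \<Longrightarrow> continuous_on (bip_domain \<alpha>) (\<lambda>q. f (fst q) (snd q))"
proof -
  have N: "bip_N (fst q) (snd q) \<noteq> 0" if "q \<in> UNIV \<times> {0<..<\<alpha>}" for q
    using bip_N_pos[of "snd q" "fst q"] that by auto
  have N': "bip_N (fst q) (snd q) \<noteq> 0" if "q \<in> bip_domain \<alpha>" for q
    using that by (auto simp: bip_domain_def)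
  have i: "continuous_on (UNIV \<times> {0<..<\<alpha>}) (\<lambda>q. inverse (bip_N (fst q) (snd q)))"
    by (intro continuous_intros bip_continuous) (use N in auto)
  have i': "continuous_on (bip_domain \<alpha>) (\<lambda>q. inverse (bip_N (fst q) (snd q)))"
    by (intro continuous_intros bip_continuous) (use N' in auto)
  let ?S = "UNIV \<times> {0<..<\<alpha>} :: (real \<times> real) set"
  have "continuous_on ?S (\<lambda>q. v1x (fst q) (snd q))"
    "continuous_on ?S (\<lambda>q. v1y (fst q) (snd q))"
    "continuous_on ?S (\<lambda>q. v2x (fst q) (snd q))"
    "continuous_on ?S (\<lambda>q. v2y (fst q) (snd q))"
    "continuous_on ?S (\<lambda>q. pr (fst q) (snd q))"
    unfolding v1x_def v1y_def v2x_def v2y_def pr_def phi1x_def phi2x_def G1_def G1'_def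
    by (rule i continuous_intros)+
  then show "f \<in> {v1x, v1y, v2x, v2y, pr} \<Longrightarrow> continuous_on ?S (\<lambda>q. f (fst q) (snd q))"
    by auto
  have "continuous_on (bip_domain \<alpha>) (\<lambda>q. v1 (fst q) (snd q))"
    "continuous_on (bip_domain \<alpha>) (\<lambda>q. v2 (fst q) (snd q))"
    "continuous_on (bip_domain \<alpha>) (\<lambda>q. \<psi> (fst q) (snd q))"
    "continuous_on (bip_domain \<alpha>) (\<lambda>q. H1 (fst q) (snd q))"
    "continuous_on (bip_domain \<alpha>) (\<lambda>q. H2 (fst q) (snd q))"
    unfolding H1_def H2_def v1_def v2_def \<psi>_def phi1_def phi2_def G1_def g_def
    by (rule i' continuous_intros)+
  then show "f \<in> {v1, v2, \<psi>, H1, H2} \<Longrightarrow> continuous_on (bip_domain \<alpha>) (\<lambda>q. f (fst q) (snd q))"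
    by auto
qed

text \<open>The velocity is periodic, so the period of \<open>H2\<close> comes from the term A x of
  \<open>phi1\<close> alone. Minus 2 pi times the resulting coefficient -4 \<nu> A will be the
  vertical drag at unit velocity.\<close>

lemma test_flow:
  "bipolar_test_flow a \<alpha> \<nu> K 0 (- 4 * \<nu> * A) 0 1 v1 v2 \<psi> H1 H2 pr v1x v1y v2x v2y"
proof
  have G: "G1 \<alpha> = 0" using t_eq by (simp add: G1_def)
  have "g \<alpha> = 2 * A * (t - \<alpha>)"
  proof -
    have s: "(sinh \<alpha>)\<^sup>2 = (cosh \<alpha>)\<^sup>2 - 1" by (simp add: cosh_sq)
    have "sinh \<alpha> * cosh \<alpha> = t * (cosh \<alpha>)\<^sup>2" using t_eq by (simp add: power2_eq_square)
    then have "sinh \<alpha> * cosh \<alpha> - t * (sinh \<alpha>)\<^sup>2 = t" unfolding s by (simp add: algebra_simps)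
    moreover have "g \<alpha> = 2 * A * (sinh \<alpha> * cosh \<alpha> - t * (sinh \<alpha>)\<^sup>2 - \<alpha>)"
      unfolding g_def by (simp add: algebra_simps)
    ultimately show ?thesis by simp
  qed
  then have g: "g \<alpha> = 1" using A_eq by simp
  show "v1 x \<alpha> = 0" "v2 x \<alpha> = 1" for x by (simp_all add: v1_def v2_def G g)
  show "v1 x 0 = 0" "v2 x 0 = 0" "\<psi> x 0 = 0" for x by (simp_all add: v1_def v2_def \<psi>_def g_def)
  show "f pi y = f (- pi) y" if "f \<in> {v1, v2, \<psi>}" for f y
    using that by (auto simp: v1_def v2_def \<psi>_def bip_N_def)
  have e: "v1 (- pi) y = v1 pi y" "v2 (- pi) y = v2 pi y" for y by (simp_all add: v1_def v2_def bip_N_def)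
  show "H1 pi y - H1 (- pi) y = 2 * pi * 0" "H2 pi y - H2 (- pi) y = 2 * pi * (- 4 * \<nu> * A)" for y
    unfolding H1_def H2_def e by (simp_all add: phi1_def phi2_def algebra_simps)
qed (use v_derivs psi_derivs stress_derivs stress_identities(3) bounds continuity in \<open>auto simp del: mult_eq_0_iff\<close>)

end

section \<open>The disk moving parallel to the wall\<close>

locale para_params = bipolar_params
begin

definition "K0 = cosh \<alpha> / sinh \<alpha>"
definition "E y = 2 * (cosh y - K0 * sinh y) * inverse \<alpha>"
definition "E' y = 2 * (sinh y - K0 * cosh y) * inverse \<alpha>"
text \<open>The stream function is m(y) - Y f(y), with m' = a E sinh y and f' = E cosh y. The choice
  coth \<alpha> for \<open>K0\<close> makes \<open>E\<close> vanish on the circle and the factor 1 /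
  \<alpha> makes f equal to 1 there; the stream function then agrees with a constant minus Y to
  first order, which is the velocity (1, 0). On the wall f, m and m' vanish.\<close>

definition "f y = (y + sinh y * cosh y - K0 * (sinh y)\<^sup>2) * inverse \<alpha>"
definition "v1 x y = f y - E y * sinh y * cos x * (cos x * cosh y - 1) * inverse (bip_N x y)"
definition "v2 x y = E y * (sinh y)\<^sup>2 * sin x * cos x * inverse (bip_N x y)"
definition "v1x x y = - E y * sinh y * ((- sin x * (cos x * cosh y - 1) - cos x * sin x * cosh y) * inverse (bip_N x y)
    - cos x * (cos x * cosh y - 1) * sin x * (inverse (bip_N x y))\<^sup>2)"
definition "v1y x y = E y * cosh y - (E' y * sinh y + E y * cosh y) * cos x * (cos x * cosh y - 1) * inverse (bip_N x y)
    - E y * (sinh y)\<^sup>2 * (cos x)\<^sup>2 * inverse (bip_N x y)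
    + E y * (sinh y)\<^sup>2 * cos x * (cos x * cosh y - 1) * (inverse (bip_N x y))\<^sup>2"
definition "v2x x y = E y * (sinh y)\<^sup>2 * (((cos x)\<^sup>2 - (sin x)\<^sup>2) * inverse (bip_N x y)
    - (sin x)\<^sup>2 * cos x * (inverse (bip_N x y))\<^sup>2)"
definition "v2y x y = (E' y * (sinh y)\<^sup>2 + 2 * E y * sinh y * cosh y) * sin x * cos x * inverse (bip_N x y)
    - E y * (sinh y) ^ 3 * sin x * cos x * (inverse (bip_N x y))\<^sup>2"
definition "\<psi> x y = a * ((sinh y)\<^sup>2 - K0 * (sinh y * cosh y - y)) * inverse \<alpha>
    - a * sinh y * inverse (bip_N x y) * f y"
text \<open>Again a Goursat function, but the multivalued term x / (2 \<alpha>) now sits in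
  \<open>phi2\<close>, so that only \<open>H1\<close> has a period and the force is horizontal. The
  constant \<open>K0\<close> makes \<open>phi1\<close> vanish at infinity.\<close>

definition "phi1 x y = (y - cos x * (K0 * cosh y - sinh y) + K0) / (2 * \<alpha>)"
definition "phi2 x y = (x + sin x * (cosh y - K0 * sinh y)) / (2 * \<alpha>)"
definition "phi1x x y = sin x * (K0 * cosh y - sinh y) * inverse \<alpha> / 2"
definition "phi2x x y = (1 + cos x * (cosh y - K0 * sinh y)) * inverse \<alpha> / 2"
definition "H1 x y = 4 * \<nu> * phi2 x y - 2 * \<nu> * v2 x y"
definition "H2 x y = - 4 * \<nu> * phi1 x y + 2 * \<nu> * v1 x y"
definition "pr x y = - 4 * \<nu> * inverse a * ((cos x * cosh y - 1) * phi1x x y - sin x * sinh y * phi2x x y)"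

lemma K0_eq: "K0 * sinh \<alpha> = cosh \<alpha>"
  using pos by (simp add: K0_def)

lemma K0_pos: "0 < K0"
  using pos cosh_real_pos[of \<alpha>] by (simp add: K0_def)

lemma f_derivs:
  "(f has_real_derivative E y * cosh y) (at y)" "(E has_real_derivative E' y) (at y)"
proof -
  show "(f has_real_derivative E y * cosh y) (at y)" unfolding f_def E_def
    by (rule DERIV_cong, (rule derivative_intros | simp)+, use cosh_sq[of y] in algebra)
  show "(E has_real_derivative E' y) (at y)" unfolding E_def E'_def
    by (rule DERIV_cong, (rule derivative_intros | simp)+)
qed

lemma v_derivs:
  assumes "0 < y"
  shows "((\<lambda>x. v1 x y) has_real_derivative v1x x y) (at x)" "((\<lambda>y. v1 x y) has_real_derivative v1y x y) (at y)"
    "((\<lambda>x. v2 x y) has_real_derivative v2x x y) (at x)" "((\<lambda>y. v2 x y) has_real_derivative v2y x y) (at y)"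
  unfolding v1_def v1x_def v1y_def v2_def v2x_def v2y_def
  by (rule DERIV_cong, (rule derivative_intros f_derivs inverse_N_derivs[OF assms] refl | simp)+, algebra)+

lemma psi_derivs:
  assumes "0 < y"
  shows "((\<lambda>x. \<psi> x y) has_real_derivative v2 x y * bip_c a x y - v1 x y * bip_s a x y) (at x)"
    "((\<lambda>y. \<psi> x y) has_real_derivative v2 x y * bip_s a x y + v1 x y * bip_c a x y) (at y)"
proof -
  note F = facts(1,2,4)[OF assms, of x] facts(3,5)[OF assms]
  show "((\<lambda>x. \<psi> x y) has_real_derivative v2 x y * bip_c a x y - v1 x y * bip_s a x y) (at x)"
    unfolding \<psi>_def v1_def v2_def facts(6,7)[OF assms]
    by (rule DERIV_cong, (rule derivative_intros f_derivs inverse_N_derivs[OF assms] refl | simp)+,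
        use F in algebra)
  show "((\<lambda>y. \<psi> x y) has_real_derivative v2 x y * bip_s a x y + v1 x y * bip_c a x y) (at y)"
    unfolding \<psi>_def v1_def v2_def facts(6,7)[OF assms]
    by (rule DERIV_cong, (rule derivative_intros f_derivs inverse_N_derivs[OF assms] refl | simp)+,
        unfold E_def, use F in algebra)
qed

lemma phi_derivs:
  "((\<lambda>x. phi1 x y) has_real_derivative phi1x x y) (at x)" "((\<lambda>y. phi1 x y) has_real_derivative phi2x x y) (at y)"
  "((\<lambda>x. phi2 x y) has_real_derivative phi2x x y) (at x)" "((\<lambda>y. phi2 x y) has_real_derivative - phi1x x y) (at y)"
  unfolding phi1_def phi2_def phi1x_def phi2x_def
  using pos(2) by (auto intro!: derivative_eq_intros simp: field_simps)

lemma stress_identities: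
  assumes "0 < y"
  shows "\<nu> * (v1x x y - v2y x y) = 4 * \<nu> * phi1x x y + pr x y * bip_c a x y"
    "\<nu> * (v2x x y + v1y x y) = 4 * \<nu> * phi2x x y + pr x y * bip_s a x y"
    "bip_c a x y * v1x x y + bip_s a x y * v1y x y + bip_s a x y * v2x x y - bip_c a x y * v2y x y = 0"
  unfolding v1x_def v1y_def v2x_def v2y_def pr_def phi1x_def phi2x_def facts(6,7)[OF assms] E_def E'_def
  by (use facts(1,2,4)[OF assms, of x] facts(3,5)[OF assms] in algebra)+

lemma stress_derivs:
  assumes "0 < y"
  shows "((\<lambda>x. H1 x y) has_real_derivative - pr x y * bip_s a x y + \<nu> * (v1y x y - v2x x y)) (at x)"
    "((\<lambda>y. H1 x y) has_real_derivative pr x y * bip_c a x y - \<nu> * (v1x x y + v2y x y)) (at y)"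
    "((\<lambda>x. H2 x y) has_real_derivative pr x y * bip_c a x y + \<nu> * (v1x x y + v2y x y)) (at x)"
    "((\<lambda>y. H2 x y) has_real_derivative pr x y * bip_s a x y + \<nu> * (v1y x y - v2x x y)) (at y)"
  unfolding H1_def H2_def
  by (rule DERIV_cong, (rule derivative_intros phi_derivs v_derivs[OF assms])+,
      use stress_identities[OF assms, of x] in \<open>simp add: algebra_simps\<close>)+

text \<open>The summands come from \<open>v1\<close>, from \<open>H1\<close> and from the stream
  function, whose non-decaying first term costs the extra factor \<open>L\<close>.\<close>

definition "K = (4 + 14 * \<nu> + 4 * a * L) * (L * L * (1 + K0) * inverse \<alpha>)"

lemma bounds:
  assumes x: "\<bar>x\<bar> \<le> pi" and y: "0 < y" "y \<le> \<alpha>"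
  shows "\<bar>\<psi> x y\<bar> \<le> K" "\<bar>v1 x y\<bar> \<le> K * sqrt (bip_N x y)" "\<bar>v2 x y\<bar> \<le> K * sqrt (bip_N x y)"
    "\<bar>H1 x y\<bar> \<le> K * sqrt (bip_N x y)" "\<bar>H2 x y\<bar> \<le> K * sqrt (bip_N x y)"
proof -
  define n where "n = sqrt (bip_N x y)"
  note b = basic_bounds[OF x y, folded n_def]
  define i where "i = inverse \<alpha>"
  have i: "0 < i" "\<bar>i\<bar> \<le> i" using pos by (simp_all add: i_def)
  define Z where "Z = L * L * (1 + K0) * i"
  have Z: "0 \<le> Z" using L_ge K0_pos i by (simp add: Z_def)
  have sL: "\<bar>sinh y\<bar> \<le> L" "\<bar>sinh y\<bar> \<le> L * n" "\<bar>y\<bar> \<le> L * n" using b y by auto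
  have kL: "\<bar>K0\<bar> \<le> K0" using K0_pos by simp
  have LL: "L \<le> L * L" "1 \<le> L * L"
  proof -
    have "2 * L \<le> L * L" "2 * 2 \<le> L * L" using L_ge by (intro mult_mono; simp)+
    then show "L \<le> L * L" "1 \<le> L * L" using L_ge by linarith+
  qed
  have Ln: "L * n \<le> L * L * n" "n \<le> L * L * n"
    using b(1) mult_right_mono[OF LL(1), of n] mult_right_mono[OF LL(2), of n] by auto
  have k: "K0 * (L * n) \<le> K0 * (L * L * n)" "0 \<le> K0 * (L * L * n)"
    using Ln K0_pos L_ge b(1) by (auto intro!: mult_left_mono)
  have Np: "0 < bip_N x y" using b(1,2) mult_pos_pos[of n n] by simp
  have ratio: "\<bar>(cos x * cosh y - 1) * inverse (bip_N x y)\<bar> \<le> 1" "\<bar>sin x * sinh y * inverse (bip_N x y)\<bar> \<le> 1"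
    using bip_abs_le[of x y] Np by (auto simp: abs_mult divide_inverse[symmetric])
  have sx: "\<bar>sin x\<bar> \<le> 1" "\<bar>cos x\<bar> \<le> 1" by simp_all
  have CK: "\<bar>cosh y - K0 * sinh y\<bar> \<le> L + K0 * L"
    using abs_mult_mono[OF kL sL(1)] b(8) by linarith
  have E: "\<bar>E y * sinh y\<bar> \<le> 2 * Z * n"
  proof -
    have "\<bar>(cosh y - K0 * sinh y) * i * sinh y\<bar> \<le> (L + K0 * L) * i * (L * n)"
      by (intro abs_mult_mono CK i sL)
    then show ?thesis unfolding E_def Z_def i_def[symmetric] by (simp add: abs_mult algebra_simps)
  qed
  have f: "\<bar>f y\<bar> \<le> 2 * Z * n"
  proof -
    have "\<bar>sinh y * cosh y\<bar> \<le> L * n * L" by (intro abs_mult_mono sL b)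
    moreover have "\<bar>K0 * (sinh y * sinh y)\<bar> \<le> K0 * (L * n * L)" by (intro abs_mult_mono sL kL)
    moreover have "\<bar>y\<bar> \<le> L * n * L" using sL Ln by (simp add: mult.commute mult.left_commute)
    moreover have "0 \<le> K0 * (L * n * L)" using K0_pos b(1) L_ge by simp
    ultimately have "\<bar>y + sinh y * cosh y - K0 * (sinh y)\<^sup>2\<bar> \<le> 2 * (L * n * L) + 2 * (K0 * (L * n * L))"
      unfolding power2_eq_square by linarith
    then have "\<bar>(y + sinh y * cosh y - K0 * (sinh y)\<^sup>2) * i\<bar> \<le> (2 * (L * n * L) + 2 * (K0 * (L * n * L))) * i"
      by (intro abs_mult_mono i)
    then show ?thesis unfolding f_def Z_def i_def[symmetric] by (simp add: algebra_simps)
  qed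
  have v1: "\<bar>v1 x y\<bar> \<le> 4 * Z * n"
  proof -
    have "\<bar>E y * sinh y * cos x * ((cos x * cosh y - 1) * inverse (bip_N x y))\<bar> \<le> 2 * Z * n * 1 * 1"
      by (intro abs_mult_mono E sx ratio)
    then have "\<bar>E y * sinh y * cos x * (cos x * cosh y - 1) * inverse (bip_N x y)\<bar> \<le> 2 * Z * n"
      by (simp add: mult.assoc)
    then show ?thesis unfolding v1_def using f by linarith
  qed
  have v2: "\<bar>v2 x y\<bar> \<le> 2 * Z * n"
  proof -
    have "\<bar>E y * sinh y * cos x * (sin x * sinh y * inverse (bip_N x y))\<bar> \<le> 2 * Z * n * 1 * 1"
      by (intro abs_mult_mono E sx ratio)
    then show ?thesis unfolding v2_def by (simp add: power2_eq_square ac_simps)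
  qed
  have half: "z / (2 * \<alpha>) = z * inverse \<alpha> / 2" for z using pos by (simp add: field_simps)
  have p1: "\<bar>phi1 x y\<bar> \<le> Z * n"
  proof -
    have e: "y - cos x * (K0 * cosh y - sinh y) + K0 = y - K0 * (cos x * cosh y - 1) + cos x * sinh y"
      by (simp add: algebra_simps)
    have "\<bar>K0 * (cos x * cosh y - 1)\<bar> \<le> K0 * (L * n)"
      using bip_abs_le[of x y] b(9) by (intro abs_mult_mono kL) auto
    moreover have "\<bar>cos x * sinh y\<bar> \<le> 1 * (L * n)" by (intro abs_mult_mono sx sL)
    ultimately have "\<bar>y - cos x * (K0 * cosh y - sinh y) + K0\<bar> \<le> 2 * (L * L * n) + 2 * (K0 * (L * L * n))"
      unfolding e using sL Ln k by linarith
    then have "\<bar>(y - cos x * (K0 * cosh y - sinh y) + K0) * i\<bar> \<le> (2 * (L * L * n) + 2 * (K0 * (L * L * n))) * i"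
      by (intro abs_mult_mono i)
    moreover define w where "w = (y - cos x * (K0 * cosh y - sinh y) + K0) * i"
    ultimately have "\<bar>w\<bar> \<le> (2 * (L * L * n) + 2 * (K0 * (L * L * n))) * i" by simp
    moreover have "phi1 x y = w / 2"
      unfolding phi1_def w_def i_def by (rule half)
    moreover have "(2 * (L * L * n) + 2 * (K0 * (L * L * n))) * i = 2 * (Z * n)"
      by (simp add: Z_def algebra_simps)
    ultimately show ?thesis by linarith
  qed
  have p2: "\<bar>phi2 x y\<bar> \<le> 5 / 2 * Z * n"
  proof -
    have *: "\<bar>sin x * (cosh y - K0 * sinh y)\<bar> \<le> 2 * n * (L + K0 * L)" by (intro abs_mult_mono b CK)
    have "\<bar>x + sin x * (cosh y - K0 * sinh y)\<bar> \<le> 5 * (L * L * n) + 5 * (K0 * (L * L * n))"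
    proof -
      have "2 * n * (L + K0 * L) = 2 * (L * n) + 2 * (K0 * (L * n))" by (simp add: algebra_simps)
      with * b(3) Ln k show ?thesis by linarith
    qed
    then have "\<bar>(x + sin x * (cosh y - K0 * sinh y)) * i\<bar> \<le> (5 * (L * L * n) + 5 * (K0 * (L * L * n))) * i"
      by (intro abs_mult_mono i)
    moreover define w where "w = (x + sin x * (cosh y - K0 * sinh y)) * i"
    ultimately have "\<bar>w\<bar> \<le> (5 * (L * L * n) + 5 * (K0 * (L * L * n))) * i" by simp
    moreover have "phi2 x y = w / 2"
      unfolding phi2_def w_def i_def by (rule half)
    moreover have "(5 * (L * L * n) + 5 * (K0 * (L * L * n))) * i = 5 * (Z * n)"
      by (simp add: Z_def algebra_simps)
    ultimately show ?thesis by linarith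
  qed
  have Kn: "c * Z * n \<le> K * n" if "c \<le> 4 + 14 * \<nu> + 4 * a * L" for c
    unfolding K_def i_def[symmetric] Z_def[symmetric] using that Z b(1) by (intro mult_right_mono) auto
  have aL: "0 \<le> a * L" using pos L_ge by simp
  show "\<bar>v1 x y\<bar> \<le> K * sqrt (bip_N x y)" "\<bar>v2 x y\<bar> \<le> K * sqrt (bip_N x y)"
    unfolding n_def[symmetric] using v1 v2 Kn[of 4] Kn[of 2] pos aL by (auto intro: order_trans)
  have mul: "\<bar>\<nu> * s\<bar> \<le> \<nu> * c" if "\<bar>s\<bar> \<le> c" for s c using that pos by (intro abs_mult_mono) auto
  have "\<bar>H1 x y\<bar> \<le> (14 * \<nu>) * Z * n"
    unfolding H1_def using mul[OF p2] mul[OF v2] by (simp add: abs_if algebra_simps split: if_splits)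
  then show "\<bar>H1 x y\<bar> \<le> K * sqrt (bip_N x y)"
    unfolding n_def[symmetric] using Kn[of "14 * \<nu>"] pos aL by auto
  have "\<bar>H2 x y\<bar> \<le> (12 * \<nu>) * Z * n"
    unfolding H2_def using mul[OF p1] mul[OF v1] by (simp add: abs_if algebra_simps split: if_splits)
  then show "\<bar>H2 x y\<bar> \<le> K * sqrt (bip_N x y)"
    unfolding n_def[symmetric] using Kn[of "12 * \<nu>"] pos aL by auto
  have "\<bar>\<psi> x y\<bar> \<le> 4 * a * L * Z"
  proof -
    have "\<bar>sinh y * f y\<bar> \<le> L * n * (2 * Z * n)" by (intro abs_mult_mono sL f)
    then have "\<bar>sinh y * f y\<bar> \<le> 2 * L * Z * bip_N x y" unfolding b(2)[symmetric] by (simp add: ac_simps)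
    then have 1: "\<bar>sinh y * f y\<bar> / bip_N x y \<le> 2 * L * Z" using Np by (simp add: pos_divide_le_eq)
    have 1: "\<bar>a * sinh y * inverse (bip_N x y) * f y\<bar> \<le> a * (2 * L * Z)"
    proof -
      have "\<bar>a * sinh y * inverse (bip_N x y) * f y\<bar> = a * (\<bar>sinh y * f y\<bar> / bip_N x y)"
        using pos Np by (simp add: abs_mult divide_inverse)
      also have "\<dots> \<le> a * (2 * L * Z)" using 1 pos by (intro mult_left_mono) auto
      finally show ?thesis .
    qed
    have s2: "\<bar>(sinh y)\<^sup>2\<bar> \<le> L * L" unfolding power2_eq_square by (intro abs_mult_mono sL)
    have "\<bar>sinh y * cosh y\<bar> \<le> L * L" by (intro abs_mult_mono sL b)
    moreover have "\<bar>y\<bar> \<le> L * L" using b(10) y LL(1) by linarith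
    ultimately have "\<bar>sinh y * cosh y - y\<bar> \<le> 2 * (L * L)" by linarith
    then have "\<bar>K0 * (sinh y * cosh y - y)\<bar> \<le> K0 * (2 * (L * L))" by (intro abs_mult_mono kL)
    moreover have "0 \<le> L * L" by simp
    ultimately have "\<bar>(sinh y)\<^sup>2 - K0 * (sinh y * cosh y - y)\<bar> \<le> 2 * (L * L) + K0 * (2 * (L * L))"
      using s2 by linarith
    then have "\<bar>a * ((sinh y)\<^sup>2 - K0 * (sinh y * cosh y - y)) * i\<bar> \<le> a * (2 * (L * L) + K0 * (2 * (L * L))) * i"
      using pos by (intro abs_mult_mono i) auto
    then have 2: "\<bar>a * ((sinh y)\<^sup>2 - K0 * (sinh y * cosh y - y)) * i\<bar> \<le> 2 * (a * Z)"
      unfolding Z_def by (simp add: algebra_simps)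
    have "1 * (a * Z) \<le> L * (a * Z)" using L_ge pos Z by (intro mult_right_mono) auto
    moreover have "a * (2 * L * Z) = 2 * (L * (a * Z))" "4 * a * L * Z = 4 * (L * (a * Z))" by simp_all
    ultimately show ?thesis unfolding \<psi>_def i_def[symmetric] using 1 2 by linarith
  qed
  also have "\<dots> \<le> K" unfolding K_def i_def[symmetric] Z_def[symmetric] using Z pos by (intro mult_right_mono) auto
  finally show "\<bar>\<psi> x y\<bar> \<le> K" .
qed

lemma continuity:
  "h \<in> {v1x, v1y, v2x, v2y, pr} \<Longrightarrow> continuous_on (UNIV \<times> {0<..<\<alpha>}) (\<lambda>q. h (fst q) (snd q))"
  "h \<in> {v1, v2, \<psi>, H1, H2} \<Longrightarrow> continuous_on (bip_domain \<alpha>) (\<lambda>q. h (fst q) (snd q))"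
proof -
  have N: "bip_N (fst q) (snd q) \<noteq> 0" if "q \<in> UNIV \<times> {0<..<\<alpha>}" for q
    using bip_N_pos[of "snd q" "fst q"] that by auto
  have N': "bip_N (fst q) (snd q) \<noteq> 0" if "q \<in> bip_domain \<alpha>" for q
    using that by (auto simp: bip_domain_def)
  let ?S = "UNIV \<times> {0<..<\<alpha>} :: (real \<times> real) set"
  have i: "continuous_on ?S (\<lambda>q. inverse (bip_N (fst q) (snd q)))"
    by (intro continuous_intros bip_continuous) (use N in auto)
  have i': "continuous_on (bip_domain \<alpha>) (\<lambda>q. inverse (bip_N (fst q) (snd q)))"
    by (intro continuous_intros bip_continuous) (use N' in auto)
  have "continuous_on ?S (\<lambda>q. v1x (fst q) (snd q))"
    "continuous_on ?S (\<lambda>q. v1y (fst q) (snd q))"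
    "continuous_on ?S (\<lambda>q. v2x (fst q) (snd q))"
    "continuous_on ?S (\<lambda>q. v2y (fst q) (snd q))"
    "continuous_on ?S (\<lambda>q. pr (fst q) (snd q))"
    unfolding v1x_def v1y_def v2x_def v2y_def pr_def phi1x_def phi2x_def E_def E'_def divide_inverse
    by (rule i continuous_on_const continuous_intros)+
  then show "h \<in> {v1x, v1y, v2x, v2y, pr} \<Longrightarrow> continuous_on ?S (\<lambda>q. h (fst q) (snd q))"
    by auto
  have "continuous_on (bip_domain \<alpha>) (\<lambda>q. v1 (fst q) (snd q))"
    "continuous_on (bip_domain \<alpha>) (\<lambda>q. v2 (fst q) (snd q))"
    "continuous_on (bip_domain \<alpha>) (\<lambda>q. \<psi> (fst q) (snd q))"
    "continuous_on (bip_domain \<alpha>) (\<lambda>q. H1 (fst q) (snd q))"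
    "continuous_on (bip_domain \<alpha>) (\<lambda>q. H2 (fst q) (snd q))"
    unfolding H1_def H2_def v1_def v2_def \<psi>_def phi1_def phi2_def E_def f_def divide_inverse
    by (rule i' continuous_on_const continuous_intros)+
  then show "h \<in> {v1, v2, \<psi>, H1, H2} \<Longrightarrow> continuous_on (bip_domain \<alpha>) (\<lambda>q. h (fst q) (snd q))"
    by auto
qed

text \<open>The coefficient in the vertical direction is 0: paired with a disk that moves
  vertically, this flow will show that the horizontal drag vanishes.\<close>

lemma test_flow:
  "bipolar_test_flow a \<alpha> \<nu> K (2 * \<nu> / \<alpha>) 0 1 0 v1 v2 \<psi> H1 H2 pr v1x v1y v2x v2y"
proof
  have E: "E \<alpha> = 0" using K0_eq by (simp add: E_def)
  have "K0 * (sinh \<alpha>)\<^sup>2 = sinh \<alpha> * cosh \<alpha>" using K0_eq by (simp add: power2_eq_square)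
  then have f: "f \<alpha> = 1" using pos by (simp add: f_def)
  show "v1 x \<alpha> = 1" "v2 x \<alpha> = 0" for x by (simp_all add: v1_def v2_def E f)
  show "v1 x 0 = 0" "v2 x 0 = 0" "\<psi> x 0 = 0" for x by (simp_all add: v1_def v2_def \<psi>_def f_def)
  show "h pi y = h (- pi) y" if "h \<in> {v1, v2, \<psi>}" for h y
    using that by (auto simp: v1_def v2_def \<psi>_def bip_N_def)
  have e: "v1 (- pi) y = v1 pi y" "v2 (- pi) y = v2 pi y" for y by (simp_all add: v1_def v2_def bip_N_def)
  show "H1 pi y - H1 (- pi) y = 2 * pi * (2 * \<nu> / \<alpha>)" "H2 pi y - H2 (- pi) y = 2 * pi * 0" for y
    unfolding H1_def H2_def e using pos by (simp_all add: phi1_def phi2_def field_simps)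
qed (use v_derivs psi_derivs stress_derivs stress_identities(3) bounds continuity in \<open>auto simp del: mult_eq_0_iff\<close>)

end

section \<open>The weak gradient and the classical gradient\<close>

text \<open>One-variable smoothness with an existentially given derivative is easily closed under
  products and affine substitutions; derivatives in the plane then only have to be computed once,
  for products of functions of the two coordinates.\<close>

primrec times_differentiable :: "nat \<Rightarrow> (real \<Rightarrow> real) \<Rightarrow> bool" where
  "times_differentiable 0 f \<longleftrightarrow> continuous_on UNIV f"
| "times_differentiable (Suc k) f \<longleftrightarrow>
     (\<exists>f'. (\<forall>t. (f has_real_derivative f' t) (at t)) \<and> times_differentiable k f')"

lemma times_differentiable_SucD: "times_differentiable (Suc k) f \<Longrightarrow> times_differentiable k f"
proof (induction k arbitrary: f)
  case 0
  then obtain f' where "\<And>t. (f has_real_derivative f' t) (at t)" by auto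
  then show ?case by (auto intro: DERIV_continuous_on has_field_derivative_at_within)
next
  case (Suc k)
  then obtain f' where "\<And>t. (f has_real_derivative f' t) (at t)" "times_differentiable (Suc k) f'" by auto
  with Suc.IH show ?case by (auto simp del: times_differentiable.simps(1))
qed

lemma times_differentiable_const: "times_differentiable k (\<lambda>_. c)"
  by (induction k arbitrary: c) (auto intro!: exI[of _ "\<lambda>_. 0"])

lemma times_differentiable_add:
  "times_differentiable k f \<Longrightarrow> times_differentiable k g \<Longrightarrow> times_differentiable k (\<lambda>t. f t + g t)"
proof (induction k arbitrary: f g)
  case (Suc k)
  then obtain f' g' where "\<And>t. (f has_real_derivative f' t) (at t)" "times_differentiable k f'"
     "\<And>t. (g has_real_derivative g' t) (at t)" "times_differentiable k g'" by auto
  then show ?case using Suc.IH[of f' g'] by (auto intro!: exI[of _ "\<lambda>t. f' t + g' t"] DERIV_add)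
qed (auto intro: continuous_intros)

lemma times_differentiable_mult:
  "times_differentiable k f \<Longrightarrow> times_differentiable k g \<Longrightarrow> times_differentiable k (\<lambda>t. f t * g t)"
proof (induction k arbitrary: f g)
  case (Suc k)
  then obtain f' g' where d: "\<And>t. (f has_real_derivative f' t) (at t)" "times_differentiable k f'"
     "\<And>t. (g has_real_derivative g' t) (at t)" "times_differentiable k g'" by auto
  have "times_differentiable k (\<lambda>t. f' t * g t + g' t * f t)"
    using Suc.IH[of f' g] Suc.IH[of g' f] d(2,4) Suc.prems[THEN times_differentiable_SucD]
    by (intro times_differentiable_add) auto
  then show ?case using d(1,3)
    by (auto intro!: exI[of _ "\<lambda>t. f' t * g t + g' t * f t"] DERIV_mult)
qed (auto intro: continuous_intros)

lemma times_differentiable_affine: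
  "times_differentiable k f \<Longrightarrow> times_differentiable k (\<lambda>t. f (c * t + d))"
proof (induction k arbitrary: f)
  case 0
  then show ?case by (auto intro!: continuous_on_compose2[of UNIV f] continuous_intros)
next
  case (Suc k)
  then obtain f' where d: "\<And>t. (f has_real_derivative f' t) (at t)" "times_differentiable k f'" by auto
  have "((\<lambda>t. f (c * t + d)) has_real_derivative f' (c * t + d) * c) (at t)" for t
    by (rule DERIV_chain2[OF d(1)]) (auto intro!: derivative_eq_intros)
  moreover have "times_differentiable k (\<lambda>t. f' (c * t + d) * c)"
    by (intro times_differentiable_mult times_differentiable_const Suc.IH d)
  ultimately show ?case by (auto intro!: exI[of _ "\<lambda>t. f' (c * t + d) * c"])
qed

text \<open>The free power of s carries the induction over the coefficients: splitting off the
  constant coefficient raises n by one.\<close>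

lemma poly_times_exp_tendsto_0:
  fixes c :: real and p :: "real poly"
  assumes "c > 0"
  shows "((\<lambda>s. s ^ n * poly p s * exp (- c * s)) \<longlongrightarrow> 0) at_top"
proof (induction p arbitrary: n)
  case (pCons d p)
  have "((\<lambda>s. (c * s) ^ n / exp (c * s)) \<longlongrightarrow> 0) at_top"
    by (rule filterlim_compose[OF tendsto_power_div_exp_0])
       (use assms in \<open>auto intro!: filterlim_tendsto_pos_mult_at_top[OF tendsto_const _ filterlim_ident]\<close>)
  note 1 = this
  have "((\<lambda>s. d / c ^ n * ((c * s) ^ n / exp (c * s)) + s ^ Suc n * poly p s * exp (- c * s)) \<longlongrightarrow> 0) at_top"
    using tendsto_add[OF tendsto_mult_right_zero[OF 1, of "d / c ^ n"] pCons(2)[of "Suc n"]] by simp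
  then show ?case using assms
    by (simp add: power_mult_distrib exp_minus field_simps)
qed simp

text \<open>The functions p(1 / t) exp(- c / t), extended by 0, form a class closed under
  differentiation. Smoothness at 0 follows by induction once every member is known to be
  differentiable there.\<close>

definition flat :: "real \<Rightarrow> real poly \<Rightarrow> real \<Rightarrow> real" where
  "flat c p t = (if t > 0 then poly p (1 / t) * exp (- c / t) else 0)"

text \<open>In the variable s = 1 / t the derivative replaces p by s^2 (c p - p'); at 0 the
  difference quotient is again a polynomial in s times an exponential.\<close>

lemma flat_deriv:
  assumes "c > 0"
  shows "(flat c p has_real_derivative flat c ([:0, 0, 1:] * (smult c p - pderiv p)) t) (at t)"
proof (cases t "0 :: real" rule: linorder_cases)
  case greater
  have "((\<lambda>t. poly p (1 / t) * exp (- c / t)) has_real_derivative flat c ([:0, 0, 1:] * (smult c p - pderiv p)) t) (at t)"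
    using greater
    by (auto intro!: derivative_eq_intros poly_DERIV[THEN DERIV_chain2] simp: flat_def field_simps power2_eq_square)
  then show ?thesis
    by (rule has_field_derivative_transform_within_open[of _ _ _ "{0<..}"]) (use greater in \<open>auto simp: flat_def\<close>)
next
  case less
  have "((\<lambda>t. 0) has_real_derivative flat c ([:0, 0, 1:] * (smult c p - pderiv p)) t) (at t)"
    using less by (simp add: flat_def)
  then show ?thesis
    by (rule has_field_derivative_transform_within_open[of _ _ _ "{..<0}"]) (use less in \<open>auto simp: flat_def\<close>)
next
  case equal
  have "((\<lambda>h. flat c p h / h) \<longlongrightarrow> 0) (at_right 0)"
  proof -
    have "((\<lambda>h. (1 / h) ^ 1 * poly p (1 / h) * exp (- c * (1 / h))) \<longlongrightarrow> 0) (at_right 0)"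
      by (rule filterlim_compose[OF poly_times_exp_tendsto_0[OF assms]])
         (simp add: filterlim_inverse_at_top_right[unfolded inverse_eq_divide])
    moreover have "\<forall>\<^sub>F h in at_right 0. (1 / h) ^ 1 * poly p (1 / h) * exp (- c * (1 / h)) = flat c p h / h"
      using eventually_at_right_less[of "0::real"] by eventually_elim (simp add: flat_def)
    ultimately show ?thesis by (rule Lim_transform_eventually)
  qed
  moreover have "((\<lambda>h. flat c p h / h) \<longlongrightarrow> 0) (at_left 0)"
    by (rule tendsto_eventually) (auto simp: flat_def eventually_at_left_field intro!: exI[of _ "-1"])
  ultimately have "((\<lambda>h. flat c p h / h) \<longlongrightarrow> 0) (at 0)" by (simp add: filterlim_at_split)
  then show ?thesis using equal by (simp add: DERIV_def flat_def)
qed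

lemma flat_smooth: "c > 0 \<Longrightarrow> times_differentiable k (flat c p)"
proof (induction k arbitrary: p)
  case 0
  then show ?case using flat_deriv[of c p]
    by (auto intro: DERIV_continuous_on has_field_derivative_at_within)
next
  case (Suc k)
  then show ?case using flat_deriv[of c p] by auto
qed

text \<open>As \<open>c\<close> tends to \<open>0\<close> these bumps increase to the indicator function of the open interval.\<close>

definition bump :: "real \<Rightarrow> real \<Rightarrow> real \<Rightarrow> real \<Rightarrow> real" where
  "bump c l r t = flat c 1 (t - l) * flat c 1 (r - t)"

lemma bump_smooth: "c > 0 \<Longrightarrow> times_differentiable k (bump c l r)"
  unfolding bump_def
  using times_differentiable_mult[OF times_differentiable_affine[OF flat_smooth, of c k 1 1 "- l"]
      times_differentiable_affine[OF flat_smooth, of c k 1 "- 1" r]]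
  by simp

lemma flat_bounds: "c > 0 \<Longrightarrow> 0 \<le> flat c 1 t" "c > 0 \<Longrightarrow> flat c 1 t \<le> 1"
  by (auto simp: flat_def)

lemma bump_bounds: "c > 0 \<Longrightarrow> 0 \<le> bump c l r t" "c > 0 \<Longrightarrow> bump c l r t \<le> 1"
  unfolding bump_def using flat_bounds by (auto intro: mult_le_one)

lemma bump_zero: "\<not> (l < t \<and> t < r) \<Longrightarrow> bump c l r t = 0"
  by (auto simp: bump_def flat_def)

lemma bump_tendsto:
  "(\<lambda>m. bump (1 / real (Suc m)) l r t) \<longlonglongrightarrow> (if l < t \<and> t < r then 1 else 0)"
proof (cases "l < t \<and> t < r")
  case True
  have "(\<lambda>m. exp (- (1 / real (Suc m)) / (t - l)) * exp (- (1 / real (Suc m)) / (r - t))) \<longlonglongrightarrow> exp (- 0 / (t - l)) * exp (- 0 / (r - t))"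
    using True by (intro tendsto_intros lim_1_over_n[THEN LIMSEQ_Suc]) auto
  then show ?thesis using True by (simp add: bump_def flat_def)
next
  case False
  show ?thesis by (subst if_not_P[OF False]) (simp add: bump_zero[OF False])
qed

lemma has_derivative_coordinate_product:
  assumes "(f has_real_derivative f') (at (x $ 1))" "(g has_real_derivative g') (at (x $ 2))"
  shows "((\<lambda>x :: real^2. f (x $ 1) * g (x $ 2)) has_derivative
      (\<lambda>h. f' * h $ 1 * g (x $ 2) + f (x $ 1) * (g' * h $ 2))) (at x)"
proof -
  have p: "((\<lambda>x :: real^2. x $ i) has_derivative (\<lambda>h. h $ i)) (at x)" for i
    by (rule bounded_linear_imp_has_derivative) (rule bounded_linear_vec_nth)
  have "((\<lambda>x :: real^2. f (x $ 1)) has_derivative (\<lambda>h. f' * h $ 1)) (at x)"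
    by (rule has_derivative_compose[OF p assms(1)[unfolded has_field_derivative_def]])
  moreover have "((\<lambda>x :: real^2. g (x $ 2)) has_derivative (\<lambda>h. g' * h $ 2)) (at x)"
    by (rule has_derivative_compose[OF p assms(2)[unfolded has_field_derivative_def]])
  ultimately show ?thesis by (auto intro!: derivative_eq_intros)
qed

lemma Ck_on_coordinate_product:
  "times_differentiable k f \<Longrightarrow> times_differentiable k g \<Longrightarrow> Ck_on k (\<lambda>x :: real^2. f (x $ 1) * g (x $ 2)) UNIV"
proof (induction k arbitrary: f g)
  case 0
  then show ?case by (auto intro!: continuous_intros continuous_on_compose2[of UNIV f] continuous_on_compose2[of UNIV g])
next
  case (Suc k)
  then obtain f' g' where d: "\<And>t. (f has_real_derivative f' t) (at t)" "times_differentiable k f'"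
     "\<And>t. (g has_real_derivative g' t) (at t)" "times_differentiable k g'" by auto
  note D = has_derivative_coordinate_product[OF d(1,3)]
  have F: "frechet_derivative (\<lambda>x :: real^2. f (x $ 1) * g (x $ 2)) (at x)
      = (\<lambda>h. f' (x $ 1) * h $ 1 * g (x $ 2) + f (x $ 1) * (g' (x $ 2) * h $ 2))" for x
    by (rule frechet_derivative_at[OF D, symmetric])
  have "Ck_on k (\<lambda>x :: real^2. f' (x $ 1) * b $ 1 * g (x $ 2) + f (x $ 1) * (g' (x $ 2) * b $ 2)) UNIV"
    if "b \<in> Basis" for b :: "real^2"
  proof -
    obtain i :: 2 where b: "b = axis i 1" using \<open>b \<in> Basis\<close> by (auto simp: Basis_vec_def)
    note lower = Suc.prems[THEN times_differentiable_SucD]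
    show ?thesis
    proof (cases "i = 1")
      case True
      then show ?thesis using Suc.IH[OF d(2) lower(2)] b by (simp add: axis_def)
    next
      case False
      then have "i = 2" using exhaust_2 by blast
      then show ?thesis using Suc.IH[OF lower(1) d(4)] b by (simp add: axis_def)
    qed
  qed
  then show ?case using D by (auto simp: F differentiable_on_def differentiable_def)
qed

definition box_bump :: "real \<Rightarrow> real^2 \<Rightarrow> real^2 \<Rightarrow> real^2 \<Rightarrow> real" where
  "box_bump c l r x = bump c (l $ 1) (r $ 1) (x $ 1) * bump c (l $ 2) (r $ 2) (x $ 2)"

lemma box_bump_zero: "x \<notin> box l r \<Longrightarrow> box_bump c l r x = 0"
  by (auto simp: box_bump_def mem_box_cart forall_2 bump_zero)

lemma box_bump_test_function:
  assumes "c > 0" "cbox l r \<subseteq> S"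
  shows "test_function S (box_bump c l r)"
proof -
  have s: "closure {x. box_bump c l r x \<noteq> 0} \<subseteq> cbox l r"
    by (rule closure_minimal) (use box_bump_zero box_subset_cbox in \<open>auto, blast\<close>)
  then have "compact (closure {x. box_bump c l r x \<noteq> 0})"
    using bounded_subset[OF bounded_cbox s] by (simp add: compact_eq_bounded_closed)
  moreover have "smooth_on (box_bump c l r) UNIV"
    unfolding smooth_on_def box_bump_def using assms by (auto intro!: Ck_on_coordinate_product bump_smooth)
  ultimately show ?thesis using s assms by (auto simp: test_function_def)
qed

lemma box_bump_bounds: "c > 0 \<Longrightarrow> \<bar>box_bump c l r x\<bar> \<le> 1"
  unfolding box_bump_def abs_mult using bump_bounds by (auto intro!: mult_le_one)

lemma box_bump_tendsto: "(\<lambda>m. box_bump (1 / real (Suc m)) l r x) \<longlonglongrightarrow> indicat_real (box l r) x"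
proof -
  have "indicat_real (box l r) x = (if l $ 1 < x $ 1 \<and> x $ 1 < r $ 1 then 1 else 0) * (if l $ 2 < x $ 2 \<and> x $ 2 < r $ 2 then 1 else 0)"
    by (auto simp: indicator_def mem_box_cart forall_2)
  then show ?thesis unfolding box_bump_def by (simp only:) (intro tendsto_mult bump_tendsto)
qed

lemma box_bump_C1:
  assumes "c > 0"
  obtains d where "\<And>x. (box_bump c l r has_derivative d x) (at x)"
    "\<And>j. continuous_on UNIV (\<lambda>x. d x (axis j 1))"
proof -
  have "times_differentiable (Suc 0) (bump c a b)" for a b by (rule bump_smooth[OF assms])
  then obtain f' g' where d: "\<And>t. (bump c (l $ 1) (r $ 1) has_real_derivative f' t) (at t)" "continuous_on UNIV f'"
     "\<And>t. (bump c (l $ 2) (r $ 2) has_real_derivative g' t) (at t)" "continuous_on UNIV g'"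
    by (metis times_differentiable.simps)
  have c: "continuous_on UNIV (bump c a b)" for a b
    using bump_smooth[OF assms, of 0] by simp
  note D = has_derivative_coordinate_product[OF d(1,3)]
  show thesis
  proof
    show "(box_bump c l r has_derivative
      (\<lambda>h. f' (x $ 1) * h $ 1 * bump c (l $ 2) (r $ 2) (x $ 2) + bump c (l $ 1) (r $ 1) (x $ 1) * (g' (x $ 2) * h $ 2))) (at x)" for x
      unfolding box_bump_def by (rule D)
    show "continuous_on UNIV (\<lambda>x. f' (x $ 1) * axis j 1 $ 1 * bump c (l $ 2) (r $ 2) (x $ 2)
        + bump c (l $ 1) (r $ 1) (x $ 1) * (g' (x $ 2) * axis j 1 $ 2))" for j :: 2
      by (intro continuous_intros continuous_on_compose2[OF d(2)] continuous_on_compose2[OF d(4)] continuous_on_compose2[OF c]) auto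
  qed
qed

section \<open>Iterated integrals over planar boxes\<close>

lemma vector2_nth [simp]: "vector [x, y] $ (1 :: 2) = x" "vector [x, y] $ (2 :: 2) = y"
  by (simp_all add: vector_2)

lemma vector2_eta [simp]: "vector [v $ 1, v $ 2] = (v :: 'a::zero^2)"
  by (simp add: vec_eq_iff forall_2)

lemma vector2_image_cbox:
  "(\<lambda>(x, y). vector [x, y]) ` cbox (a, c) (b, d) = cbox (vector [a, c]) (vector [b, d] :: real^2)"
proof (intro set_eqI iffI)
  fix v :: "real^2"
  assume "v \<in> cbox (vector [a, c]) (vector [b, d])"
  then have "(v $ 1, v $ 2) \<in> cbox (a, c) (b, d)" by (simp add: mem_box_cart forall_2 cbox_Pair_eq)
  moreover have "v = (\<lambda>(x, y). vector [x, y]) (v $ 1, v $ 2)" by simp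
  ultimately show "v \<in> (\<lambda>(x, y). vector [x, y]) ` cbox (a, c) (b, d)" by (rule rev_image_eqI)
qed (auto simp: mem_box_cart forall_2 cbox_Pair_eq)

lemma continuous_on_vector2 [continuous_intros]:
  assumes "continuous_on S f" "continuous_on S g"
  shows "continuous_on S (\<lambda>x. vector [f x, g x] :: real^2)"
proof -
  have "continuous_on S (\<lambda>x. if i = 1 then f x else g x)" for i :: 2
    using assms by (cases "i = 1") simp_all
  then have "continuous_on S (\<lambda>x. \<chi> i. if i = (1 :: 2) then f x else g x)"
    by (rule continuous_on_vec_lambda)
  then show ?thesis by (rule continuous_on_eq) (simp add: vec_eq_iff forall_2)
qed

lemma content_cbox_vector2:
  "measure lborel (cbox (vector [a, c]) (vector [b, d] :: real^2)) = measure lborel (cbox (a, c) (b, d))"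
proof -
  have "measure lborel (cbox (vector [a, c]) (vector [b, d] :: real^2))
     = (if a \<le> b \<and> c \<le> d then (b - a) * (d - c) else 0)"
  proof -
    have ex: "(\<exists>i :: 2. P i) \<longleftrightarrow> P 1 \<or> P 2" for P using forall_2[of "\<lambda>i. \<not> P i"] by blast
    show ?thesis by (auto simp: content_cbox_if_cart interval_eq_empty_cart ex UNIV_2)
  qed
  moreover have "measure lborel (cbox (a, c) (b, d)) = (if a \<le> b \<and> c \<le> d then (b - a) * (d - c) else 0)"
    by (simp add: content_Pair)
  ultimately show ?thesis by simp
qed

text \<open>The coordinate bijection between pairs and \<open>real^2\<close> maps boxes to boxes of
  the same content, so it transports the iterated integral for pairs.\<close>

lemma integral_vec2_iterated:
  fixes f :: "real^2 \<Rightarrow> real"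
  assumes "continuous_on (cbox (vector [a, c]) (vector [b, d])) f"
  shows "integral (cbox (vector [a, c]) (vector [b, d])) f = integral {a..b} (\<lambda>x. integral {c..d} (\<lambda>y. f (vector [x, y])))"
proof -
  let ?g = "\<lambda>(x, y). vector [x, y] :: real^2" and ?h = "\<lambda>v :: real^2. (v $ 1, v $ 2)"
  have h: "?h ` cbox u v = cbox (?h u) (?h v)" for u v
  proof (intro set_eqI iffI)
    fix p assume "p \<in> cbox (?h u) (?h v)"
    then have "vector [fst p, snd p] \<in> cbox u v" by (cases p) (simp add: mem_box_cart forall_2 cbox_Pair_eq)
    then show "p \<in> ?h ` cbox u v" by (rule rev_image_eqI) simp
  qed (auto simp: mem_box_cart forall_2 cbox_Pair_eq)
  have "(f has_integral integral (cbox (vector [a, c]) (vector [b, d])) f) (cbox (vector [a, c]) (vector [b, d]))"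
    by (rule integrable_integral[OF integrable_continuous[OF assms]])
  then have "((\<lambda>p. f (?g p)) has_integral (1 / 1) *\<^sub>R integral (cbox (vector [a, c]) (vector [b, d])) f)
       (?h ` cbox (vector [a, c]) (vector [b, d]))"
  proof (rule has_integral_twiddle[rotated -1])
    show "continuous (at p) ?g" for p
    proof -
      have "continuous_on UNIV (\<lambda>p. vector [fst p, snd p] :: real^2)" by (intro continuous_intros)
      then show ?thesis by (auto simp: continuous_on_eq_continuous_at case_prod_unfold simp del: split_paired_All)
    qed
    show "\<exists>w z. ?g ` cbox u v = cbox w z" for u v
      using vector2_image_cbox[of "fst u" "snd u" "fst v" "snd v"] by auto
    show "\<exists>w z. ?h ` cbox u v = cbox w z" for u v using h by blast
    show "measure lborel (?g ` cbox u v) = 1 * measure lborel (cbox u v)" for u v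
      using vector2_image_cbox[of "fst u" "snd u" "fst v" "snd v"]
         content_cbox_vector2[of "fst u" "snd u" "fst v" "snd v"] by simp
  qed auto
  then have "((\<lambda>p. f (?g p)) has_integral integral (cbox (vector [a, c]) (vector [b, d])) f) (cbox (a, c) (b, d))"
    by (simp add: h)
  moreover have "continuous_on (cbox (a, c) (b, d)) (\<lambda>p. f (?g p))"
  proof (rule continuous_on_compose2[OF assms])
    show "continuous_on (cbox (a, c) (b, d)) ?g"
      using continuous_on_vector2[of _ fst snd] by (simp add: split_beta continuous_intros)
    show "?g ` cbox (a, c) (b, d) \<subseteq> cbox (vector [a, c]) (vector [b, d])" by (simp add: vector2_image_cbox)
  qed
  then have "integral (cbox (a, c) (b, d)) (\<lambda>p. f (?g p)) = integral {a..b} (\<lambda>x. integral {c..d} (\<lambda>y. f (vector [x, y])))"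
    by (simp add: integral_prod_continuous)
  ultimately show ?thesis by (simp add: integral_unique)
qed

lemma has_derivative_vector2:
  "((\<lambda>t. vector [t, y] :: real^2) has_derivative (\<lambda>h. h *\<^sub>R axis 1 1)) F"
  "((\<lambda>t. vector [x, t] :: real^2) has_derivative (\<lambda>h. h *\<^sub>R axis 2 1)) F"
proof -
  have e: "(\<lambda>t. vector [t, y] :: real^2) = (\<lambda>t. t *\<^sub>R axis 1 1 + vector [0, y])"
    "(\<lambda>t. vector [x, t] :: real^2) = (\<lambda>t. t *\<^sub>R axis 2 1 + vector [x, 0])"
    by (auto simp: fun_eq_iff vec_eq_iff forall_2 axis_def)
  show "((\<lambda>t. vector [t, y] :: real^2) has_derivative (\<lambda>h. h *\<^sub>R axis 1 1)) F"
    "((\<lambda>t. vector [x, t] :: real^2) has_derivative (\<lambda>h. h *\<^sub>R axis 2 1)) F"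
    unfolding e by (auto intro!: derivative_eq_intros)
qed

text \<open>On each segment in direction j the fundamental theorem leaves the values of
  \<open>f\<close> at the two ends, which lie outside the open box. For j = 1 the order of
  integration is exchanged to make that direction the inner one.\<close>

lemma integral_partial_derivative_eq_0:
  fixes f :: "real^2 \<Rightarrow> real"
  assumes f: "\<And>x. x \<in> cbox l r \<Longrightarrow> (f has_derivative f' x) (at x)"
    and c: "continuous_on (cbox l r) (\<lambda>x. f' x (axis j 1))"
    and z: "\<And>x. x \<notin> box l r \<Longrightarrow> f x = 0"
  shows "integral (cbox l r) (\<lambda>x. f' x (axis j 1)) = 0"
proof -
  define l1 l2 r1 r2 where "l1 = l $ 1" "l2 = l $ 2" "r1 = r $ 1" "r2 = r $ 2"
  have lr: "l = vector [l1, l2]" "r = vector [r1, r2]" by (simp_all add: l1_l2_r1_r2_def)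
  note I = integral_vec2_iterated[OF c[unfolded lr], folded lr]
  have mem: "vector [x, y] \<in> cbox l r \<longleftrightarrow> x \<in> {l1..r1} \<and> y \<in> {l2..r2}" for x y
    by (auto simp: lr mem_box_cart forall_2)
  consider "j = 1" | "j = 2" using exhaust_2 by blast
  then show ?thesis
  proof cases
    case 2
    have "integral {l2..r2} (\<lambda>y. f' (vector [x, y]) (axis j 1)) = 0" if x: "x \<in> {l1..r1}" for x
    proof (cases "l2 \<le> r2")
      case True
      have "((\<lambda>y. f' (vector [x, y]) (axis j 1)) has_integral (f (vector [x, r2]) - f (vector [x, l2]))) {l2..r2}"
      proof (rule fundamental_theorem_of_calculus[OF True])
        fix y assume y: "y \<in> {l2..r2}"
        interpret bounded_linear "f' (vector [x, y])" using f[of "vector [x, y]"] mem x y by (auto intro: has_derivative_bounded_linear)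
        have "((\<lambda>y. f (vector [x, y])) has_derivative (\<lambda>h. f' (vector [x, y]) (h *\<^sub>R axis 2 1))) (at y within {l2..r2})"
          using x y mem by (intro has_derivative_compose[OF has_derivative_vector2(2)] f) auto
        then show "((\<lambda>y. f (vector [x, y])) has_vector_derivative f' (vector [x, y]) (axis j 1)) (at y within {l2..r2})"
          by (simp add: has_vector_derivative_def scaleR 2)
      qed
      moreover have "f (vector [x, r2]) = 0" "f (vector [x, l2]) = 0"
        by (rule z, simp add: lr mem_box_cart forall_2)+
      ultimately show ?thesis by (simp add: integral_unique)
    qed simp
    then have "integral {l1..r1} (\<lambda>x. integral {l2..r2} (\<lambda>y. f' (vector [x, y]) (axis j 1))) = integral {l1..r1} (\<lambda>x. 0)"
      by (intro Henstock_Kurzweil_Integration.integral_cong) auto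
    then show ?thesis unfolding I by simp
  next
    case 1
    have cc: "continuous_on (cbox (l1, l2) (r1, r2)) (\<lambda>(x, y). f' (vector [x, y]) (axis j 1))"
    proof -
      have "continuous_on (cbox (l1, l2) (r1, r2)) (\<lambda>p. f' (vector [fst p, snd p]) (axis j 1))"
        by (rule continuous_on_compose2[OF c]) (auto intro!: continuous_intros simp: mem cbox_Pair_eq)
      then show ?thesis by (simp add: split_beta)
    qed
    have swap: "integral {l1..r1} (\<lambda>x. integral {l2..r2} (\<lambda>y. f' (vector [x, y]) (axis j 1)))
        = integral {l2..r2} (\<lambda>y. integral {l1..r1} (\<lambda>x. f' (vector [x, y]) (axis j 1)))"
      using integral_swap_continuous[OF cc] by simp
    have "integral {l1..r1} (\<lambda>x. f' (vector [x, y]) (axis j 1)) = 0" if y: "y \<in> {l2..r2}" for y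
    proof (cases "l1 \<le> r1")
      case True
      have "((\<lambda>x. f' (vector [x, y]) (axis j 1)) has_integral (f (vector [r1, y]) - f (vector [l1, y]))) {l1..r1}"
      proof (rule fundamental_theorem_of_calculus[OF True])
        fix x assume x: "x \<in> {l1..r1}"
        interpret bounded_linear "f' (vector [x, y])" using f[of "vector [x, y]"] mem x y by (auto intro: has_derivative_bounded_linear)
        have "((\<lambda>x. f (vector [x, y])) has_derivative (\<lambda>h. f' (vector [x, y]) (h *\<^sub>R axis 1 1))) (at x within {l1..r1})"
          using x y mem by (intro has_derivative_compose[OF has_derivative_vector2(1)] f) auto
        then show "((\<lambda>x. f (vector [x, y])) has_vector_derivative f' (vector [x, y]) (axis j 1)) (at x within {l1..r1})"
          by (simp add: has_vector_derivative_def scaleR 1)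
      qed
      moreover have "f (vector [r1, y]) = 0" "f (vector [l1, y]) = 0"
        by (rule z, simp add: lr mem_box_cart forall_2)+
      ultimately show ?thesis by (simp add: integral_unique)
    qed simp
    then have "integral {l2..r2} (\<lambda>y. integral {l1..r1} (\<lambda>x. f' (vector [x, y]) (axis j 1))) = integral {l2..r2} (\<lambda>y. 0)"
      by (intro Henstock_Kurzweil_Integration.integral_cong) auto
    then show ?thesis unfolding I swap by simp
  qed
qed

section \<open>Agreement of weak and classical derivatives\<close>

lemma LINT_supported:
  assumes "Q \<subseteq> S" "\<And>x. x \<notin> Q \<Longrightarrow> f x = 0"
  shows "(LINT x:S|M. f x :: real) = (LINT x:Q|M. f x)"
  unfolding set_lebesgue_integral_def
  by (rule Bochner_Integration.integral_cong) (use assms in \<open>auto simp: indicator_def\<close>)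

text \<open>The weak identity and classical integration by parts, both tested with a bump on the
  box, show that the difference \<open>h\<close> of the two derivatives integrates to 0 against
  every bump. With c = 1 / (m + 1) the bumps tend to the indicator of the open box, and |h|
  dominates.\<close>

lemma weak_gradient_box_integral:
  assumes wg: "weak_gradient S w G" and Q: "cbox l r \<subseteq> S"
    and u: "\<And>x. x \<in> cbox l r \<Longrightarrow> w x = u x" "\<And>x. x \<in> cbox l r \<Longrightarrow> (u has_derivative u' x) (at x)"
    and c: "\<And>j. continuous_on (cbox l r) (\<lambda>x. u' x (axis j 1))"
  shows "integral (cbox l r) (\<lambda>x. G x $ i $ j) = integral (cbox l r) (\<lambda>x. u' x (axis j 1) $ i)"
proof -
  let ?Q = "cbox l r" and ?b = "\<lambda>m. box_bump (1 / real (Suc m)) l r"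
  have G: "G absolutely_integrable_on ?Q" using wg Q by (auto simp: weak_gradient_def L1_loc_def)
  have Gij: "(\<lambda>x. G x $ i $ j) absolutely_integrable_on ?Q"
  proof -
    have "(\<lambda>x. G x \<bullet> axis i (axis j 1)) absolutely_integrable_on ?Q"
      by (rule absolutely_integrable_component[OF G])
    then show ?thesis by (simp add: inner_axis)
  qed
  have "continuous_on ?Q u" by (rule has_derivative_continuous_on[OF has_derivative_at_withinI[OF u(2)]])
  then have cu: "continuous_on ?Q (\<lambda>x. u x $ i)" by (intro continuous_intros)
  have cD: "continuous_on ?Q (\<lambda>x. u' x (axis j 1) $ i)" by (intro continuous_intros c)
  have bb: "bounded (?b m ` T)" for m T
  proof (rule boundedI)
    show "norm y \<le> 1" if "y \<in> ?b m ` T" for y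
      using that box_bump_bounds[of "1 / real (Suc m)" l r] by auto
  qed
  define h where "h x = G x $ i $ j - u' x (axis j 1) $ i" for x
  have h: "h absolutely_integrable_on ?Q"
    unfolding h_def by (intro set_integral_diff Gij absolutely_integrable_continuous cD)
  have zero: "integral ?Q (\<lambda>x. h x * ?b m x) = 0" for m
  proof -
    let ?c = "1 / real (Suc m)"
    have cp: "?c > 0" by simp
    obtain d where d: "\<And>x. (?b m has_derivative d x) (at x)" "\<And>j. continuous_on UNIV (\<lambda>x. d x (axis j 1))"
      by (rule box_bump_C1[OF cp]) blast
    have pd: "partial_deriv j (?b m) x = d x (axis j 1)" for x
      unfolding partial_deriv_def using frechet_derivative_at[OF d(1)] by simp
    have cb: "continuous_on T (?b m)" for T
      using d(1) by (meson continuous_at_imp_continuous_on has_derivative_continuous)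
    have dz: "d x (axis j 1) = 0" if "x \<notin> ?Q" for x
    proof -
      have "(?b m has_derivative (\<lambda>_. 0)) (at x)"
      proof (rule has_derivative_transform_within_open[OF has_derivative_const open_Compl[OF closed_cbox]])
        show "x \<in> - ?Q" using that by simp
        show "0 = ?b m y" if "y \<in> - ?Q" for y
          using that box_bump_zero[of y l r] box_subset_cbox[of l r] by auto
      qed
      then show ?thesis using has_derivative_unique[OF d(1)] by metis
    qed
    have cd: "continuous_on T (\<lambda>x. d x (axis j 1))" for T using d(2) continuous_on_subset by blast
    have 1: "(LINT x:S|lebesgue. w x $ i * partial_deriv j (?b m) x) = integral ?Q (\<lambda>x. u x $ i * d x (axis j 1))"
    proof -
      have "(LINT x:S|lebesgue. w x $ i * partial_deriv j (?b m) x) = (LINT x:?Q|lebesgue. w x $ i * partial_deriv j (?b m) x)"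
      proof (rule LINT_supported[OF Q])
        show "w x $ i * partial_deriv j (?b m) x = 0" if "x \<notin> ?Q" for x
          unfolding pd dz[OF that] by simp
      qed
      also have "\<dots> = (LINT x:?Q|lebesgue. u x $ i * d x (axis j 1))"
        unfolding set_lebesgue_integral_def pd
        by (rule Bochner_Integration.integral_cong) (auto simp: indicator_def u)
      also have "\<dots> = integral ?Q (\<lambda>x. u x $ i * d x (axis j 1))"
        by (rule set_lebesgue_integral_eq_integral(2))
           (intro absolutely_integrable_continuous continuous_intros cu cd)
      finally show ?thesis .
    qed
    have Gb: "(\<lambda>x. G x $ i $ j * ?b m x) absolutely_integrable_on ?Q"
    proof -
      have "(\<lambda>x. ?b m x * G x $ i $ j) absolutely_integrable_on ?Q"
        by (rule absolutely_integrable_bounded_measurable_product[OF bilinear_times])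
          (use Gij in \<open>auto simp del: of_nat_Suc intro!: continuous_imp_measurable_on_sets_lebesgue cb bb\<close>)
      then show ?thesis by (simp add: mult.commute)
    qed
    have 2: "(LINT x:S|lebesgue. G x $ i $ j * ?b m x) = integral ?Q (\<lambda>x. G x $ i $ j * ?b m x)"
    proof -
      have "(LINT x:S|lebesgue. G x $ i $ j * ?b m x) = (LINT x:?Q|lebesgue. G x $ i $ j * ?b m x)"
        by (rule LINT_supported[OF Q]) (use box_bump_zero box_subset_cbox in \<open>metis mult_zero_right subsetD\<close>)
      also have "\<dots> = integral ?Q (\<lambda>x. G x $ i $ j * ?b m x)"
        by (rule set_lebesgue_integral_eq_integral(2)[OF Gb])
      finally show ?thesis .
    qed
    have Db: "(\<lambda>x. u' x (axis j 1) $ i * ?b m x) integrable_on ?Q"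
      "(\<lambda>x. u x $ i * d x (axis j 1)) integrable_on ?Q"
      by (intro integrable_continuous continuous_intros cD cb cu cd)+
    have 3: "integral ?Q (\<lambda>x. u' x (axis j 1) $ i * ?b m x + u x $ i * d x (axis j 1)) = 0"
    proof (rule integral_partial_derivative_eq_0[where f = "\<lambda>x. u x $ i * ?b m x"
          and f' = "\<lambda>x h. u' x h $ i * ?b m x + u x $ i * d x h"])
      show "((\<lambda>x. u x $ i * ?b m x) has_derivative (\<lambda>h. u' x h $ i * ?b m x + u x $ i * d x h)) (at x)"
        if "x \<in> ?Q" for x
      proof -
        have "((\<lambda>x. u x $ i) has_derivative (\<lambda>h. u' x h $ i)) (at x)"
          by (rule bounded_linear.has_derivative[OF bounded_linear_vec_nth u(2)[OF that]])
        then show ?thesis by (rule has_derivative_eq_rhs[OF has_derivative_mult[OF _ d(1)]]) auto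
      qed
    qed (auto intro!: continuous_intros cD cb cu cd simp: box_bump_zero simp del: of_nat_Suc)
    have t: "test_function S (?b m)" by (rule box_bump_test_function[OF cp Q])
    have "integral ?Q (\<lambda>x. u x $ i * d x (axis j 1)) = - integral ?Q (\<lambda>x. G x $ i $ j * ?b m x)"
      using wg t unfolding weak_gradient_def 1[symmetric] 2[symmetric] by blast
    moreover have "integral ?Q (\<lambda>x. u' x (axis j 1) $ i * ?b m x) + integral ?Q (\<lambda>x. u x $ i * d x (axis j 1)) = 0"
      using 3 integral_add[OF Db] by simp
    moreover have "integral ?Q (\<lambda>x. h x * ?b m x)
       = integral ?Q (\<lambda>x. G x $ i $ j * ?b m x) - integral ?Q (\<lambda>x. u' x (axis j 1) $ i * ?b m x)"
      unfolding h_def left_diff_distrib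
      by (rule integral_diff) (use Gb Db in \<open>auto dest: set_lebesgue_integral_eq_integral(1)\<close>)
    ultimately show ?thesis by linarith
  qed
  have bs: "integral ?Q h = integral ?Q (\<lambda>x. h x * indicat_real (box l r) x)"
    by (rule integral_spike[OF negligible_frontier_interval[of l r]]) (auto simp: indicator_def)
  have "(\<lambda>m. integral ?Q (\<lambda>x. h x * ?b m x)) \<longlonglongrightarrow> integral ?Q (\<lambda>x. h x * indicat_real (box l r) x)"
  proof (rule dominated_convergence(2)[where h = "\<lambda>x. norm (h x)"])
    show "(\<lambda>x. h x * ?b m x) integrable_on ?Q" for m
    proof -
      have cp: "1 / real (Suc m) > 0" by simp
      obtain d where d: "\<And>x. (?b m has_derivative d x) (at x)" by (rule box_bump_C1[OF cp]) blast
      have cb: "continuous_on ?Q (?b m)"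
        using d(1) by (meson continuous_at_imp_continuous_on has_derivative_continuous)
      have "(\<lambda>x. ?b m x * h x) absolutely_integrable_on ?Q"
        by (rule absolutely_integrable_bounded_measurable_product[OF bilinear_times])
          (use h in \<open>auto simp del: of_nat_Suc intro!: continuous_imp_measurable_on_sets_lebesgue cb bb\<close>)
      then show ?thesis by (auto simp: mult.commute dest: set_lebesgue_integral_eq_integral(1))
    qed
    show "(\<lambda>x. norm (h x)) integrable_on ?Q" using h by (simp add: absolutely_integrable_on_def)
    show "norm (h x * ?b m x) \<le> norm (h x)" for m x
      using box_bump_bounds[of "1 / real (Suc m)" l r x] by (simp add: abs_mult mult_left_le)
    show "(\<lambda>m. h x * ?b m x) \<longlonglongrightarrow> h x * indicat_real (box l r) x" for x
      by (intro tendsto_intros box_bump_tendsto)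
  qed
  then have "integral ?Q h = 0" unfolding zero bs by (simp add: LIMSEQ_const_iff)
  moreover have "integral ?Q h = integral ?Q (\<lambda>x. G x $ i $ j) - integral ?Q (\<lambda>x. u' x (axis j 1) $ i)"
    unfolding h_def
    by (rule integral_diff) (use Gij cD in \<open>auto intro: integrable_continuous dest: set_lebesgue_integral_eq_integral(1)\<close>)
  ultimately show ?thesis by simp
qed

text \<open>The difference of the two derivatives has integral 0 over every subbox. At almost every
  point it is the limit of its averages over small cubes with corner at that point, hence 0.\<close>

lemma weak_gradient_AE_box:
  assumes wg: "weak_gradient S w G" and Q: "cbox l r \<subseteq> S"
    and u: "\<And>x. x \<in> cbox l r \<Longrightarrow> w x = u x" "\<And>x. x \<in> cbox l r \<Longrightarrow> (u has_derivative u' x) (at x)"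
    and c: "\<And>j. continuous_on (cbox l r) (\<lambda>x. u' x (axis j 1))"
  shows "negligible {x \<in> cbox l r. G x $ i $ j \<noteq> u' x (axis j 1) $ i}"
proof -
  let ?Q = "cbox l r"
  define h where "h x = (if x \<in> ?Q then G x $ i $ j - u' x (axis j 1) $ i else 0)" for x
  have G: "G absolutely_integrable_on ?Q" using wg Q by (auto simp: weak_gradient_def L1_loc_def)
  have Gij: "(\<lambda>x. G x $ i $ j) integrable_on T" if "T = cbox a b" "T \<subseteq> ?Q" for T a b
  proof -
    have "(\<lambda>x. G x \<bullet> axis i (axis j 1)) absolutely_integrable_on ?Q"
      by (rule absolutely_integrable_component[OF G])
    then have "(\<lambda>x. G x $ i $ j) integrable_on ?Q"
      by (simp add: inner_axis set_lebesgue_integral_eq_integral(1))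
    then show ?thesis using that integrable_on_subcbox by blast
  qed
  have D: "(\<lambda>x. u' x (axis j 1) $ i) integrable_on T" if "T = cbox a b" "T \<subseteq> ?Q" for T a b
    unfolding that(1)
    by (rule integrable_continuous, intro continuous_intros continuous_on_subset[OF c]) (use that in auto)
  have int: "h integrable_on cbox a b" for a b
  proof -
    have "(\<lambda>x. G x $ i $ j - u' x (axis j 1) $ i) integrable_on ?Q"
      by (intro integrable_diff Gij[OF refl] D[OF refl]) auto
    then have "h integrable_on UNIV" unfolding h_def by (simp add: integrable_restrict_UNIV)
    then show ?thesis by (rule integrable_on_subcbox) simp
  qed
  obtain N where N: "negligible N" "\<And>x e. \<lbrakk>x \<notin> N; 0 < e\<rbrakk> \<Longrightarrow>
               \<exists>d>0. \<forall>t. 0 < t \<and> t < d \<longrightarrow>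
                         norm(integral (cbox x (x + t *\<^sub>R One)) h /\<^sub>R t ^ DIM(real^2) - h x) < e"
    using integrable_ccontinuous_explicit[of h] int by metis
  have zero: "h x = 0" if x: "x \<in> box l r" "x \<notin> N" for x
  proof (rule ccontr)
    assume "h x \<noteq> 0"
    then obtain d where d: "d > 0" "\<And>t. 0 < t \<Longrightarrow> t < d \<Longrightarrow>
         norm(integral (cbox x (x + t *\<^sub>R One)) h /\<^sub>R t ^ DIM(real^2) - h x) < norm (h x)"
      using N(2)[OF x(2), of "norm (h x)"] by auto
    obtain e where e: "e > 0" "ball x e \<subseteq> box l r" using x(1) open_box openE by blast
    \<comment> \<open>The diagonal vector \<open>One\<close> has norm at most 2, so a side of at
      most e / 4 keeps the far corner of the cube in the ball.\<close>
    define t where "t = min (d / 2) (e / 4)"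
    have t: "0 < t" "t < d" "t \<le> e / 4" using d e by (auto simp: t_def)
    have "x + t *\<^sub>R One \<in> ball x e"
    proof -
      have "norm (One :: real^2) \<le> 2"
        by (rule order_trans[OF norm_sum]) simp
      then have "t * norm (One :: real^2) \<le> e / 4 * 2" using t by (intro mult_mono) auto
      then show ?thesis using e t by (simp add: dist_norm)
    qed
    then have "x + t *\<^sub>R One \<in> box l r" using e by auto
    then have sub: "cbox x (x + t *\<^sub>R One) \<subseteq> ?Q"
      using x(1) by (intro subset_box_imp) (auto simp: mem_box less_imp_le)
    have "integral (cbox x (x + t *\<^sub>R One)) h
       = integral (cbox x (x + t *\<^sub>R One)) (\<lambda>x. G x $ i $ j - u' x (axis j 1) $ i)"
      by (rule Henstock_Kurzweil_Integration.integral_cong) (use sub in \<open>auto simp: h_def\<close>)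
    also have "\<dots> = integral (cbox x (x + t *\<^sub>R One)) (\<lambda>x. G x $ i $ j) - integral (cbox x (x + t *\<^sub>R One)) (\<lambda>x. u' x (axis j 1) $ i)"
      by (intro integral_diff Gij[OF refl sub] D[OF refl sub])
    also have "\<dots> = 0"
      using weak_gradient_box_integral[OF wg order_trans[OF sub Q] u(1)[OF subsetD[OF sub]]
          u(2)[OF subsetD[OF sub]] continuous_on_subset[OF c sub], of i j] by simp
    finally show False using d(2)[OF t(1,2)] by simp
  qed
  have "{x \<in> ?Q. G x $ i $ j \<noteq> u' x (axis j 1) $ i} \<subseteq> N \<union> (?Q - box l r)"
    using zero by (force simp: h_def)
  then show ?thesis
    using N(1) negligible_frontier_interval negligible_Un negligible_subset by blast
qed

text \<open>An open set is a countable union of closed boxes, so the null sets of the single boxes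
  add up to a null set.\<close>

lemma weak_gradient_AE:
  assumes wg: "weak_gradient S w G" and F: "open F" "F \<subseteq> S"
    and u: "\<And>x. x \<in> F \<Longrightarrow> w x = u x" "\<And>x. x \<in> F \<Longrightarrow> (u has_derivative u' x) (at x)"
    and c: "\<And>j. continuous_on F (\<lambda>x. u' x (axis j 1))"
  shows "negligible {x \<in> F. G x $ i $ j \<noteq> u' x (axis j 1) $ i}"
proof -
  obtain \<D> where D: "countable \<D>" "\<D> \<subseteq> Pow F" "\<And>X. X \<in> \<D> \<Longrightarrow> \<exists>a b. X = cbox a b" "\<Union>\<D> = F"
    using open_countable_Union_open_cbox[OF F(1)] by metis
  have "negligible {x \<in> X. G x $ i $ j \<noteq> u' x (axis j 1) $ i}" if X: "X \<in> \<D>" for X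
  proof -
    obtain l r where X': "X = cbox l r" "cbox l r \<subseteq> F" using D(2,3) X by blast
    show ?thesis unfolding X'(1)
      by (rule weak_gradient_AE_box[OF wg, where u = u and u' = u'])
        (use X' F u continuous_on_subset[OF c] in auto)
  qed
  then have "negligible (\<Union>X\<in>\<D>. {x \<in> X. G x $ i $ j \<noteq> u' x (axis j 1) $ i})"
    using D(1) by (intro negligible_countable_Union) auto
  moreover have "(\<Union>X\<in>\<D>. {x \<in> X. G x $ i $ j \<noteq> u' x (axis j 1) $ i}) = {x \<in> F. G x $ i $ j \<noteq> u' x (axis j 1) $ i}"
    using D(4) by auto
  ultimately show ?thesis by simp
qed

lemma norm_matrix2_squared:
  "(norm (A :: real^2^2))\<^sup>2 = (A $ 1 $ 1)\<^sup>2 + (A $ 1 $ 2)\<^sup>2 + (A $ 2 $ 1)\<^sup>2 + (A $ 2 $ 2)\<^sup>2"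
  by (simp add: norm_vec_def L2_set_def UNIV_2)

text \<open>This converts membership in \<open>D12_0\<close> into an energy bound for the classical
  gradient that is the same for all subsets \<open>T\<close>.\<close>

lemma classical_energy_le:
  assumes wg: "weak_gradient S w G" and L2: "L2 S G" and F: "open F" "F \<subseteq> S"
    and u: "\<And>x. x \<in> F \<Longrightarrow> w x = u x" "\<And>x. x \<in> F \<Longrightarrow> (u has_derivative u' x) (at x)"
    and c: "\<And>j. continuous_on F (\<lambda>x. u' x (axis j 1))"
    and T: "T \<subseteq> F" "(\<lambda>x. (u' x (axis 1 1) $ 1)\<^sup>2 + (u' x (axis 2 1) $ 1)\<^sup>2
          + (u' x (axis 1 1) $ 2)\<^sup>2 + (u' x (axis 2 1) $ 2)\<^sup>2) integrable_on T"
  shows "integral T (\<lambda>x. (u' x (axis 1 1) $ 1)\<^sup>2 + (u' x (axis 2 1) $ 1)\<^sup>2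
          + (u' x (axis 1 1) $ 2)\<^sup>2 + (u' x (axis 2 1) $ 2)\<^sup>2) \<le> integral S (\<lambda>x. (norm (G x))\<^sup>2)"
proof -
  let ?e = "\<lambda>x. (u' x (axis 1 1) $ 1)\<^sup>2 + (u' x (axis 2 1) $ 1)\<^sup>2 + (u' x (axis 1 1) $ 2)\<^sup>2 + (u' x (axis 2 1) $ 2)\<^sup>2"
  define N where "N = (\<Union>i :: 2. \<Union>j :: 2. {x \<in> F. G x $ i $ j \<noteq> u' x (axis j 1) $ i})"
  have N: "negligible N"
    unfolding N_def using weak_gradient_AE[OF wg F u c] by (intro negligible_Union) (auto intro!: negligible_Union)
  have eq: "?e x = (norm (G x))\<^sup>2" if "x \<in> T - N" for x
  proof -
    have "G x $ i $ j = u' x (axis j 1) $ i" for i j using that T by (auto simp: N_def)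
    then show ?thesis by (simp add: norm_matrix2_squared)
  qed
  have i: "(\<lambda>x. (norm (G x))\<^sup>2) integrable_on T"
    using T(2) integrable_spike[OF _ N, of ?e T "\<lambda>x. (norm (G x))\<^sup>2"] eq by auto
  have "integral T ?e = integral T (\<lambda>x. (norm (G x))\<^sup>2)"
    by (rule integral_spike[OF N]) (use eq in auto)
  also have "\<dots> \<le> integral S (\<lambda>x. (norm (G x))\<^sup>2)"
    using i L2 T F by (intro integral_subset_le) (auto simp: L2_def set_lebesgue_integral_eq_integral(1))
  finally show ?thesis .
qed

section \<open>The half plane minus a disk\<close>

definition bip_map :: "real \<Rightarrow> real \<Rightarrow> real \<Rightarrow> real^2" where
  "bip_map a x y = vector [bip_X a x y, bip_Y a x y]"

lemma bip_map_nth [simp]: "bip_map a x y $ 1 = bip_X a x y" "bip_map a x y $ 2 = bip_Y a x y"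
  by (simp_all add: bip_map_def)

lemma bip_map_derivs:
  assumes "bip_N x y \<noteq> 0"
  shows "((\<lambda>x. bip_map a x y) has_vector_derivative bip_c a x y *\<^sub>R axis 1 1 + bip_s a x y *\<^sub>R axis 2 1) (at x within U)"
    "((\<lambda>y. bip_map a x y) has_vector_derivative bip_s a x y *\<^sub>R axis 1 1 - bip_c a x y *\<^sub>R axis 2 1) (at y within U)"
proof -
  have e: "bip_map a x y = bip_X a x y *\<^sub>R axis 1 1 + bip_Y a x y *\<^sub>R axis 2 1" for x y
    by (simp add: vec_eq_iff forall_2 axis_def)
  have sc: "((\<lambda>t. f t *\<^sub>R (b :: real^2)) has_vector_derivative f' *\<^sub>R b) (at t within U)"
    if "(f has_field_derivative f') (at t within U)" for f f' b t
    using has_vector_derivative_scaleR[OF that has_vector_derivative_const[of b]] by simp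
  note d = bip_derivs(3-6)[OF assms, of a, THEN has_field_derivative_at_within, of U]
  show "((\<lambda>x. bip_map a x y) has_vector_derivative bip_c a x y *\<^sub>R axis 1 1 + bip_s a x y *\<^sub>R axis 2 1) (at x within U)"
    unfolding e by (intro has_vector_derivative_add sc d)
  have "((\<lambda>y. bip_map a x y) has_vector_derivative bip_s a x y *\<^sub>R axis 1 1 + (- bip_c a x y) *\<^sub>R axis 2 1) (at y within U)"
    unfolding e by (intro has_vector_derivative_add sc d)
  then show "((\<lambda>y. bip_map a x y) has_vector_derivative bip_s a x y *\<^sub>R axis 1 1 - bip_c a x y *\<^sub>R axis 2 1) (at y within U)"
    by simp
qed

lemma bip_map_continuous:
  "(\<And>q. q \<in> S \<Longrightarrow> bip_N (fst q) (snd q) \<noteq> 0) \<Longrightarrow> continuous_on S (\<lambda>q. bip_map a (fst q) (snd q))"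
  unfolding bip_map_def bip_X_def bip_Y_def by (intro continuous_intros bip_continuous) auto

lemma bip_radius:
  assumes "bip_N x y \<noteq> 0"
  shows "(bip_X a x y)\<^sup>2 + (bip_Y a x y)\<^sup>2 + a\<^sup>2 = 2 * a\<^sup>2 * cosh y / bip_N x y"
proof -
  define i where "i = inverse (bip_N x y)"
  have i: "bip_N x y * i = 1" using assms by (simp add: i_def)
  have "(sin x)\<^sup>2 = 1 - (cos x)\<^sup>2" "(sinh y)\<^sup>2 = (cosh y)\<^sup>2 - 1" "cosh y = bip_N x y + cos x"
    by (simp_all add: sin_squared_eq cosh_sq bip_N_def)
  then show ?thesis unfolding bip_X_def bip_Y_def divide_inverse i_def[symmetric] using i by algebra
qed

text \<open>The image point determines sin x / N and sinh y / N, and through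
  \<open>bip_radius\<close> also cosh y / N. Their quotient gives tanh y, hence y; then N follows,
  and with it cos x and sin x.\<close>

lemma bip_map_inj:
  assumes "a > 0" and x: "\<bar>x\<bar> < pi" "\<bar>x'\<bar> < pi" and y: "0 < y" "0 < y'" and eq: "bip_map a x y = bip_map a x' y'"
  shows "x = x' \<and> y = y'"
proof -
  have N: "bip_N x y > 0" "bip_N x' y' > 0" using bip_N_pos y by simp_all
  have X: "bip_X a x y = bip_X a x' y'" "bip_Y a x y = bip_Y a x' y'"
    using arg_cong[OF eq, of "\<lambda>v. v $ 1"] arg_cong[OF eq, of "\<lambda>v. v $ 2"] by simp_all
  have "2 * a\<^sup>2 * cosh y / bip_N x y = 2 * a\<^sup>2 * cosh y' / bip_N x' y'"
    using bip_radius[of x y a] bip_radius[of x' y' a] N X by simp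
  then have "2 * a\<^sup>2 * (cosh y / bip_N x y) = 2 * a\<^sup>2 * (cosh y' / bip_N x' y')"
    by (simp only: times_divide_eq_right)
  then have C: "cosh y / bip_N x y = cosh y' / bip_N x' y'" using assms(1) by (simp only: mult_cancel_left) simp
  have S: "sinh y / bip_N x y = sinh y' / bip_N x' y'" "sin x / bip_N x y = sin x' / bip_N x' y'"
  proof -
    have "a * (sinh y / bip_N x y) = a * (sinh y' / bip_N x' y')" "a * (sin x / bip_N x y) = a * (sin x' / bip_N x' y')"
      using X by (simp_all only: bip_X_def bip_Y_def times_divide_eq_right)
    then show "sinh y / bip_N x y = sinh y' / bip_N x' y'" "sin x / bip_N x y = sin x' / bip_N x' y'"
      using assms(1) by (simp_all only: mult_cancel_left) simp_all
  qed
  have "tanh y = (sinh y / bip_N x y) / (cosh y / bip_N x y)" "tanh y' = (sinh y' / bip_N x' y') / (cosh y' / bip_N x' y')"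
    using N by (simp_all add: tanh_def)
  then have "tanh y = tanh y'" using C S by simp
  then have yy: "y = y'" by simp
  then have NN: "bip_N x y = bip_N x' y'" using C N cosh_real_pos[of y] by (simp add: field_simps)
  then have "cos x = cos x'" using yy by (simp add: bip_N_def)
  moreover have "sin x = sin x'" using S(2) NN N by simp
  ultimately have "cos (x - x') = 1" by (simp add: cos_diff power2_eq_square[symmetric])
  moreover have "cos (x - x') = 1 - 2 * (sin ((x - x') / 2))\<^sup>2"
  proof -
    have "x - x' = 2 * ((x - x') / 2)" by simp
    then show ?thesis using cos_double_sin[of "(x - x') / 2"] by metis
  qed
  ultimately have sin0: "sin ((x - x') / 2) = 0" by simp
  have lt: "- pi < (x - x') / 2" "(x - x') / 2 < pi"
  proof -
    have "x < pi" "- pi < x" "x' < pi" "- pi < x'" using x by auto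
    then show "- pi < (x - x') / 2" "(x - x') / 2 < pi" by (simp_all add: field_simps)
  qed
  have "(x - x') / 2 = 0" by (rule sin_eq_0_pi[OF lt sin0])
  then show ?thesis using yy by simp
qed

section \<open>The bipolar chart of the fluid domain\<close>

locale disk_geometry =
  fixes R q :: real
  assumes R: "0 < R" and q: "0 < q"
begin

text \<open>The coordinate line y = \<alpha> is a circle of radius a / sinh \<alpha> whose centre
  has height a coth \<alpha>. Equating these with R and R + q forces cosh \<alpha> = 1 + q / R and a
  = R sinh \<alpha>.\<close>

definition "\<alpha> = arcosh (1 + q / R)"
definition "a = R * sinh \<alpha>"

lemma alpha_pos: "0 < \<alpha>"
  using arcosh_less_iff_real[of 1 "1 + q / R"] R q by (simp add: \<alpha>_def)

lemma R_cosh: "R * cosh \<alpha> = R + q"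
  unfolding \<alpha>_def using R q by (simp add: cosh_arcosh_real field_simps)

lemma a_pos: "0 < a"
  using R alpha_pos by (simp add: a_def)

text \<open>The sign of sinh(\<alpha> - y) tells on which side of the circle the point lies; this
  settles both the open strip and the line y = \<alpha>.\<close>

lemma dist_center:
  assumes "bip_N x y \<noteq> 0"
  shows "(dist (disk_center R q) (bip_map a x y))\<^sup>2 = R\<^sup>2 + 2 * R * a * sinh (\<alpha> - y) / bip_N x y"
proof -
  have "(dist (disk_center R q) (bip_map a x y))\<^sup>2 = (bip_X a x y)\<^sup>2 + (R * cosh \<alpha> - bip_Y a x y)\<^sup>2"
    unfolding R_cosh
    by (simp add: disk_center_def dist_norm norm_vec_def L2_set_def UNIV_2)
  also have "\<dots> = ((bip_X a x y)\<^sup>2 + (bip_Y a x y)\<^sup>2 + a\<^sup>2) - a\<^sup>2 + R\<^sup>2 * (cosh \<alpha>)\<^sup>2 - 2 * R * cosh \<alpha> * bip_Y a x y"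
    by (simp add: power2_eq_square algebra_simps)
  also have "\<dots> = 2 * a\<^sup>2 * cosh y / bip_N x y + R\<^sup>2 - 2 * R * cosh \<alpha> * (a * sinh y / bip_N x y)"
    unfolding bip_radius[OF assms] by (simp add: a_def bip_Y_def power_mult_distrib cosh_sq algebra_simps)
  also have "\<dots> = R\<^sup>2 + 2 * R * a * sinh (\<alpha> - y) / bip_N x y"
    using assms by (simp add: sinh_diff a_def field_simps power2_eq_square)
  finally show ?thesis .
qed

lemma bip_map_fluid:
  assumes "0 < y" "y < \<alpha>"
  shows "bip_map a x y \<in> fluid R q"
proof -
  have N: "0 < bip_N x y" using bip_N_pos assms by simp
  have "0 < 2 * R * a * sinh (\<alpha> - y) / bip_N x y" using N R a_pos assms by simp
  then have "R\<^sup>2 < (dist (disk_center R q) (bip_map a x y))\<^sup>2" using dist_center[of x y] N by simp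
  then have "R < dist (disk_center R q) (bip_map a x y)" using R by (simp add: power2_less_imp_less)
  moreover have "0 < bip_Y a x y" unfolding bip_Y_def using N a_pos assms by simp
  ultimately show ?thesis using R by (simp add: fluid_def half_plane_def disk_def)
qed

lemma bip_map_closure:
  assumes "0 \<le> y" "y \<le> \<alpha>" "0 < bip_N x y"
  shows "bip_map a x y \<in> closure (fluid R q)"
proof -
  \<comment> \<open>A convex combination of y and the interior height \<alpha> / 2, with weight 1 /
    (n + 1) on the latter: strictly inside the strip even if y is 0 or \<alpha>.\<close>
  define z where "z n = y + (\<alpha> / 2 - y) / real (Suc n)" for n
  have zlim: "z \<longlonglongrightarrow> y"
  proof -
    have "(\<lambda>n. y + (\<alpha> / 2 - y) / real (Suc n)) \<longlonglongrightarrow> y + 0"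
      by (intro tendsto_add tendsto_const LIMSEQ_Suc[OF lim_const_over_n])
    then show ?thesis by (simp add: z_def[abs_def])
  qed
  have "0 < z n \<and> z n < \<alpha>" for n
  proof -
    define w where "w = 1 / real (Suc n)"
    have t: "0 < w" "w \<le> 1" by (simp_all add: w_def)
    have "z n = y + (\<alpha> / 2 - y) * w" by (simp add: z_def w_def)
    then have "z n = (1 - w) * y + w * (\<alpha> / 2)" by (simp add: algebra_simps)
    moreover have "0 \<le> (1 - w) * y" "(1 - w) * y \<le> (1 - w) * \<alpha>"
      using t assms by (auto intro: mult_left_mono)
    moreover have "0 < w * (\<alpha> / 2)" "w * (\<alpha> / 2) < w * \<alpha>" using t alpha_pos by simp_all
    moreover have "(1 - w) * \<alpha> + w * \<alpha> = \<alpha>" by (simp add: algebra_simps)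
    ultimately show ?thesis by linarith
  qed
  then have "bip_map a x (z n) \<in> fluid R q" for n using bip_map_fluid by blast
  moreover have "(\<lambda>n. bip_map a x (z n)) \<longlonglongrightarrow> bip_map a x y"
  proof (rule isCont_tendsto_compose[OF _ zlim])
    show "isCont (bip_map a x) y"
      using bip_map_derivs(2)[of x y a UNIV] assms(3) by (auto intro: has_vector_derivative_continuous)
  qed
  ultimately show ?thesis unfolding closure_sequential
    by (intro exI[of _ "\<lambda>n. bip_map a x (z n)"]) simp
qed

lemma open_fluid: "open (fluid R q)"
proof -
  have "open half_plane" unfolding half_plane_def
    by (rule open_halfspace_component_gt_cart)
  then show ?thesis unfolding fluid_def by (rule open_Diff) simp
qed

lemma bip_map_disk_boundary: "bip_map a x \<alpha> \<in> disk_boundary R q"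
proof -
  have N: "0 < bip_N x \<alpha>" using bip_N_pos alpha_pos by simp
  then have "(dist (disk_center R q) (bip_map a x \<alpha>))\<^sup>2 = R\<^sup>2" using dist_center[of x \<alpha>] by simp
  then show ?thesis using R by (simp add: disk_boundary_def power2_eq_iff)
      (metis R zero_le_dist less_le_not_le neg_0_le_iff_le)
qed

lemma bip_map_wall: "bip_map a x 0 \<in> wall"
  by (simp add: wall_def bip_Y_def)

end

lemma has_vector_derivative_nth:
  fixes f :: "real \<Rightarrow> real^'n"
  assumes "(f has_vector_derivative f') F"
  shows "((\<lambda>x. f x $ k) has_real_derivative f' $ k) F"
  using bounded_linear.has_vector_derivative[OF bounded_linear_vec_nth assms]
  by (simp add: has_real_derivative_iff_has_vector_derivative)

lemma axis_Basis: "axis j (1::real) \<in> Basis"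
  by (simp add: axis_in_Basis_iff)

section \<open>The chain rule along bipolar coordinate lines\<close>

context disk_geometry
begin

abbreviation "S \<equiv> closure (fluid R q)"

text \<open>A derivative within the closed domain can be composed with any curve that stays in it.
  The lines of constant y do so even for y = 0 and y = \<alpha>, so derivatives in x reach the
  boundary; derivatives in y are two-sided and only taken in the open strip.\<close>

lemma chain:
  fixes f :: "real^2 \<Rightarrow> 'b::real_normed_vector"
  assumes f: "f differentiable_on S"
  defines "F \<equiv> \<lambda>j z. frechet_derivative f (at z within S) (axis j 1)"
  shows chain_x: "\<lbrakk>0 \<le> y; y \<le> \<alpha>; 0 < bip_N x y\<rbrakk> \<Longrightarrow>
      ((\<lambda>x. f (bip_map a x y)) has_vector_derivative
        bip_c a x y *\<^sub>R F 1 (bip_map a x y) + bip_s a x y *\<^sub>R F 2 (bip_map a x y)) (at x)"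
    and chain_y: "\<lbrakk>0 < y; y < \<alpha>\<rbrakk> \<Longrightarrow>
      ((\<lambda>y. f (bip_map a x y)) has_vector_derivative
        bip_s a x y *\<^sub>R F 1 (bip_map a x y) - bip_c a x y *\<^sub>R F 2 (bip_map a x y)) (at y)"
proof -
  have der: "(f has_derivative frechet_derivative f (at z within S)) (at z within S)" if "z \<in> S" for z
    using f that by (simp add: differentiable_on_def frechet_derivative_works[symmetric])
  {
    assume y: "0 \<le> y" "y \<le> \<alpha>" "0 < bip_N x y"
    let ?z = "bip_map a x y"
    define T where "T = {t. 0 < bip_N t y}"
    have T: "open T" "x \<in> T"
      using y(3) unfolding T_def bip_N_def by (auto intro!: open_Collect_less continuous_intros)
    have sub: "(\<lambda>x. bip_map a x y) ` T \<subseteq> S" using bip_map_closure y by (auto simp: T_def)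
    have zS: "?z \<in> S" using sub T by auto
    interpret L: bounded_linear "frechet_derivative f (at ?z within S)"
      by (rule has_derivative_bounded_linear[OF der[OF zS]])
    have "((f \<circ> (\<lambda>x. bip_map a x y)) has_vector_derivative
        frechet_derivative f (at ?z within S) (bip_c a x y *\<^sub>R axis 1 1 + bip_s a x y *\<^sub>R axis 2 1)) (at x within T)"
      by (rule vector_derivative_diff_chain_within[OF bip_map_derivs(1) has_derivative_subset[OF der[OF zS] sub]])
        (use y in simp)
    then show "((\<lambda>x. f (bip_map a x y)) has_vector_derivative
        bip_c a x y *\<^sub>R F 1 ?z + bip_s a x y *\<^sub>R F 2 ?z) (at x)"
      using T at_within_open[of x T] by (simp add: o_def F_def L.add L.scaleR)
  }
  {
    assume y: "0 < y" "y < \<alpha>"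
    let ?z = "bip_map a x y"
    have N: "0 < bip_N x t" if "t \<in> {0<..<\<alpha>}" for t using bip_N_pos[of t x] that by simp
    have sub: "bip_map a x ` {0<..<\<alpha>} \<subseteq> S" using bip_map_closure N by fastforce
    have zS: "?z \<in> S" using sub y by auto
    interpret L: bounded_linear "frechet_derivative f (at ?z within S)"
      by (rule has_derivative_bounded_linear[OF der[OF zS]])
    have "((f \<circ> (\<lambda>y. bip_map a x y)) has_vector_derivative
        frechet_derivative f (at ?z within S) (bip_s a x y *\<^sub>R axis 1 1 - bip_c a x y *\<^sub>R axis 2 1)) (at y within {0<..<\<alpha>})"
      by (rule vector_derivative_diff_chain_within[OF bip_map_derivs(2) has_derivative_subset[OF der[OF zS] sub]])
        (use N[of y] y in simp)
    then show "((\<lambda>y. f (bip_map a x y)) has_vector_derivative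
        bip_s a x y *\<^sub>R F 1 ?z - bip_c a x y *\<^sub>R F 2 ?z) (at y)"
      using y at_within_open[of y "{0<..<\<alpha>}"] by (simp add: o_def F_def L.diff L.scaleR)
  }
qed

lemma continuous_on_bip_domain:
  assumes "continuous_on S f"
  shows "continuous_on (bip_domain \<alpha>) (\<lambda>q. f (bip_map a (fst q) (snd q)))"
  by (rule continuous_on_compose2[OF assms bip_map_continuous]) (auto simp: bip_domain_def intro: bip_map_closure)

lemma strip_subset: "UNIV \<times> {0<..<\<alpha>} \<subseteq> bip_domain \<alpha>"
  using bip_N_pos by (auto simp: bip_domain_def)

lemma bip_map_pi: "bip_map a (- pi) y = bip_map a pi y" "bip_c a (- pi) y = bip_c a pi y" "bip_s a (- pi) y = bip_s a pi y"
  by (simp_all add: bip_map_def bip_X_def bip_Y_def bip_N_def bip_c_def bip_s_def)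

end

section \<open>A Stokes solution in bipolar coordinates\<close>

locale disk_stokes_flow = disk_geometry +
  fixes \<nu> V :: real and u :: "real^2 \<Rightarrow> real^2" and p :: "real^2 \<Rightarrow> real"
  assumes nu: "0 < \<nu>" and sol: "stokes_solution \<nu> R q V u p"
begin

text \<open>Taken within the closure, these derivatives are continuous up to the wall and the
  circle; on the open fluid domain they agree with the partial derivatives in the Stokes
  equations.\<close>

definition "D j x = frechet_derivative u (at x within S) (axis j 1)"
definition "DD j l x = frechet_derivative (D j) (at x within S) (axis l 1)"
definition "Dp l x = frechet_derivative p (at x within S) (axis l 1)"

lemma regularity:
  "u differentiable_on S" "D j differentiable_on S" "p differentiable_on S"
  "continuous_on S u" "continuous_on S (D j)" "continuous_on S (DD j l)" "continuous_on S p" "continuous_on S (Dp l)"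
proof -
  have "Ck_on (Suc (Suc 0)) u S" "Ck_on (Suc 0) p S"
    using sol by (auto simp: stokes_solution_def smooth_on_def simp del: Ck_on.simps)
  note c = this[unfolded Ck_on.simps]
  show 1: "u differentiable_on S" and 2: "p differentiable_on S" using c by auto
  show 3: "D j differentiable_on S" using c(1) axis_Basis[of j] unfolding D_def by blast
  show "continuous_on S (DD j l)" using c(1) axis_Basis[of j] axis_Basis[of l] unfolding DD_def D_def by blast
  show "continuous_on S (Dp l)" using c(2) axis_Basis[of l] unfolding Dp_def by blast
  show "continuous_on S u" "continuous_on S (D j)" "continuous_on S p"
    using 1 2 3 differentiable_imp_continuous_on by blast+
qed

lemma fluid_interior: "z \<in> fluid R q \<Longrightarrow> at z within S = at z"
  using open_fluid closure_subset[of "fluid R q"] by (intro at_within_interior) (meson interiorI)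

lemma u_has_derivative:
  assumes "z \<in> fluid R q"
  shows "(u has_derivative frechet_derivative u (at z within S)) (at z)"
proof -
  have "z \<in> S" using closure_subset assms by blast
  then have "(u has_derivative frechet_derivative u (at z within S)) (at z within S)"
    using regularity(1) by (simp add: differentiable_on_def frechet_derivative_works[symmetric])
  then show ?thesis by (simp only: fluid_interior[OF assms])
qed

lemma partial_D: "z \<in> fluid R q \<Longrightarrow> partial_deriv j u z = D j z"
  by (simp add: partial_deriv_def D_def fluid_interior)

lemma partial_DD:
  assumes z: "z \<in> fluid R q"
  shows "partial_deriv l (partial_deriv j u) z = DD j l z"
proof -
  have "z \<in> S" using closure_subset z by blast
  then have "D j differentiable (at z within S)" using regularity(2)[of j] by (simp add: differentiable_on_def)
  then have "D j differentiable (at z)" by (simp only: fluid_interior[OF z])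
  then have "(D j has_derivative frechet_derivative (D j) (at z)) (at z)" by (simp add: frechet_derivative_works[symmetric])
  then have "(partial_deriv j u has_derivative frechet_derivative (D j) (at z)) (at z)"
    by (rule has_derivative_transform_within_open[OF _ open_fluid z]) (simp add: partial_D)
  then have "frechet_derivative (partial_deriv j u) (at z) = frechet_derivative (D j) (at z)"
    by (rule frechet_derivative_at[symmetric])
  then show ?thesis by (simp add: partial_deriv_def DD_def fluid_interior[OF z])
qed

lemma stokes_pointwise:
  assumes z: "z \<in> fluid R q"
  shows "\<nu> * (DD 1 1 z $ k + DD 2 2 z $ k) = Dp k z"
    and "D 1 z $ 1 + D 2 z $ 2 = 0"
proof -
  have "- (\<nu> *\<^sub>R laplacian u z) + grad p z = 0" "divergence u z = 0"
    using sol z by (auto simp: stokes_solution_def)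
  note e = this
  have "laplacian u z = DD 1 1 z + DD 2 2 z" by (simp add: laplacian_def UNIV_2 partial_DD z)
  moreover have "grad p z $ k = Dp k z" by (simp add: grad_def partial_deriv_def Dp_def fluid_interior[OF z])
  ultimately show "\<nu> * (DD 1 1 z $ k + DD 2 2 z $ k) = Dp k z"
    using arg_cong[OF e(1), of "\<lambda>v. v $ k"] by simp
  show "D 1 z $ 1 + D 2 z $ 2 = 0" using e(2) by (simp add: divergence_def UNIV_2 partial_D z)
qed

text \<open>Continuity carries the equation to the boundary. It is needed on the circle, where
  incompressibility rewrites the traction.\<close>

lemma divergence_closure: "z \<in> S \<Longrightarrow> D 1 z $ 1 + D 2 z $ 2 = 0"
  by (rule continuous_constant_on_closure[of "fluid R q" "\<lambda>z. D 1 z $ 1 + D 2 z $ 2"])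
    (intro continuous_intros regularity, simp_all add: stokes_pointwise)

definition "U k x y = u (bip_map a x y) $ k"
definition "Ux k x y = bip_c a x y * D 1 (bip_map a x y) $ k + bip_s a x y * D 2 (bip_map a x y) $ k"
definition "Uy k x y = bip_s a x y * D 1 (bip_map a x y) $ k - bip_c a x y * D 2 (bip_map a x y) $ k"
definition "Uxx k x y = bip_cx a x y * D 1 (bip_map a x y) $ k + bip_cy a x y * D 2 (bip_map a x y) $ k
   + bip_c a x y * (bip_c a x y * DD 1 1 (bip_map a x y) $ k + bip_s a x y * DD 1 2 (bip_map a x y) $ k)
   + bip_s a x y * (bip_c a x y * DD 2 1 (bip_map a x y) $ k + bip_s a x y * DD 2 2 (bip_map a x y) $ k)"
definition "Uxy k x y = bip_cy a x y * D 1 (bip_map a x y) $ k - bip_cx a x y * D 2 (bip_map a x y) $ k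
   + bip_c a x y * (bip_s a x y * DD 1 1 (bip_map a x y) $ k - bip_c a x y * DD 1 2 (bip_map a x y) $ k)
   + bip_s a x y * (bip_s a x y * DD 2 1 (bip_map a x y) $ k - bip_c a x y * DD 2 2 (bip_map a x y) $ k)"
definition "Uyx k x y = bip_cy a x y * D 1 (bip_map a x y) $ k - bip_cx a x y * D 2 (bip_map a x y) $ k
   + bip_s a x y * (bip_c a x y * DD 1 1 (bip_map a x y) $ k + bip_s a x y * DD 1 2 (bip_map a x y) $ k)
   - bip_c a x y * (bip_c a x y * DD 2 1 (bip_map a x y) $ k + bip_s a x y * DD 2 2 (bip_map a x y) $ k)"
definition "Uyy k x y = - bip_cx a x y * D 1 (bip_map a x y) $ k - bip_cy a x y * D 2 (bip_map a x y) $ k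
   + bip_s a x y * (bip_s a x y * DD 1 1 (bip_map a x y) $ k - bip_c a x y * DD 1 2 (bip_map a x y) $ k)
   - bip_c a x y * (bip_s a x y * DD 2 1 (bip_map a x y) $ k - bip_c a x y * DD 2 2 (bip_map a x y) $ k)"
definition "Pr x y = p (bip_map a x y)"
definition "Prx x y = bip_c a x y * Dp 1 (bip_map a x y) + bip_s a x y * Dp 2 (bip_map a x y)"
definition "Pry x y = bip_s a x y * Dp 1 (bip_map a x y) - bip_c a x y * Dp 2 (bip_map a x y)"

lemma U_x: "\<lbrakk>0 \<le> y; y \<le> \<alpha>; 0 < bip_N x y\<rbrakk> \<Longrightarrow> ((\<lambda>x. U k x y) has_real_derivative Ux k x y) (at x)"
  using has_vector_derivative_nth[OF chain_x[OF regularity(1)], of y x k]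
  by (simp add: U_def Ux_def D_def)

lemma U_y: "\<lbrakk>0 < y; y < \<alpha>\<rbrakk> \<Longrightarrow> ((\<lambda>y. U k x y) has_real_derivative Uy k x y) (at y)"
  using has_vector_derivative_nth[OF chain_y[OF regularity(1)], of y x k]
  by (simp add: U_def Uy_def D_def)

lemma D_x: "\<lbrakk>0 < y; y < \<alpha>\<rbrakk> \<Longrightarrow> ((\<lambda>x. D j (bip_map a x y) $ k) has_real_derivative
    bip_c a x y * DD j 1 (bip_map a x y) $ k + bip_s a x y * DD j 2 (bip_map a x y) $ k) (at x)"
  using has_vector_derivative_nth[OF chain_x[OF regularity(2)[of j]], of y x k] bip_N_pos[of y x]
  by (simp add: DD_def)

lemma D_y: "\<lbrakk>0 < y; y < \<alpha>\<rbrakk> \<Longrightarrow> ((\<lambda>y. D j (bip_map a x y) $ k) has_real_derivative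
    bip_s a x y * DD j 1 (bip_map a x y) $ k - bip_c a x y * DD j 2 (bip_map a x y) $ k) (at y)"
  using has_vector_derivative_nth[OF chain_y[OF regularity(2)[of j]], of y x k]
  by (simp add: DD_def)

lemma Pr_derivs:
  assumes "0 < y" "y < \<alpha>"
  shows "((\<lambda>x. Pr x y) has_real_derivative Prx x y) (at x)" "((\<lambda>y. Pr x y) has_real_derivative Pry x y) (at y)"
  using chain_x[OF regularity(3), of y x] chain_y[OF regularity(3), of y x] bip_N_pos[of y x] assms
  by (simp_all add: Pr_def Prx_def Pry_def Dp_def has_real_derivative_iff_has_vector_derivative)

lemma second_derivs:
  assumes "0 < y" "y < \<alpha>"
  shows "((\<lambda>x. Ux k x y) has_real_derivative Uxx k x y) (at x)" "((\<lambda>y. Ux k x y) has_real_derivative Uxy k x y) (at y)"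
    "((\<lambda>x. Uy k x y) has_real_derivative Uyx k x y) (at x)" "((\<lambda>y. Uy k x y) has_real_derivative Uyy k x y) (at y)"
proof -
  have N: "bip_N x y \<noteq> 0" using bip_N_pos[of y x] assms by simp
  note d = bip_derivs(7-10)[OF N, of a] D_x[OF assms] D_y[OF assms]
  show "((\<lambda>x. Ux k x y) has_real_derivative Uxx k x y) (at x)"
    unfolding Ux_def Uxx_def by (rule DERIV_cong, (rule derivative_intros d)+, simp add: algebra_simps)
  show "((\<lambda>y. Ux k x y) has_real_derivative Uxy k x y) (at y)"
    unfolding Ux_def Uxy_def by (rule DERIV_cong, (rule derivative_intros d)+, simp add: algebra_simps)
  show "((\<lambda>x. Uy k x y) has_real_derivative Uyx k x y) (at x)"
    unfolding Uy_def Uyx_def by (rule DERIV_cong, (rule derivative_intros d)+, simp add: algebra_simps)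
  show "((\<lambda>y. Uy k x y) has_real_derivative Uyy k x y) (at y)"
    unfolding Uy_def Uyy_def by (rule DERIV_cong, (rule derivative_intros d)+, simp add: algebra_simps)
qed

lemma continuity_domain:
  "continuous_on (bip_domain \<alpha>) (\<lambda>q. Ux k (fst q) (snd q))" "continuous_on (bip_domain \<alpha>) (\<lambda>q. Uy k (fst q) (snd q))"
  "continuous_on (bip_domain \<alpha>) (\<lambda>q. Pr (fst q) (snd q))"
  "continuous_on (bip_domain \<alpha>) (\<lambda>q. Prx (fst q) (snd q))" "continuous_on (bip_domain \<alpha>) (\<lambda>q. Pry (fst q) (snd q))"
  "continuous_on (bip_domain \<alpha>) (\<lambda>q. Uxx k (fst q) (snd q))" "continuous_on (bip_domain \<alpha>) (\<lambda>q. Uxy k (fst q) (snd q))"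
  "continuous_on (bip_domain \<alpha>) (\<lambda>q. Uyy k (fst q) (snd q))"
proof -
  have N: "\<And>q. q \<in> bip_domain \<alpha> \<Longrightarrow> bip_N (fst q) (snd q) \<noteq> 0" by (auto simp: bip_domain_def)
  note c = bip_continuous(2-5)[OF N] regularity(4-8)[THEN continuous_on_bip_domain]
  show "continuous_on (bip_domain \<alpha>) (\<lambda>q. Ux k (fst q) (snd q))" "continuous_on (bip_domain \<alpha>) (\<lambda>q. Uy k (fst q) (snd q))"
  "continuous_on (bip_domain \<alpha>) (\<lambda>q. Pr (fst q) (snd q))"
  "continuous_on (bip_domain \<alpha>) (\<lambda>q. Prx (fst q) (snd q))" "continuous_on (bip_domain \<alpha>) (\<lambda>q. Pry (fst q) (snd q))"
  "continuous_on (bip_domain \<alpha>) (\<lambda>q. Uxx k (fst q) (snd q))" "continuous_on (bip_domain \<alpha>) (\<lambda>q. Uxy k (fst q) (snd q))"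
  "continuous_on (bip_domain \<alpha>) (\<lambda>q. Uyy k (fst q) (snd q))"
    unfolding Ux_def Uy_def Pr_def Prx_def Pry_def Uxx_def Uxy_def Uyy_def
    by (intro continuous_intros c; assumption)+
qed

text \<open>The two expressions differ by the exchange of \<open>DD 1 2\<close> and
  \<open>DD 2 1\<close>. The symmetry is proved for the pulled-back velocity on the strip, from
  continuity of \<open>Uxy\<close>.\<close>

lemma Uxy_eq_Uyx:
  assumes "0 < y" "y < \<alpha>"
  shows "Uxy k x y = Uyx k x y"
proof (rule mixed_partials_eq[where f = "U k" and fx = "Ux k" and fy = "Uy k" and fxy = "Uxy k" and fyx = "Uyx k"
      and l = 0 and r = \<alpha>])
  show "continuous_on (UNIV \<times> {0<..<\<alpha>}) (\<lambda>(x, y). Uxy k x y)"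
    unfolding split_beta by (rule continuous_on_subset[OF continuity_domain(7) strip_subset])
qed (use assms U_x U_y second_derivs bip_N_pos in auto)

lemma U_wall: "bip_N x 0 > 0 \<Longrightarrow> U k x 0 = 0"
  using sol bip_map_wall[of x] by (simp add: stokes_solution_def U_def)

lemma U_disk: "U 1 x \<alpha> = 0" "U 2 x \<alpha> = V"
  using sol bip_map_disk_boundary[of x] by (simp_all add: stokes_solution_def U_def e2_def axis_def)

lemma Ux_wall: "bip_N x 0 > 0 \<Longrightarrow> Ux k x 0 = 0"
proof -
  assume N: "bip_N x 0 > 0"
  have "((\<lambda>x. U k x 0) has_real_derivative Ux k x 0) (at x)" using U_x[of 0 x k] N alpha_pos by simp
  then have "((\<lambda>x. 0) has_real_derivative Ux k x 0) (at x)"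
  proof (rule has_field_derivative_transform_within_open[of _ _ _ "{t. 0 < bip_N t 0}"])
    show "open {t. 0 < bip_N t 0}" unfolding bip_N_def by (intro open_Collect_less continuous_intros)
  qed (use N U_wall in auto)
  then show ?thesis using DERIV_unique[OF DERIV_const] by metis
qed

lemma Ux_disk: "Ux k x \<alpha> = 0"
proof -
  have N: "0 < bip_N t \<alpha>" for t using bip_N_pos alpha_pos by simp
  have "((\<lambda>x. U k x \<alpha>) has_real_derivative Ux k x \<alpha>) (at x)" using U_x[of \<alpha> x k] alpha_pos N by simp
  moreover obtain c where "(\<lambda>x. U k x \<alpha>) = (\<lambda>x. c)"
    using U_disk exhaust_2[of k] by (metis (no_types))
  ultimately show ?thesis using DERIV_unique[OF DERIV_const] by metis
qed

end

section \<open>Conformal invariance of the Dirichlet energy\<close>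

lemma bip_map_has_derivative:
  fixes v :: "real^2"
  assumes N0: "bip_N (v $ 1) (v $ 2) \<noteq> 0"
  shows "((\<lambda>v. bip_map a (v $ 1) (v $ 2)) has_derivative
     (\<lambda>h. (h $ 1) *\<^sub>R (bip_c a (v $ 1) (v $ 2) *\<^sub>R axis 1 1 + bip_s a (v $ 1) (v $ 2) *\<^sub>R axis 2 1)
        + (h $ 2) *\<^sub>R (bip_s a (v $ 1) (v $ 2) *\<^sub>R axis 1 1 - bip_c a (v $ 1) (v $ 2) *\<^sub>R axis 2 1))) (at v within T)"
proof -
  define x y i where "x = v $ 1" and "y = v $ 2" and "i = inverse (bip_N (v $ 1) (v $ 2))"
  have co: "((\<lambda>v :: real^2. f (v $ k)) has_derivative (\<lambda>h. f' * h $ k)) (at v)"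
    if "(f has_real_derivative f') (at (v $ k))" for f f' k
    by (rule has_derivative_compose[OF bounded_linear_imp_has_derivative[OF bounded_linear_vec_nth]
        that[unfolded has_field_derivative_def]])
  have sx: "((\<lambda>v :: real^2. sin (v $ 1)) has_derivative (\<lambda>h. cos x * h $ 1)) (at v)"
    unfolding x_def y_def by (rule co) (auto intro!: derivative_eq_intros)
  have cx: "((\<lambda>v :: real^2. cos (v $ 1)) has_derivative (\<lambda>h. - sin x * h $ 1)) (at v)"
    unfolding x_def y_def by (rule co) (auto intro!: derivative_eq_intros)
  have sy: "((\<lambda>v :: real^2. sinh (v $ 2)) has_derivative (\<lambda>h. cosh y * h $ 2)) (at v)"
    unfolding x_def y_def by (rule co) (auto intro!: derivative_eq_intros)
  have cy: "((\<lambda>v :: real^2. cosh (v $ 2)) has_derivative (\<lambda>h. sinh y * h $ 2)) (at v)"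
    unfolding x_def y_def by (rule co) (auto intro!: derivative_eq_intros)
  have N: "((\<lambda>v. bip_N (v $ 1) (v $ 2)) has_derivative (\<lambda>h. sinh y * h $ 2 - - sin x * h $ 1)) (at v)"
    unfolding bip_N_def by (rule has_derivative_diff[OF cy cx])
  have I: "((\<lambda>v. inverse (bip_N (v $ 1) (v $ 2))) has_derivative
      (\<lambda>h. - (i * (sinh y * h $ 2 - - sin x * h $ 1) * i))) (at v)"
    unfolding i_def by (rule Deriv.has_derivative_inverse[OF N0 N])
  have f: "bip_N x y * i = 1" "(sin x)\<^sup>2 = 1 - (cos x)\<^sup>2" "(sinh y)\<^sup>2 = (cosh y)\<^sup>2 - 1" "cosh y = bip_N x y + cos x"
    using N0 by (simp_all add: x_def y_def i_def sin_squared_eq cosh_sq bip_N_def)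
  have cs: "bip_c a x y = a * (cos x * cosh y - 1) * i\<^sup>2" "bip_s a x y = - a * sin x * sinh y * i\<^sup>2"
    by (simp_all add: bip_c_def bip_s_def i_def x_def y_def divide_inverse power_inverse)
  have X: "((\<lambda>v. bip_X a (v $ 1) (v $ 2)) has_derivative (\<lambda>h. h $ 1 * bip_c a x y + h $ 2 * bip_s a x y)) (at v)"
    unfolding bip_X_def divide_inverse
  proof (rule has_derivative_eq_rhs[OF has_derivative_mult[OF has_derivative_mult_right[OF sx] I]], rule ext)
    show "a * sin (v $ 1) * - (i * (sinh y * h $ 2 - - sin x * h $ 1) * i) + a * (cos x * h $ 1) * inverse (bip_N (v $ 1) (v $ 2))
       = h $ 1 * bip_c a x y + h $ 2 * bip_s a x y" for h :: "real^2"
      unfolding i_def[symmetric] unfolding cs x_def[symmetric] using f by algebra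
  qed
  have Y: "((\<lambda>v. bip_Y a (v $ 1) (v $ 2)) has_derivative (\<lambda>h. h $ 1 * bip_s a x y - h $ 2 * bip_c a x y)) (at v)"
    unfolding bip_Y_def divide_inverse
  proof (rule has_derivative_eq_rhs[OF has_derivative_mult[OF has_derivative_mult_right[OF sy] I]], rule ext)
    show "a * sinh (v $ 2) * - (i * (sinh y * h $ 2 - - sin x * h $ 1) * i) + a * (cosh y * h $ 2) * inverse (bip_N (v $ 1) (v $ 2))
       = h $ 1 * bip_s a x y - h $ 2 * bip_c a x y" for h :: "real^2"
      unfolding i_def[symmetric] unfolding cs y_def[symmetric] using f by algebra
  qed
  have e: "bip_map a s t = bip_X a s t *\<^sub>R axis 1 1 + bip_Y a s t *\<^sub>R axis 2 1" for s t
    by (simp add: vec_eq_iff forall_2 axis_def)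
  have "((\<lambda>v. bip_map a (v $ 1) (v $ 2)) has_derivative (\<lambda>h. (h $ 1 * bip_c a x y + h $ 2 * bip_s a x y) *\<^sub>R axis 1 1
       + (h $ 1 * bip_s a x y - h $ 2 * bip_c a x y) *\<^sub>R axis 2 1)) (at v)"
    unfolding e by (intro has_derivative_add has_derivative_scaleR_left X Y)
  then show ?thesis
    by (rule has_derivative_at_withinI[OF has_derivative_eq_rhs]) (simp add: x_def y_def algebra_simps)
qed

context disk_stokes_flow
begin

text \<open>The ratio \<open>bip_c\<close>^2 + \<open>bip_s\<close>^2 of the two energy densities is
  also the absolute Jacobian determinant of the chart. The energy on a rectangle is therefore the
  energy of \<open>u\<close> on its image in the fluid, and the Dirichlet integral of the weak
  gradient over the half plane bounds it.\<close>

lemma energy_bound: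
  obtains M where "\<And>y0 y1. \<lbrakk>0 < y0; y0 < y1; y1 < \<alpha>\<rbrakk> \<Longrightarrow>
     integral {y0..y1} (\<lambda>y. integral {- pi..pi}
       (\<lambda>x. (Ux 1 x y)\<^sup>2 + (Uy 1 x y)\<^sup>2 + (Ux 2 x y)\<^sup>2 + (Uy 2 x y)\<^sup>2)) \<le> M"
proof -
  define w where "w x = (if x \<in> disk R q then V *\<^sub>R e2 else u x)" for x
  have "w \<in> D12_0" using sol unfolding stokes_solution_def w_def[abs_def] by blast
  then obtain G where G: "weak_gradient half_plane w G" "L2 half_plane G" by (auto simp: D12_0_def)
  define u' where "u' z = frechet_derivative u (at z within S)" for z
  have u'D: "u' z (axis j 1) = D j z" for z j by (simp add: u'_def D_def)
  define E where "E z = (u' z (axis 1 1) $ 1)\<^sup>2 + (u' z (axis 2 1) $ 1)\<^sup>2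
          + (u' z (axis 1 1) $ 2)\<^sup>2 + (u' z (axis 2 1) $ 2)\<^sup>2" for z
  define e where "e x y = (Ux 1 x y)\<^sup>2 + (Uy 1 x y)\<^sup>2 + (Ux 2 x y)\<^sup>2 + (Uy 2 x y)\<^sup>2" for x y
  have eE: "e x y = ((bip_c a x y)\<^sup>2 + (bip_s a x y)\<^sup>2) * E (bip_map a x y)" for x y
    unfolding e_def E_def Ux_def Uy_def u'D by algebra
  have FS: "fluid R q \<subseteq> half_plane" by (auto simp: fluid_def)
  show thesis
  proof (rule that[of "integral half_plane (\<lambda>x. (norm (G x))\<^sup>2)"])
    fix y0 y1 assume y: "0 < y0" "y0 < y1" "y1 < \<alpha>"
    let ?C = "cbox (vector [- pi, y0]) (vector [pi, y1]) :: (real^2) set"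
    \<comment> \<open>The chart identifies the sides x = - pi and x = pi, so injectivity requires
      the open rectangle.\<close>
    let ?B = "box (vector [- pi, y0]) (vector [pi, y1]) :: (real^2) set"
    let ?g = "\<lambda>v :: real^2. bip_map a (v $ 1) (v $ 2)"
    let ?g' = "\<lambda>v h :: real^2. (h $ 1) *\<^sub>R (bip_c a (v $ 1) (v $ 2) *\<^sub>R axis 1 1 + bip_s a (v $ 1) (v $ 2) *\<^sub>R axis 2 1)
        + (h $ 2) *\<^sub>R (bip_s a (v $ 1) (v $ 2) *\<^sub>R axis 1 1 - bip_c a (v $ 1) (v $ 2) *\<^sub>R axis 2 1)"
    have BC: "?B \<subseteq> ?C" by (rule box_subset_cbox)
    have mC: "- pi \<le> v $ 1 \<and> v $ 1 \<le> pi \<and> y0 \<le> v $ 2 \<and> v $ 2 \<le> y1" if "v \<in> ?C" for v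
      using that by (auto simp: mem_box_cart forall_2)
    have mB: "\<bar>v $ 1\<bar> < pi \<and> y0 < v $ 2 \<and> v $ 2 < y1" if "v \<in> ?B" for v
      using that by (auto simp: mem_box_cart forall_2)
    have der: "(?g has_derivative ?g' v) (at v within ?B)" if "v \<in> ?B" for v
      using bip_N_pos[of "v $ 2" "v $ 1"] mB[OF that] y by (intro bip_map_has_derivative) auto
    have inj: "inj_on ?g ?B"
    proof (rule inj_onI)
      fix v w assume "v \<in> ?B" "w \<in> ?B" "?g v = ?g w"
      then have "v $ 1 = w $ 1 \<and> v $ 2 = w $ 2" using mB[of v] mB[of w] y a_pos by (intro bip_map_inj) auto
      then show "v = w" by (simp add: vec_eq_iff forall_2)
    qed
    have sub: "?g ` ?B \<subseteq> fluid R q" using mB y by (auto intro!: bip_map_fluid dest!: mB)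
    have det: "\<bar>det (matrix (?g' v))\<bar> = (bip_c a (v $ 1) (v $ 2))\<^sup>2 + (bip_s a (v $ 1) (v $ 2))\<^sup>2" for v
    proof -
      have "det (matrix (?g' v)) = - ((bip_c a (v $ 1) (v $ 2))\<^sup>2 + (bip_s a (v $ 1) (v $ 2))\<^sup>2)"
        by (simp add: det_2 matrix_def axis_def power2_eq_square)
      then show ?thesis by simp
    qed
    have ce: "continuous_on ?C (\<lambda>v. e (v $ 1) (v $ 2))"
    proof -
      have "continuous_on (bip_domain \<alpha>) (\<lambda>p. e (fst p) (snd p))"
        unfolding e_def by (intro continuous_intros continuity_domain)
      then have "continuous_on ?C (\<lambda>v. e (fst (v $ 1, v $ 2)) (snd (v $ 1, v $ 2)))"
      proof (rule continuous_on_compose2)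
        show "continuous_on ?C (\<lambda>v. (v $ 1, v $ 2))" by (intro continuous_intros)
        show "(\<lambda>v. (v $ 1, v $ 2)) ` ?C \<subseteq> bip_domain \<alpha>"
        proof (rule image_subsetI)
          fix v assume "v \<in> ?C"
          then have "y0 \<le> v $ 2" "v $ 2 \<le> y1" using mC by auto
          then show "(v $ 1, v $ 2) \<in> bip_domain \<alpha>"
            using y bip_N_pos[of "v $ 2" "v $ 1"] by (simp add: bip_domain_def)
        qed
      qed
      then show ?thesis by simp
    qed
    \<comment> \<open>The change of variables theorem is applied to vector-valued functions;
      \<open>F\<close> is \<open>E\<close> with values in \<open>real^1\<close>.\<close>
    define F where "F z = (vec (E z) :: real^1)" for z
    have gF: "\<bar>det (matrix (?g' v))\<bar> *\<^sub>R F (?g v) = vec (e (v $ 1) (v $ 2))" for v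
      unfolding det F_def eE by (simp add: vec_eq_iff)
    have "(\<lambda>v. vec (e (v $ 1) (v $ 2)) :: real^1) absolutely_integrable_on ?B"
    proof (rule set_integrable_subset[OF absolutely_integrable_continuous _ BC])
      show "continuous_on ?C (\<lambda>v. vec (e (v $ 1) (v $ 2)) :: real^1)"
        unfolding vec_def by (intro continuous_on_vec_lambda ce)
    qed simp
    then have ai: "(\<lambda>v. \<bar>det (matrix (?g' v))\<bar> *\<^sub>R F (?g v)) absolutely_integrable_on ?B" unfolding gF .
    have cv: "F absolutely_integrable_on ?g ` ?B \<and>
        integral (?g ` ?B) F = integral ?B (\<lambda>v. \<bar>det (matrix (?g' v))\<bar> *\<^sub>R F (?g v))"
      using has_absolute_integral_change_of_variables[of ?B ?g ?g' F] der inj ai by auto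
    then have FI: "F integrable_on ?g ` ?B" by (simp add: set_lebesgue_integral_eq_integral(1))
    have BI: "(\<lambda>v. vec (e (v $ 1) (v $ 2)) :: real^1) integrable_on ?B"
      using ai unfolding gF by (rule set_lebesgue_integral_eq_integral(1))
    have EI: "E integrable_on ?g ` ?B"
      using integrable_component[OF FI, of "axis 1 1"] by (simp add: F_def inner_axis)
    have "integral (?g ` ?B) E = integral (?g ` ?B) F $ 1"
      using integral_component_eq[OF FI, of "axis 1 1"] by (simp add: F_def inner_axis)
    also have "\<dots> = integral ?B (\<lambda>v. e (v $ 1) (v $ 2))"
      using cv integral_component_eq[OF BI, of "axis 1 1"] unfolding gF by (simp add: inner_axis)
    also have "\<dots> = integral ?C (\<lambda>v. e (v $ 1) (v $ 2))" by (rule integral_open_interval)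
    also have "\<dots> = integral {- pi..pi} (\<lambda>x. integral {y0..y1} (\<lambda>y. e x y))"
      using integral_vec2_iterated[OF ce] by simp
    also have "\<dots> = integral {y0..y1} (\<lambda>y. integral {- pi..pi} (\<lambda>x. e x y))"
    proof -
      have "continuous_on (cbox (- pi, y0) (pi, y1)) (\<lambda>p. e (fst p) (snd p))"
        unfolding e_def
        by (rule continuous_on_subset[of "bip_domain \<alpha>"], intro continuous_intros continuity_domain)
           (use y bip_N_pos in \<open>auto simp: bip_domain_def cbox_Pair_eq\<close>)
      then show ?thesis
        using integral_swap_continuous[of "- pi" y0 pi y1 e] by (simp add: split_beta)
    qed
    finally have eq: "integral {y0..y1} (\<lambda>y. integral {- pi..pi} (\<lambda>x. e x y)) = integral (?g ` ?B) E" by simp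
    have "integral (?g ` ?B) E \<le> integral half_plane (\<lambda>x. (norm (G x))\<^sup>2)"
      unfolding E_def
    proof (rule classical_energy_le[OF G open_fluid FS])
      show "w z = u z" if "z \<in> fluid R q" for z
        using that closure_subset[of "disk R q"] by (auto simp: w_def fluid_def)
      show "(u has_derivative u' z) (at z)" if "z \<in> fluid R q" for z
        unfolding u'_def by (rule u_has_derivative[OF that])
      show "continuous_on (fluid R q) (\<lambda>x. u' x (axis j 1))" for j
        unfolding u'D by (rule continuous_on_subset[OF regularity(5) closure_subset])
    qed (use sub EI in \<open>auto simp: E_def[abs_def]\<close>)
    then show "integral {y0..y1} (\<lambda>y. integral {- pi..pi}
       (\<lambda>x. (Ux 1 x y)\<^sup>2 + (Uy 1 x y)\<^sup>2 + (Ux 2 x y)\<^sup>2 + (Uy 2 x y)\<^sup>2)) \<le> integral half_plane (\<lambda>x. (norm (G x))\<^sup>2)"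
      using eq by (simp add: e_def)
  qed
qed

lemma bipolar_flow_instance:
  obtains M where "bipolar_flow a \<alpha> \<nu> V M (U 1) (U 2) Pr (Ux 1) (Uy 1) (Ux 2) (Uy 2) Prx Pry
     (Uxx 1) (Uxy 1) (Uyy 1) (Uxx 2) (Uxy 2) (Uyy 2)"
proof -
  obtain M where M: "\<And>y0 y1. \<lbrakk>0 < y0; y0 < y1; y1 < \<alpha>\<rbrakk> \<Longrightarrow>
     integral {y0..y1} (\<lambda>y. integral {- pi..pi}
       (\<lambda>x. (Ux 1 x y)\<^sup>2 + (Uy 1 x y)\<^sup>2 + (Ux 2 x y)\<^sup>2 + (Uy 2 x y)\<^sup>2)) \<le> M" by (rule energy_bound) blast
  have pi0: "0 < bip_N pi 0" by (simp add: bip_N_def)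
  have cU: "continuous_on {0..\<alpha>} (U k pi)" for k
  proof -
    have "continuous_on {0..\<alpha>} (\<lambda>y. (\<lambda>q. u (bip_map a (fst q) (snd q))) (pi, y))"
      by (rule continuous_on_compose2[OF continuous_on_bip_domain[OF regularity(4)]])
         (auto intro!: continuous_intros bip_N_pos' simp: bip_domain_def)
    then show ?thesis unfolding U_def by (auto intro: continuous_intros)
  qed
  have per: "Ux k pi y = Ux k (- pi) y" "Uy k pi y = Uy k (- pi) y" "Pr pi y = Pr (- pi) y" for k y
    by (simp_all add: Ux_def Uy_def Pr_def bip_map_pi)
  \<comment> \<open>The chart is harmonic, so the terms with its second derivatives cancel and the
    Laplacian only picks up the conformal factor.\<close>
  have lap: "Uxx k x y + Uyy k x y = ((bip_c a x y)\<^sup>2 + (bip_s a x y)\<^sup>2) * (DD 1 1 (bip_map a x y) $ k + DD 2 2 (bip_map a x y) $ k)"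
    for k x y unfolding Uxx_def Uyy_def by algebra
  have st: "\<nu> * (Uxx k x y + Uyy k x y) = ((bip_c a x y)\<^sup>2 + (bip_s a x y)\<^sup>2) * Dp k (bip_map a x y)"
    if "0 < y" "y < \<alpha>" for k x y
    unfolding lap mult.left_commute[of \<nu>] stokes_pointwise(1)[OF bip_map_fluid[OF that]] ..
  have str: "continuous_on (UNIV \<times> {0<..<\<alpha>}) f" if "continuous_on (bip_domain \<alpha>) f" for f :: "real \<times> real \<Rightarrow> real"
    by (rule continuous_on_subset[OF that strip_subset])
  show thesis
  proof (rule that, unfold_locales)
    fix x y assume y: "0 < y" "y < \<alpha>"
    show "\<nu> * (Uxx 1 x y + Uyy 1 x y) = Prx x y * bip_c a x y + Pry x y * bip_s a x y"
      unfolding st[OF y] Prx_def Pry_def by algebra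
    show "\<nu> * (Uxx 2 x y + Uyy 2 x y) = Prx x y * bip_s a x y - Pry x y * bip_c a x y"
      unfolding st[OF y] Prx_def Pry_def by algebra
    show "bip_c a x y * Ux 1 x y + bip_s a x y * Uy 1 x y + bip_s a x y * Ux 2 x y - bip_c a x y * Uy 2 x y = 0"
      unfolding Ux_def Uy_def using stokes_pointwise(2)[OF bip_map_fluid[OF y, of x]] by algebra
    have "((\<lambda>x. Uy k x y) has_real_derivative Uxy k x y) (at x)" for k
      using second_derivs(3)[OF y] Uxy_eq_Uyx[OF y] by simp
    then show "((\<lambda>x. Uy 1 x y) has_real_derivative Uxy 1 x y) (at x)" "((\<lambda>x. Uy 2 x y) has_real_derivative Uxy 2 x y) (at x)"
      by blast+
  next
    fix f assume "f \<in> {Uxx 1, Uxy 1, Uyy 1, Uxx 2, Uxy 2, Uyy 2, Prx, Pry}"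
    then show "continuous_on (UNIV \<times> {0<..<\<alpha>}) (\<lambda>q. f (fst q) (snd q))"
      by (elim insertE emptyE) (simp_all only:, (rule str, rule continuity_domain)+)
  next
    fix f assume "f \<in> {Ux 1, Uy 1, Ux 2, Uy 2, Pr}"
    then show "continuous_on (bip_domain \<alpha>) (\<lambda>q. f (fst q) (snd q))"
      by (elim insertE emptyE) (simp_all only:, (rule continuity_domain)+)
  next
    fix f y assume "f \<in> {Ux 1, Uy 1, Ux 2, Uy 2, Pr}"
    then show "f pi y = f (- pi) y" using per by auto
  qed (use a_pos alpha_pos nu U_y second_derivs Pr_derivs cU U_wall[of pi] pi0 U_disk Ux_wall Ux_disk M in auto)
qed

end

section \<open>The drag force\<close>

context disk_geometry
begin

definition "rot = exp (- \<alpha>)"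

text \<open>The angle on the circle, measured clockwise from the top, as a function of the bipolar angle.\<close>

definition "angle x = x + 2 * arctan (rot * sin x / (1 - rot * cos x))"

lemma rot_bounds: "0 < rot" "rot < 1"
  using alpha_pos by (simp_all add: rot_def)

lemma rot_hyperbolic: "2 * rot * cosh \<alpha> = 1 + rot\<^sup>2" "2 * rot * sinh \<alpha> = 1 - rot\<^sup>2"
proof -
  have "rot * exp \<alpha> = 1" by (simp add: rot_def exp_minus)
  moreover have "2 * cosh \<alpha> = exp \<alpha> + rot" "2 * sinh \<alpha> = exp \<alpha> - rot"
    by (simp_all add: cosh_field_def sinh_field_def rot_def)
  ultimately show "2 * rot * cosh \<alpha> = 1 + rot\<^sup>2" "2 * rot * sinh \<alpha> = 1 - rot\<^sup>2"
    by algebra+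
qed

lemma angle_denominator: "0 < 1 - rot * cos x"
proof -
  have "rot * cos x \<le> rot" using mult_left_mono[of "cos x" 1 rot] rot_bounds by simp
  then show ?thesis using rot_bounds by linarith
qed

text \<open>With r = \<open>rot\<close>, exp(i \<open>angle\<close> x) = (exp(i x) - r) / (1 - r
  exp(i x)), a Moebius map of the unit circle; the formula with arctan is the continuous branch of
  its argument. The derivative is the Poisson kernel sinh \<alpha> / (cosh \<alpha> - cos
  x).\<close>

lemma angle_props:
  shows "(angle has_real_derivative sinh \<alpha> / bip_N x \<alpha>) (at x)"
    and "sin (angle x) = sinh \<alpha> * sin x / bip_N x \<alpha>"
    and "cos (angle x) = (cosh \<alpha> * cos x - 1) / bip_N x \<alpha>"
proof -
  define d w where "d = 1 - rot * cos x" and "w = rot * sin x / (1 - rot * cos x)"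
  have d: "0 < d" using angle_denominator by (simp add: d_def)
  have N: "0 < bip_N x \<alpha>" using bip_N_pos alpha_pos by simp
  \<comment> \<open>\<open>Q\<close> is |1 - r exp(i x)|^2 and \<open>w\<close> is the tangent of
    the argument of 1 - r exp(- i x); the double angle formulas then give both components.\<close>
  define Q where "Q = 2 * rot * bip_N x \<alpha>"
  have Q: "0 < Q" using N rot_bounds by (simp add: Q_def)
  have ss: "(sin x)\<^sup>2 = 1 - (cos x)\<^sup>2" by (simp add: sin_squared_eq)
  have Qe: "Q = 1 + rot\<^sup>2 - 2 * rot * cos x" using rot_hyperbolic by (simp add: Q_def bip_N_def algebra_simps)
  have Qd: "Q = d\<^sup>2 + rot\<^sup>2 * (sin x)\<^sup>2" unfolding Qe d_def ss by algebra
  have wd: "w = rot * sin x / d" by (simp add: w_def d_def)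
  have w2: "1 + w\<^sup>2 = Q / d\<^sup>2" unfolding Qd wd using d by (simp add: power_divide power_mult_distrib add_divide_distrib)
  have w1: "((\<lambda>x. rot * sin x / (1 - rot * cos x)) has_real_derivative (rot * cos x * d - rot\<^sup>2 * (sin x)\<^sup>2) / d\<^sup>2) (at x)"
    using d unfolding d_def by (auto intro!: derivative_eq_intros simp: power2_eq_square algebra_simps)
  have "(angle has_real_derivative 1 + 2 * (inverse (1 + w\<^sup>2) * ((rot * cos x * d - rot\<^sup>2 * (sin x)\<^sup>2) / d\<^sup>2))) (at x)"
    unfolding angle_def w_def by (rule derivative_eq_intros DERIV_chain2[OF DERIV_arctan w1] refl | simp)+
  moreover have "1 + 2 * (inverse (1 + w\<^sup>2) * ((rot * cos x * d - rot\<^sup>2 * (sin x)\<^sup>2) / d\<^sup>2))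
     = (Q + 2 * (rot * cos x * d - rot\<^sup>2 * (sin x)\<^sup>2)) / Q"
    unfolding w2 using d Q by (simp add: field_simps)
  moreover have "Q + 2 * (rot * cos x * d - rot\<^sup>2 * (sin x)\<^sup>2) = 2 * rot * sinh \<alpha>"
    unfolding Qe d_def ss rot_hyperbolic by algebra
  ultimately show "(angle has_real_derivative sinh \<alpha> / bip_N x \<alpha>) (at x)"
    using rot_bounds by (simp add: Q_def)
  have c2: "cos (2 * arctan w) = (d\<^sup>2 - rot\<^sup>2 * (sin x)\<^sup>2) / Q"
  proof -
    have "cos (2 * arctan w) = 2 * (cos (arctan w))\<^sup>2 - 1" by (rule cos_double_cos)
    also have "(cos (arctan w))\<^sup>2 = 1 / (1 + w\<^sup>2)" by (simp add: cos_arctan power_divide add_nonneg_nonneg)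
    also have "1 / (1 + w\<^sup>2) = d\<^sup>2 / Q" unfolding w2 by simp
    also have "2 * (d\<^sup>2 / Q) - 1 = (d\<^sup>2 - rot\<^sup>2 * (sin x)\<^sup>2) / Q" using Q Qd by (simp add: field_simps)
    finally show ?thesis .
  qed
  have s2: "sin (2 * arctan w) = 2 * rot * sin x * d / Q"
  proof -
    have "sin (2 * arctan w) = 2 * (sin (arctan w) * cos (arctan w))" by (simp add: sin_double)
    also have "sin (arctan w) * cos (arctan w) = w / (1 + w\<^sup>2)"
      by (simp add: cos_arctan sin_arctan add_nonneg_nonneg)
    also have "w / (1 + w\<^sup>2) = w / (Q / d\<^sup>2)" by (simp only: w2)
    also have "\<dots> = rot * sin x * d / Q" using d by (simp add: wd power2_eq_square)
    finally show ?thesis by simp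
  qed
  have A: "angle x = x + 2 * arctan w" by (simp add: angle_def w_def)
  have "sin (angle x) = (sin x * (d\<^sup>2 - rot\<^sup>2 * (sin x)\<^sup>2) + cos x * (2 * rot * sin x * d)) / Q"
    unfolding A sin_add c2 s2 by (simp add: add_divide_distrib)
  also have "sin x * (d\<^sup>2 - rot\<^sup>2 * (sin x)\<^sup>2) + cos x * (2 * rot * sin x * d) = 2 * rot * (sinh \<alpha> * sin x)"
    using rot_hyperbolic ss unfolding d_def by algebra
  also have "2 * rot * (sinh \<alpha> * sin x) / Q = sinh \<alpha> * sin x / bip_N x \<alpha>" using rot_bounds by (simp add: Q_def)
  finally show "sin (angle x) = sinh \<alpha> * sin x / bip_N x \<alpha>" .
  have "cos (angle x) = (cos x * (d\<^sup>2 - rot\<^sup>2 * (sin x)\<^sup>2) - sin x * (2 * rot * sin x * d)) / Q"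
    unfolding A cos_add c2 s2 by (simp only: times_divide_eq_right diff_divide_distrib[symmetric])
  also have "cos x * (d\<^sup>2 - rot\<^sup>2 * (sin x)\<^sup>2) - sin x * (2 * rot * sin x * d) = 2 * rot * (cosh \<alpha> * cos x - 1)"
    using rot_hyperbolic ss unfolding d_def by algebra
  also have "2 * rot * (cosh \<alpha> * cos x - 1) / Q = (cosh \<alpha> * cos x - 1) / bip_N x \<alpha>" using rot_bounds by (simp add: Q_def)
  finally show "cos (angle x) = (cosh \<alpha> * cos x - 1) / bip_N x \<alpha>" .
qed

lemma bip_map_angle:
  "bip_map a x \<alpha> = disk_center R q + R *\<^sub>R vector [sin (angle x), cos (angle x)]"
proof -
  have N: "bip_N x \<alpha> \<noteq> 0" using bip_N_pos[of \<alpha> x] alpha_pos by simp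
  have "bip_X a x \<alpha> = R * sin (angle x)" unfolding angle_props bip_X_def a_def by simp
  moreover have "bip_Y a x \<alpha> = R * cosh \<alpha> + R * cos (angle x)"
    unfolding angle_props bip_Y_def a_def using N cosh_sq[of \<alpha>]
    by (simp add: field_simps) (simp add: bip_N_def power2_eq_square algebra_simps)
  ultimately show ?thesis by (simp add: vec_eq_iff forall_2 disk_center_def R_cosh)
qed

lemma bip_tangent:
  "bip_c a x \<alpha> = R * (sinh \<alpha> / bip_N x \<alpha>) * cos (angle x)" "bip_s a x \<alpha> = - R * (sinh \<alpha> / bip_N x \<alpha>) * sin (angle x)"
  unfolding angle_props bip_c_def bip_s_def a_def by (simp_all add: power2_eq_square mult.commute mult.left_commute)

lemma circle_in_closure: "disk_center R q + R *\<^sub>R vector [cos t, sin t] \<in> S"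
proof (unfold closure_approachable, intro allI impI)
  fix e :: real assume e: "0 < e"
  \<comment> \<open>The point is pushed outwards by d. Its height is at least q - d, so d < q keeps
    it above the wall.\<close>
  define d where "d = min q e / 2"
  have d: "0 < d" "d < q" "d < e" using q e by (auto simp: d_def)
  define z where "z = disk_center R q + (R + d) *\<^sub>R vector [cos t, sin t]"
  have n: "norm (vector [cos t, sin t] :: real^2) = 1" by (simp add: norm_vec_def L2_set_def UNIV_2)
  have "dist z (disk_center R q + R *\<^sub>R vector [cos t, sin t]) = norm (d *\<^sub>R (vector [cos t, sin t] :: real^2))"
    by (simp add: z_def dist_norm scaleR_left_distrib)
  then have "dist z (disk_center R q + R *\<^sub>R vector [cos t, sin t]) < e" using d n by simp
  moreover have "z \<in> fluid R q"
  proof -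
    have "dist (disk_center R q) z = norm ((R + d) *\<^sub>R (vector [cos t, sin t] :: real^2))"
      by (simp add: z_def dist_norm)
    then have "R < dist (disk_center R q) z" using n R d by simp
    moreover have "(R + d) * sin t \<ge> (R + d) * (- 1)" using R d by (intro mult_left_mono) auto
    then have "0 < z $ 2" using d by (simp add: z_def disk_center_def)
    ultimately show ?thesis using R by (simp add: fluid_def half_plane_def disk_def)
  qed
  ultimately show "\<exists>z\<in>fluid R q. dist z (disk_center R q + R *\<^sub>R vector [cos t, sin t]) < e" by blast
qed

end

lemma integral_periodic:
  fixes f :: "real \<Rightarrow> 'a::euclidean_space"
  assumes "continuous_on UNIV f" "\<And>t. f (t + 2 * pi) = f t"
  shows "integral {- (pi / 2)..3 * pi / 2} f = integral {0..2 * pi} f"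
proof -
  have i: "f integrable_on {c..d}" for c d
    by (intro integrable_continuous_real continuous_on_subset[OF assms(1)]) simp
  have "integral {- (pi / 2)..0} (\<lambda>t. f (t + 2 * pi)) = integral {- (pi / 2) + 2 * pi..0 + 2 * pi} f"
    by (rule integral_shift[unfolded o_def]) (intro continuous_on_subset[OF assms(1)], simp)
  then have "integral {- (pi / 2)..0} f = integral {3 * pi / 2..2 * pi} f" by (simp add: assms(2))
  moreover have "integral {- (pi / 2)..0} f + integral {0..3 * pi / 2} f = integral {- (pi / 2)..3 * pi / 2} f"
    by (intro Henstock_Kurzweil_Integration.integral_combine i) auto
  moreover have "integral {0..3 * pi / 2} f + integral {3 * pi / 2..2 * pi} f = integral {0..2 * pi} f"
    by (intro Henstock_Kurzweil_Integration.integral_combine i) auto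
  ultimately show ?thesis by (metis add.commute)
qed

section \<open>Traction and drag in bipolar coordinates\<close>

context disk_stokes_flow
begin

definition "traction t = (let n = vector [cos t, sin t]
       in R *\<^sub>R (stress \<nu> R q u p (disk_center R q + R *\<^sub>R n) *v n))"

lemma traction_nth:
  fixes t
  defines "z \<equiv> disk_center R q + R *\<^sub>R vector [cos t, sin t]"
  shows "traction t $ 1 = R * (\<nu> * (2 * D 1 z $ 1 * cos t + (D 2 z $ 1 + D 1 z $ 2) * sin t) - p z * cos t)"
    "traction t $ 2 = R * (\<nu> * ((D 1 z $ 2 + D 2 z $ 1) * cos t + 2 * D 2 z $ 2 * sin t) - p z * sin t)"
proof -
  have J: "jacobian u (at z within S) $ i $ j = D j z $ i" for i j
    by (simp add: jacobian_def matrix_def D_def)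
  show "traction t $ 1 = R * (\<nu> * (2 * D 1 z $ 1 * cos t + (D 2 z $ 1 + D 1 z $ 2) * sin t) - p z * cos t)"
    "traction t $ 2 = R * (\<nu> * ((D 1 z $ 2 + D 2 z $ 1) * cos t + 2 * D 2 z $ 2 * sin t) - p z * sin t)"
    unfolding traction_def Let_def z_def[symmetric] stress_def sym_gradient_def
    by (simp_all add: matrix_vector_mult_def UNIV_2 J transpose_def mat_def algebra_simps)
qed

lemma traction_continuous: "continuous_on UNIV traction"
proof -
  have m: "continuous_on UNIV (\<lambda>t. disk_center R q + R *\<^sub>R vector [cos t, sin t] :: real^2)"
    by (intro continuous_intros)
  have c: "continuous_on UNIV (\<lambda>t. f (disk_center R q + R *\<^sub>R vector [cos t, sin t]))" if "continuous_on S f" for f :: "real^2 \<Rightarrow> 'b::topological_space"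
    by (rule continuous_on_compose2[OF that m]) (auto simp: circle_in_closure)
  note cs = c[OF regularity(5)] c[OF regularity(7)]
  have "continuous_on UNIV (\<lambda>t. traction t $ 1)" "continuous_on UNIV (\<lambda>t. traction t $ 2)"
    unfolding traction_nth by (intro continuous_intros cs)+
  then have "continuous_on UNIV (\<lambda>t. vector [traction t $ 1, traction t $ 2] :: real^2)" by (rule continuous_on_vector2)
  then show ?thesis by simp
qed

text \<open>The factor sinh \<alpha> / \<open>bip_N\<close> is the derivative of
  \<open>angle\<close>, which makes the left side the force per unit of x. Increasing x runs
  clockwise around the disk, and then (dY, - dX) is the inward normal; hence the minus sign in front
  of the stress form.\<close>

lemma traction_pullback:
  "(sinh \<alpha> / bip_N x \<alpha>) * traction (pi / 2 - angle x) $ 1 = - (- Pr x \<alpha> * bip_s a x \<alpha> + \<nu> * (Uy 1 x \<alpha> - Ux 2 x \<alpha>))"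
  "(sinh \<alpha> / bip_N x \<alpha>) * traction (pi / 2 - angle x) $ 2 = - (Pr x \<alpha> * bip_c a x \<alpha> + \<nu> * (Ux 1 x \<alpha> + Uy 2 x \<alpha>))"
proof -
  have c: "cos (pi / 2 - angle x) = sin (angle x)" "sin (pi / 2 - angle x) = cos (angle x)"
    by (simp_all add: cos_diff sin_diff)
  have "0 < bip_N x \<alpha>" using bip_N_pos alpha_pos by simp
  then have dv: "D 1 (bip_map a x \<alpha>) $ 1 + D 2 (bip_map a x \<alpha>) $ 2 = 0"
    using alpha_pos by (intro divergence_closure bip_map_closure) auto
  define z T where "z = bip_map a x \<alpha>" and "T = sinh \<alpha> / bip_N x \<alpha>"
  show "(sinh \<alpha> / bip_N x \<alpha>) * traction (pi / 2 - angle x) $ 1 = - (- Pr x \<alpha> * bip_s a x \<alpha> + \<nu> * (Uy 1 x \<alpha> - Ux 2 x \<alpha>))"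
    unfolding traction_nth c bip_map_angle[symmetric] Pr_def Ux_def Uy_def bip_tangent T_def[symmetric] z_def[symmetric]
    using dv[folded z_def] by algebra
  show "(sinh \<alpha> / bip_N x \<alpha>) * traction (pi / 2 - angle x) $ 2 = - (Pr x \<alpha> * bip_c a x \<alpha> + \<nu> * (Ux 1 x \<alpha> + Uy 2 x \<alpha>))"
    unfolding traction_nth c bip_map_angle[symmetric] Pr_def Ux_def Uy_def bip_tangent T_def[symmetric] z_def[symmetric]
    using dv[folded z_def] by algebra
qed

text \<open>The substitution t = pi / 2 - \<open>angle\<close> x turns the clockwise angle from the
  top into the counterclockwise angle of \<open>drag_force\<close>. It runs backwards over
  [- pi / 2, 3 pi / 2], and periodicity of the traction moves this interval to [0, 2 pi].\<close>

lemma drag_pullback: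
  "drag_force \<nu> R q u p $ 1 = - integral {- pi..pi} (\<lambda>x. - Pr x \<alpha> * bip_s a x \<alpha> + \<nu> * (Uy 1 x \<alpha> - Ux 2 x \<alpha>))"
  "drag_force \<nu> R q u p $ 2 = - integral {- pi..pi} (\<lambda>x. Pr x \<alpha> * bip_c a x \<alpha> + \<nu> * (Ux 1 x \<alpha> + Uy 2 x \<alpha>))"
proof -
  have ends: "angle pi = pi" "angle (- pi) = - pi" by (simp_all add: angle_def)
  have "((\<lambda>x. (- (sinh \<alpha> / bip_N x \<alpha>)) *\<^sub>R traction (pi / 2 - angle x)) has_integral
     (integral {pi / 2 - angle (- pi)..pi / 2 - angle pi} traction
       - integral {pi / 2 - angle pi..pi / 2 - angle (- pi)} traction)) {- pi..pi}"
  \<comment> \<open>\<open>angle\<close> differs from the identity by at most pi, so the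
    substitution has values in [- 3 pi / 2, 5 pi / 2], which the chosen interval contains with room
    to spare.\<close>
  proof (rule has_integral_substitution_general[where s = "{}" and c = "- 3 * pi" and d = "4 * pi"])
    have "\<bar>2 * arctan w\<bar> \<le> pi" for w using arctan_bounded[of w] by (simp add: abs_le_iff)
    then have "\<bar>angle x - x\<bar> \<le> pi" for x by (simp add: angle_def)
    then show "(\<lambda>x. pi / 2 - angle x) ` {- pi..pi} \<subseteq> {- 3 * pi..4 * pi}"
      by (auto simp: abs_le_iff) (smt (verit) pi_gt_zero field_sum_of_halves)+
    show "((\<lambda>x. pi / 2 - angle x) has_real_derivative - (sinh \<alpha> / bip_N x \<alpha>)) (at x within {- pi..pi})" for x
      by (auto intro!: derivative_eq_intros has_field_derivative_at_within[OF angle_props(1)])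
    show "continuous_on {- pi..pi} (\<lambda>x. pi / 2 - angle x)"
      by (intro continuous_intros DERIV_continuous_on[OF has_field_derivative_at_within[OF angle_props(1)]])
  qed (auto intro: continuous_on_subset[OF traction_continuous])
  then have "((\<lambda>x. (- (sinh \<alpha> / bip_N x \<alpha>)) *\<^sub>R traction (pi / 2 - angle x)) has_integral
     - integral {- (pi / 2)..3 * pi / 2} traction) {- pi..pi}"
    by (simp add: ends)
  moreover have "integral {- (pi / 2)..3 * pi / 2} traction = drag_force \<nu> R q u p"
    unfolding drag_force_def traction_def[symmetric]
    by (rule integral_periodic[OF traction_continuous]) (simp add: traction_def)
  ultimately have I: "((\<lambda>x. (- (sinh \<alpha> / bip_N x \<alpha>)) *\<^sub>R traction (pi / 2 - angle x)) has_integral - drag_force \<nu> R q u p) {- pi..pi}"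
    by simp
  have "((\<lambda>x. ((- (sinh \<alpha> / bip_N x \<alpha>)) *\<^sub>R traction (pi / 2 - angle x)) $ k) has_integral (- drag_force \<nu> R q u p) $ k) {- pi..pi}" for k
    using has_integral_linear[OF I bounded_linear_vec_nth] by (simp only: o_def)
  moreover have "((- (sinh \<alpha> / bip_N x \<alpha>)) *\<^sub>R traction (pi / 2 - angle x)) $ 1
       = - Pr x \<alpha> * bip_s a x \<alpha> + \<nu> * (Uy 1 x \<alpha> - Ux 2 x \<alpha>)"
    "((- (sinh \<alpha> / bip_N x \<alpha>)) *\<^sub>R traction (pi / 2 - angle x)) $ 2
       = Pr x \<alpha> * bip_c a x \<alpha> + \<nu> * (Ux 1 x \<alpha> + Uy 2 x \<alpha>)" for x
    unfolding vector_scaleR_component real_scaleR_def mult_minus_left traction_pullback by simp_all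
  ultimately have c: "((\<lambda>x. - Pr x \<alpha> * bip_s a x \<alpha> + \<nu> * (Uy 1 x \<alpha> - Ux 2 x \<alpha>)) has_integral (- drag_force \<nu> R q u p) $ 1) {- pi..pi}"
    "((\<lambda>x. Pr x \<alpha> * bip_c a x \<alpha> + \<nu> * (Ux 1 x \<alpha> + Uy 2 x \<alpha>)) has_integral (- drag_force \<nu> R q u p) $ 2) {- pi..pi}"
    by (metis (no_types, lifting) has_integral_cong)+
  show "drag_force \<nu> R q u p $ 1 = - integral {- pi..pi} (\<lambda>x. - Pr x \<alpha> * bip_s a x \<alpha> + \<nu> * (Uy 1 x \<alpha> - Ux 2 x \<alpha>))"
    "drag_force \<nu> R q u p $ 2 = - integral {- pi..pi} (\<lambda>x. Pr x \<alpha> * bip_c a x \<alpha> + \<nu> * (Ux 1 x \<alpha> + Uy 2 x \<alpha>))"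
    using integral_unique[OF c(1)] integral_unique[OF c(2)] by simp_all
qed

text \<open>The perpendicular test flow selects the vertical component, with coefficient -4 \<nu> A
  = 2 \<nu> / (\<alpha> - tanh \<alpha>); the parallel one selects the horizontal component, with
  coefficient 0.\<close>

theorem drag_formula: "drag_force \<nu> R q u p = - ((4 * pi * \<nu> / (\<alpha> - tanh \<alpha>)) *\<^sub>R (V *\<^sub>R e2))"
proof -
  obtain M where "bipolar_flow a \<alpha> \<nu> V M (U 1) (U 2) Pr (Ux 1) (Uy 1) (Ux 2) (Uy 2) Prx Pry
     (Uxx 1) (Uxy 1) (Uyy 1) (Uxx 2) (Uxy 2) (Uyy 2)" by (rule bipolar_flow_instance)
  then interpret flow: bipolar_flow a \<alpha> \<nu> V M "U 1" "U 2" Pr "Ux 1" "Uy 1" "Ux 2" "Uy 2" Prx Pry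
     "Uxx 1" "Uxy 1" "Uyy 1" "Uxx 2" "Uxy 2" "Uyy 2" .
  interpret perp: perp_params a \<alpha> \<nu> by unfold_locales (use a_pos alpha_pos nu in auto)
  interpret para: para_params a \<alpha> \<nu> by unfold_locales (use a_pos alpha_pos nu in auto)
  interpret perp: bipolar_test_flow a \<alpha> \<nu> perp.K 0 "- 4 * \<nu> * perp.A" 0 1 perp.v1 perp.v2 perp.\<psi> perp.H1 perp.H2 perp.pr
    perp.v1x perp.v1y perp.v2x perp.v2y by (rule perp.test_flow)
  interpret para: bipolar_test_flow a \<alpha> \<nu> para.K "2 * \<nu> / \<alpha>" 0 1 0 para.v1 para.v2 para.\<psi> para.H1 para.H2 para.pr
    para.v1x para.v1y para.v2x para.v2y by (rule para.test_flow)
  interpret perp: reciprocity a \<alpha> \<nu> V M "U 1" "U 2" Pr "Ux 1" "Uy 1" "Ux 2" "Uy 2" Prx Pry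
     "Uxx 1" "Uxy 1" "Uyy 1" "Uxx 2" "Uxy 2" "Uyy 2" perp.K 0 "- 4 * \<nu> * perp.A" 0 1 perp.v1 perp.v2 perp.\<psi> perp.H1 perp.H2 perp.pr
    perp.v1x perp.v1y perp.v2x perp.v2y ..
  interpret para: reciprocity a \<alpha> \<nu> V M "U 1" "U 2" Pr "Ux 1" "Uy 1" "Ux 2" "Uy 2" Prx Pry
     "Uxx 1" "Uxy 1" "Uyy 1" "Uxx 2" "Uxy 2" "Uyy 2" para.K "2 * \<nu> / \<alpha>" 0 1 0 para.v1 para.v2 para.\<psi> para.H1 para.H2 para.pr
    para.v1x para.v1y para.v2x para.v2y ..
  have "drag_force \<nu> R q u p $ 1 = 0"
    using para.boundary_flux by (simp add: drag_pullback)
  moreover have "drag_force \<nu> R q u p $ 2 = - (4 * pi * \<nu> / (\<alpha> - tanh \<alpha>) * V)"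
  proof -
    have "drag_force \<nu> R q u p $ 2 = 8 * pi * \<nu> * perp.A * V"
      using perp.boundary_flux by (simp add: drag_pullback)
    also have "\<dots> = - (4 * pi * \<nu> / (\<alpha> - tanh \<alpha>) * V)"
      using perp.denominator by (simp add: perp.A_def field_simps)
    finally show ?thesis .
  qed
  ultimately show ?thesis by (simp add: vec_eq_iff forall_2 e2_def axis_def)
qed

end

section \<open>The limit of small gaps\<close>

theorem theorem8:
  fixes \<nu> R :: real
  assumes "\<nu> > 0" and "R > 0"
  shows "\<exists>(n :: real \<Rightarrow> real) (\<epsilon> :: real \<Rightarrow> real).
           (\<forall>q>0. \<forall>V u p. stokes_solution \<nu> R q V u p \<longrightarrow>
                drag_force \<nu> R q u p = - (n q *\<^sub>R (V *\<^sub>R e2))) \<and>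
           (\<forall>q>0. n q = 3 * sqrt 2 * pi * \<nu> * (R / q) powr (3 / 2) * (1 + \<epsilon> q)) \<and>
           (\<epsilon> \<longlongrightarrow> 0) (at_right 0)"
proof -
  define al where "al s = arcosh (1 + s)" for s :: real
  define n where "n q = 4 * pi * \<nu> / (al (q / R) - tanh (al (q / R)))" for q
  \<comment> \<open>Obtained by solving the required formula for the error in terms of s = q / R;
    the formula is then exact for every q, and all content lies in the limit.\<close>
  define e where "e s = 4 / (3 * sqrt 2) * (s powr (3 / 2) / (al s - tanh (al s))) - 1" for s :: real
  have "drag_force \<nu> R q u p = - (n q *\<^sub>R (V *\<^sub>R e2))" if "q > 0" "stokes_solution \<nu> R q V u p" for q V u p
  proof -
    interpret disk_stokes_flow R q \<nu> V u p by unfold_locales (use assms that in auto)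
    show ?thesis using drag_formula by (simp add: n_def al_def \<alpha>_def)
  qed
  moreover have "n q = 3 * sqrt 2 * pi * \<nu> * (R / q) powr (3 / 2) * (1 + e (q / R))" if "q > 0" for q
  proof -
    have inv: "(R / q) powr (3 / 2) * (q / R) powr (3 / 2) = 1"
      using that assms by (simp add: powr_mult[symmetric])
    have simplify: "3 * s * pi * \<nu> * P * (1 + (4 / (3 * s) * (W / D) - 1)) = 4 * pi * \<nu> * (P * W) / D"
      if "s \<noteq> 0" for s P W D :: real using that by simp
    have "sqrt 2 \<noteq> 0" by simp
    from simplify[OF this] show ?thesis unfolding n_def e_def by (simp only: inv mult_1_right)
  qed
  moreover have "((\<lambda>q. e (q / R)) \<longlongrightarrow> 0) (at_right 0)"
  proof (rule filterlim_compose[where g = e])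
    show "filterlim (\<lambda>q. q / R) (at_right 0) (at_right 0)"
      using assms by real_asymp
    \<comment> \<open>This is \<open>e\<close> in the variable t = arcosh(1 + s): here s = 2 (sinh(t
      / 2))^2, so s^(3/2) is 2 sqrt 2 (sinh(t / 2))^3, and 2 sqrt 2 times 4 / (3 sqrt 2) is 8 / 3.
      Hyperbolic functions are spelled out as exponentials so that \<open>real_asymp\<close> can
      expand the quotient.\<close>
    define f where "f t = 8 / 3 * ((exp (t / 2) - exp (- t / 2)) / 2) ^ 3 / (t - (exp t - exp (- t)) / (exp t + exp (- t))) - 1" for t :: real
    have "(f \<longlongrightarrow> 0) (at_right 0)" unfolding f_def by real_asymp (simp add: power3_eq_cube)
    moreover have "filterlim al (at_right 0) (at_right 0)"
    proof (rule tendsto_imp_filterlim_at_right)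
      have "filterlim (\<lambda>s :: real. 1 + s) (at_right 1) (at_right 0)" by real_asymp
      then show "(al \<longlongrightarrow> 0) (at_right 0)"
        unfolding al_def by (rule filterlim_compose[OF tendsto_arcosh_at_left_1])
      show "\<forall>\<^sub>F s in at_right 0. 0 < al s"
        using eventually_at_right_less[of "0 :: real"] by eventually_elim (simp add: al_def)
    qed
    ultimately have "((\<lambda>s. f (al s)) \<longlongrightarrow> 0) (at_right 0)" by (rule filterlim_compose)
    moreover have "\<forall>\<^sub>F s in at_right 0. f (al s) = e s"
      using eventually_at_right_less[of "0 :: real"]
    proof eventually_elim
      case (elim s)
      define t where "t = al s"
      have t: "0 < t" using elim by (simp add: t_def al_def)
      define w where "w = sinh (t / 2)"
      have w: "0 < w" using t by (simp add: w_def)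
      have "cosh t = 1 + s" using elim by (simp add: t_def al_def)
      moreover have "cosh t = 2 * w\<^sup>2 + 1"
        using cosh_add[of "t / 2" "t / 2"] cosh_sq[of "t / 2"] by (simp add: w_def power2_eq_square)
      ultimately have s: "s = 2 * w\<^sup>2" by simp
      have "s powr (3 / 2) = sqrt s ^ 3"
        using elim by (simp add: powr_half_sqrt[symmetric] powr_powr flip: powr_numeral)
      also have "sqrt s ^ 3 = 2 * sqrt 2 * w ^ 3"
        using w by (simp add: s real_sqrt_mult power_mult_distrib power3_eq_cube)
      finally have p: "s powr (3 / 2) = 2 * sqrt 2 * w ^ 3" .
      have "f t = 8 / 3 * w ^ 3 / (t - tanh t) - 1"
        by (simp add: f_def w_def sinh_field_def tanh_altdef)
      then show ?case unfolding e_def p t_def[symmetric] by simp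
    qed
    ultimately show "(e \<longlongrightarrow> 0) (at_right 0)" by (rule Lim_transform_eventually)
  qed
  ultimately show ?thesis by (intro exI[of _ n] exI[of _ "\<lambda>q. e (q / R)"]) auto
qed

end
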